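(* Let $F$ be a field and let $A$ be a semiassociative $F$-algebra. Then the semisimple quotient of the nucleus, $\sigma(A)=\mathfrak{N}(A)/\mathrm{J}(\mathfrak{N}(A))$, is a separable $F$-algebra.
   Context: Algebras are unital and not necessarily associative. The associator is $(x,y,z)=(xy)z-x(yz)$; the nucleus $\mathfrak{N}(A)$ is the set of $x\in A$ with $(x,A,A)=(A,x,A)=(A,A,x)=0$, an associative subalgebra; $\mathrm{J}(\cdot)$ denotes the Jacobson radical. The center is $Z(A)=\{x\in\mathfrak{N}(A):xa=ax\text{ for all }a\in A\}$; $A$ is $F$-central if $Z(A)=F$. An étale $F$-algebra is a finite direct product of finite separable field extensions of $F$. A module over an associative ring is minimally faithful if it is faithful and has no faithful proper section (quotient of submodules). A finite dimensional $F$-central algebra $A$ is semiassociative if there is an étale $F$-subalgebra $K\subseteq\mathfrak{N}(A)$ (containing $1_A$) such that $A$ is minimally faithful (equivalently, faithful and cyclic) as a $K\otimes_F K$-module via $(k\otimes k')a=kak'$. An associative $F$-algebra $R$ is separable if $R$ is projective as a module over $R\otimes_F R^{\mathrm{op}}$; a finite dimensional algebra is separable if and only if it is semisimple and its center is étale over $F$. *)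

theory Defs
  imports
    "HOL-Library.Poly_Mapping"
    "HOL-Computational_Algebra.Polynomial"
    "HOL-Algebra.Module"
    "HOL-Algebra.QuotRing"
begin

text \<open>
  The base field is a type of class \<open>field\<close>. Algebras over it are \<open>module\<close> records, which carry
  a multiplication and a unit besides the module operations. For a record that only serves as
  a module, the fields \<open>mult\<close> and \<open>one\<close> are irrelevant.
\<close>

section \<open>Algebras\<close>

locale nonassoc_algebra = abelian_group A
  for A :: "('f::field, 'a) module" (structure) +
  assumes m_closed: "\<lbrakk>x \<in> carrier A; y \<in> carrier A\<rbrakk> \<Longrightarrow> x \<otimes> y \<in> carrier A"
    and one_closed: "\<one> \<in> carrier A"
    and smult_closed: "x \<in> carrier A \<Longrightarrow> c \<odot> x \<in> carrier A"
    and l_one: "x \<in> carrier A \<Longrightarrow> \<one> \<otimes> x = x"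
    and r_one: "x \<in> carrier A \<Longrightarrow> x \<otimes> \<one> = x"
    and l_distr: "\<lbrakk>x \<in> carrier A; y \<in> carrier A; z \<in> carrier A\<rbrakk>
      \<Longrightarrow> (x \<oplus> y) \<otimes> z = x \<otimes> z \<oplus> y \<otimes> z"
    and r_distr: "\<lbrakk>x \<in> carrier A; y \<in> carrier A; z \<in> carrier A\<rbrakk>
      \<Longrightarrow> z \<otimes> (x \<oplus> y) = z \<otimes> x \<oplus> z \<otimes> y"
    and smult_l_distr: "x \<in> carrier A \<Longrightarrow> (c + d) \<odot> x = c \<odot> x \<oplus> d \<odot> x"
    and smult_r_distr: "\<lbrakk>x \<in> carrier A; y \<in> carrier A\<rbrakk> \<Longrightarrow> c \<odot> (x \<oplus> y) = c \<odot> x \<oplus> c \<odot> y"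
    and smult_assoc: "x \<in> carrier A \<Longrightarrow> (c * d) \<odot> x = c \<odot> (d \<odot> x)"
    and smult_one: "x \<in> carrier A \<Longrightarrow> 1 \<odot> x = x"
    and smult_mult_l: "\<lbrakk>x \<in> carrier A; y \<in> carrier A\<rbrakk> \<Longrightarrow> (c \<odot> x) \<otimes> y = c \<odot> (x \<otimes> y)"
    and smult_mult_r: "\<lbrakk>x \<in> carrier A; y \<in> carrier A\<rbrakk> \<Longrightarrow> x \<otimes> (c \<odot> y) = c \<odot> (x \<otimes> y)"

locale assoc_algebra = nonassoc_algebra A + ring A
  for A :: "('f::field, 'a) module" (structure)

definition finite_dimensional_algebra :: "('f::field, 'a) module \<Rightarrow> bool" where
  "finite_dimensional_algebra A \<longleftrightarrow>
     (\<exists>B. finite B \<and> B \<subseteq> carrier A \<and>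
        (\<forall>x\<in>carrier A. \<exists>c. x = (\<Oplus>\<^bsub>A\<^esub>b\<in>B. c b \<odot>\<^bsub>A\<^esub> b)))"

definition subalgebra_of :: "'a set \<Rightarrow> ('f::field, 'a) module \<Rightarrow> bool" where
  "subalgebra_of K A \<longleftrightarrow>
     K \<subseteq> carrier A \<and> \<one>\<^bsub>A\<^esub> \<in> K \<and>
     (\<forall>x\<in>K. \<forall>y\<in>K. x \<oplus>\<^bsub>A\<^esub> y \<in> K \<and> x \<otimes>\<^bsub>A\<^esub> y \<in> K) \<and>
     (\<forall>c. \<forall>x\<in>K. c \<odot>\<^bsub>A\<^esub> x \<in> K)"

definition algebra_hom :: "('f::field, 'a) module \<Rightarrow> ('f, 'b) module \<Rightarrow> ('a \<Rightarrow> 'b) set" where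
  "algebra_hom A B =
     {h \<in> ring_hom A B. \<forall>c. \<forall>x\<in>carrier A. h (c \<odot>\<^bsub>A\<^esub> x) = c \<odot>\<^bsub>B\<^esub> h x}"

definition algebra_iso :: "('f::field, 'a) module \<Rightarrow> ('f, 'b) module \<Rightarrow> ('a \<Rightarrow> 'b) set" where
  "algebra_iso A B = {h \<in> algebra_hom A B. bij_betw h (carrier A) (carrier B)}"

definition opposite_algebra :: "('f, 'a) module \<Rightarrow> ('f, 'a) module" where
  "opposite_algebra A = A\<lparr>mult := \<lambda>x y. y \<otimes>\<^bsub>A\<^esub> x\<rparr>"

definition associator :: "('f, 'a) module \<Rightarrow> 'a \<Rightarrow> 'a \<Rightarrow> 'a \<Rightarrow> 'a" where
  "associator A x y z = ((x \<otimes>\<^bsub>A\<^esub> y) \<otimes>\<^bsub>A\<^esub> z) \<ominus>\<^bsub>A\<^esub> (x \<otimes>\<^bsub>A\<^esub> (y \<otimes>\<^bsub>A\<^esub> z))"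

definition nucleus :: "('f, 'a) module \<Rightarrow> 'a set" where
  "nucleus A = {x \<in> carrier A. \<forall>a\<in>carrier A. \<forall>b\<in>carrier A.
     associator A x a b = \<zero>\<^bsub>A\<^esub> \<and> associator A a x b = \<zero>\<^bsub>A\<^esub> \<and> associator A a b x = \<zero>\<^bsub>A\<^esub>}"

definition algebra_center :: "('f, 'a) module \<Rightarrow> 'a set" where
  "algebra_center A = {x \<in> nucleus A. \<forall>a\<in>carrier A. x \<otimes>\<^bsub>A\<^esub> a = a \<otimes>\<^bsub>A\<^esub> x}"

text \<open>The condition that the unit is nonzero makes the base field embed into the algebra.\<close>

definition central_algebra :: "('f::field, 'a) module \<Rightarrow> bool" where
  "central_algebra A \<longleftrightarrow>
     \<one>\<^bsub>A\<^esub> \<noteq> \<zero>\<^bsub>A\<^esub> \<and> algebra_center A = {c \<odot>\<^bsub>A\<^esub> \<one>\<^bsub>A\<^esub> | c. True}"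


section \<open>Modules over associative rings\<close>

text \<open>The library's locale \<open>module\<close> requires a commutative base ring.\<close>

locale left_module = ring R + M?: abelian_group M
  for R :: "('r, 'c) ring_scheme" (structure) and M :: "('r, 'm, 'd) module_scheme" (structure) +
  assumes lm_smult_closed: "\<lbrakk>r \<in> carrier R; x \<in> carrier M\<rbrakk> \<Longrightarrow> r \<odot>\<^bsub>M\<^esub> x \<in> carrier M"
    and lm_smult_l_distr: "\<lbrakk>r \<in> carrier R; s \<in> carrier R; x \<in> carrier M\<rbrakk>
      \<Longrightarrow> (r \<oplus> s) \<odot>\<^bsub>M\<^esub> x = r \<odot>\<^bsub>M\<^esub> x \<oplus>\<^bsub>M\<^esub> s \<odot>\<^bsub>M\<^esub> x"
    and lm_smult_r_distr: "\<lbrakk>r \<in> carrier R; x \<in> carrier M; y \<in> carrier M\<rbrakk>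
      \<Longrightarrow> r \<odot>\<^bsub>M\<^esub> (x \<oplus>\<^bsub>M\<^esub> y) = r \<odot>\<^bsub>M\<^esub> x \<oplus>\<^bsub>M\<^esub> r \<odot>\<^bsub>M\<^esub> y"
    and lm_smult_assoc: "\<lbrakk>r \<in> carrier R; s \<in> carrier R; x \<in> carrier M\<rbrakk>
      \<Longrightarrow> (r \<otimes> s) \<odot>\<^bsub>M\<^esub> x = r \<odot>\<^bsub>M\<^esub> (s \<odot>\<^bsub>M\<^esub> x)"
    and lm_smult_one: "x \<in> carrier M \<Longrightarrow> \<one> \<odot>\<^bsub>M\<^esub> x = x"

definition left_module_hom ::
    "('r, 'c) ring_scheme \<Rightarrow> ('r, 'm) module \<Rightarrow> ('r, 'n) module \<Rightarrow> ('m \<Rightarrow> 'n) set" where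
  "left_module_hom R M N = {h \<in> carrier M \<rightarrow> carrier N.
     (\<forall>x\<in>carrier M. \<forall>y\<in>carrier M. h (x \<oplus>\<^bsub>M\<^esub> y) = h x \<oplus>\<^bsub>N\<^esub> h y) \<and>
     (\<forall>r\<in>carrier R. \<forall>x\<in>carrier M. h (r \<odot>\<^bsub>M\<^esub> x) = r \<odot>\<^bsub>N\<^esub> h x)}"

text \<open>
  The quotient on the set of cosets; depending on what \<open>I\<close> is, a quotient module or a quotient
  algebra.
\<close>

definition quotient_module :: "('r, 'm) module \<Rightarrow> 'm set \<Rightarrow> ('r, 'm set) module" where
  "quotient_module M I =
     ring.extend (M Quot I) (module.fields (\<lambda>r X. \<Union>x\<in>X. I +>\<^bsub>M\<^esub> (r \<odot>\<^bsub>M\<^esub> x)))"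

definition faithful_module :: "('r, 'c) ring_scheme \<Rightarrow> ('r, 'm) module \<Rightarrow> bool" where
  "faithful_module R M \<longleftrightarrow>
     (\<forall>r\<in>carrier R. (\<forall>x\<in>carrier M. r \<odot>\<^bsub>M\<^esub> x = \<zero>\<^bsub>M\<^esub>) \<longrightarrow> r = \<zero>\<^bsub>R\<^esub>)"

text \<open>A section of \<open>M\<close> is a quotient \<open>N / L\<close> of submodules; it is proper unless \<open>N = M\<close> and \<open>L = 0\<close>.\<close>

definition minimally_faithful :: "('r, 'c) ring_scheme \<Rightarrow> ('r, 'm) module \<Rightarrow> bool" where
  "minimally_faithful R M \<longleftrightarrow>
     faithful_module R M \<and>
     (\<forall>N L. submodule N R M \<and> submodule L R M \<and> L \<subseteq> N \<and>
        faithful_module R (quotient_module (M\<lparr>carrier := N\<rparr>) L) \<longrightarrow>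
        N = carrier M \<and> L = {\<zero>\<^bsub>M\<^esub>})"

definition free_module :: "('r, 'c) ring_scheme \<Rightarrow> 'i set \<Rightarrow> ('r, 'i \<Rightarrow> 'r) module" where
  "free_module R I =
     \<lparr>carrier = {f. (\<forall>i. f i \<in> carrier R) \<and> (\<forall>i. i \<notin> I \<longrightarrow> f i = \<zero>\<^bsub>R\<^esub>) \<and>
                    finite {i. f i \<noteq> \<zero>\<^bsub>R\<^esub>}},
      mult = undefined, one = undefined,
      zero = (\<lambda>_. \<zero>\<^bsub>R\<^esub>), add = (\<lambda>f g i. f i \<oplus>\<^bsub>R\<^esub> g i),
      smult = (\<lambda>r f i. r \<otimes>\<^bsub>R\<^esub> f i)\<rparr>"

text \<open>
  Projective means: isomorphic to a direct summand, i.e. a retract, of a free module. Restricting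
  the index set to the element type of \<open>M\<close> loses nothing, as a projective \<open>M\<close> is a retract
  of the free module on its own carrier.
\<close>

definition projective_module :: "('r, 'c) ring_scheme \<Rightarrow> ('r, 'm) module \<Rightarrow> bool" where
  "projective_module R M \<longleftrightarrow>
     left_module R M \<and>
     (\<exists>(I :: 'm set) s p.
        s \<in> left_module_hom R M (free_module R I) \<and>
        p \<in> left_module_hom R (free_module R I) M \<and>
        (\<forall>x\<in>carrier M. p (s x) = x))"

definition left_ideal :: "'a set \<Rightarrow> ('a, 'c) ring_scheme \<Rightarrow> bool" where
  "left_ideal I R \<longleftrightarrow>
     additive_subgroup I R \<and> (\<forall>r\<in>carrier R. \<forall>x\<in>I. r \<otimes>\<^bsub>R\<^esub> x \<in> I)"

definition maximal_left_ideal :: "'a set \<Rightarrow> ('a, 'c) ring_scheme \<Rightarrow> bool" where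
  "maximal_left_ideal I R \<longleftrightarrow>
     left_ideal I R \<and> I \<noteq> carrier R \<and>
     (\<forall>J. left_ideal J R \<and> I \<subseteq> J \<longrightarrow> J = I \<or> J = carrier R)"

definition jacobson_radical :: "('a, 'c) ring_scheme \<Rightarrow> 'a set" where
  "jacobson_radical R = carrier R \<inter> \<Inter>{I. maximal_left_ideal I R}"


section \<open>Tensor products of algebras\<close>

text \<open>
  The tensor product of \<open>R\<close> and \<open>S\<close> is the free vector space on \<open>carrier R \<times> carrier S\<close>, with the
  componentwise multiplication of basis elements, modulo the span of the bilinearity relations.
  The basis element \<open>(x, y)\<close> is \<open>Poly_Mapping.single (x, y) 1\<close>.
\<close>

definition pair_algebra ::
    "('f::field, 'a) module \<Rightarrow> ('f, 'b) module \<Rightarrow> ('f, ('a \<times> 'b) \<Rightarrow>\<^sub>0 'f) module" where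
  "pair_algebra R S =
     \<lparr>carrier = {f. Poly_Mapping.keys f \<subseteq> carrier R \<times> carrier S},
      mult = (\<lambda>f g. \<Sum>(x, y)\<in>Poly_Mapping.keys f. \<Sum>(x', y')\<in>Poly_Mapping.keys g.
        Poly_Mapping.single (x \<otimes>\<^bsub>R\<^esub> x', y \<otimes>\<^bsub>S\<^esub> y')
          (Poly_Mapping.lookup f (x, y) * Poly_Mapping.lookup g (x', y'))),
      one = Poly_Mapping.single (\<one>\<^bsub>R\<^esub>, \<one>\<^bsub>S\<^esub>) 1,
      zero = 0, add = (+),
      smult = (\<lambda>c. Poly_Mapping.map ((*) c))\<rparr>"

inductive_set tensor_relations ::
    "('f::field, 'a) module \<Rightarrow> ('f, 'b) module \<Rightarrow> (('a \<times> 'b) \<Rightarrow>\<^sub>0 'f) set"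
  for R :: "('f::field, 'a) module" and S :: "('f, 'b) module" where
    zero: "0 \<in> tensor_relations R S"
  | add: "\<lbrakk>f \<in> tensor_relations R S; g \<in> tensor_relations R S\<rbrakk> \<Longrightarrow> f + g \<in> tensor_relations R S"
  | scale: "f \<in> tensor_relations R S \<Longrightarrow> Poly_Mapping.map ((*) c) f \<in> tensor_relations R S"
  | add_left: "\<lbrakk>x \<in> carrier R; x' \<in> carrier R; y \<in> carrier S\<rbrakk> \<Longrightarrow>
      Poly_Mapping.single (x \<oplus>\<^bsub>R\<^esub> x', y) 1
        - (Poly_Mapping.single (x, y) 1 + Poly_Mapping.single (x', y) 1) \<in> tensor_relations R S"
  | add_right: "\<lbrakk>x \<in> carrier R; y \<in> carrier S; y' \<in> carrier S\<rbrakk> \<Longrightarrow>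
      Poly_Mapping.single (x, y \<oplus>\<^bsub>S\<^esub> y') 1
        - (Poly_Mapping.single (x, y) 1 + Poly_Mapping.single (x, y') 1) \<in> tensor_relations R S"
  | smult_left: "\<lbrakk>x \<in> carrier R; y \<in> carrier S\<rbrakk> \<Longrightarrow>
      Poly_Mapping.single (c \<odot>\<^bsub>R\<^esub> x, y) 1 - Poly_Mapping.single (x, y) c \<in> tensor_relations R S"
  | smult_right: "\<lbrakk>x \<in> carrier R; y \<in> carrier S\<rbrakk> \<Longrightarrow>
      Poly_Mapping.single (x, c \<odot>\<^bsub>S\<^esub> y) 1 - Poly_Mapping.single (x, y) c \<in> tensor_relations R S"

definition tensor_algebra ::
    "('f::field, 'a) module \<Rightarrow> ('f, 'b) module \<Rightarrow> ('f, (('a \<times> 'b) \<Rightarrow>\<^sub>0 'f) set) module" where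
  "tensor_algebra R S = quotient_module (pair_algebra R S) (tensor_relations R S)"

text \<open>
  The action \<open>(k \<otimes> k') a = k a k'\<close>. A tensor is a coset of formal sums; the value does not depend
  on the representative chosen.
\<close>

definition two_sided_module ::
    "('f::field, 'a) module \<Rightarrow> ((('a \<times> 'a) \<Rightarrow>\<^sub>0 'f) set, 'a) module" where
  "two_sided_module A =
     \<lparr>carrier = carrier A, mult = undefined, one = undefined, zero = zero A, add = add A,
      smult = (\<lambda>T a. let f = (SOME f. f \<in> T) in
        \<Oplus>\<^bsub>A\<^esub>p\<in>Poly_Mapping.keys f.
          Poly_Mapping.lookup f p \<odot>\<^bsub>A\<^esub> ((fst p \<otimes>\<^bsub>A\<^esub> a) \<otimes>\<^bsub>A\<^esub> snd p))\<rparr>"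

definition separable_algebra :: "('f::field, 'a) module \<Rightarrow> bool" where
  "separable_algebra R \<longleftrightarrow>
     assoc_algebra R \<and>
     projective_module (tensor_algebra R (opposite_algebra R)) (two_sided_module R)"


section \<open>Etale algebras\<close>

definition poly_at :: "('f::field, 'a) module \<Rightarrow> 'f poly \<Rightarrow> 'a \<Rightarrow> 'a" where
  "poly_at A p x = (\<Oplus>\<^bsub>A\<^esub>i\<in>{..degree p}. coeff p i \<odot>\<^bsub>A\<^esub> (x [^]\<^bsub>A\<^esub> i))"

definition minimal_polynomial :: "('f::field, 'a) module \<Rightarrow> 'a \<Rightarrow> 'f poly \<Rightarrow> bool" where
  "minimal_polynomial A x p \<longleftrightarrow>
     lead_coeff p = 1 \<and> poly_at A p x = \<zero>\<^bsub>A\<^esub> \<and>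
     (\<forall>q. q \<noteq> 0 \<and> poly_at A q x = \<zero>\<^bsub>A\<^esub> \<longrightarrow> degree p \<le> degree q)"

definition finite_separable_extension :: "('f::field, 'a) module \<Rightarrow> bool" where
  "finite_separable_extension E \<longleftrightarrow>
     assoc_algebra E \<and> Ring.field E \<and> finite_dimensional_algebra E \<and>
     (\<forall>x\<in>carrier E. \<exists>p. minimal_polynomial E x p \<and> coprime p (pderiv p))"

definition product_algebra :: "'i set \<Rightarrow> ('i \<Rightarrow> ('f, 'a) module) \<Rightarrow> ('f, 'i \<Rightarrow> 'a) module" where
  "product_algebra I E =
     \<lparr>carrier = (\<Pi>\<^sub>E i\<in>I. carrier (E i)),
      mult = (\<lambda>f g. \<lambda>i\<in>I. f i \<otimes>\<^bsub>E i\<^esub> g i), one = (\<lambda>i\<in>I. \<one>\<^bsub>E i\<^esub>),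
      zero = (\<lambda>i\<in>I. \<zero>\<^bsub>E i\<^esub>), add = (\<lambda>f g. \<lambda>i\<in>I. f i \<oplus>\<^bsub>E i\<^esub> g i),
      smult = (\<lambda>c f. \<lambda>i\<in>I. c \<odot>\<^bsub>E i\<^esub> f i)\<rparr>"

text \<open>
  The factors may be taken on the element type of \<open>K\<close>, since each factor of a product algebra
  isomorphic to \<open>K\<close> is a copy of an ideal of \<open>K\<close>.
\<close>

definition etale_algebra :: "('f::field, 'a) module \<Rightarrow> bool" where
  "etale_algebra K \<longleftrightarrow>
     assoc_algebra K \<and>
     (\<exists>(n::nat) (E :: nat \<Rightarrow> ('f, 'a) module).
        (\<forall>i<n. finite_separable_extension (E i)) \<and>
        algebra_iso K (product_algebra {..<n} E) \<noteq> {})"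


section \<open>Semiassociative algebras\<close>

definition semiassociative :: "('f::field, 'a) module \<Rightarrow> bool" where
  "semiassociative A \<longleftrightarrow>
     nonassoc_algebra A \<and> finite_dimensional_algebra A \<and> central_algebra A \<and>
     (\<exists>K. subalgebra_of K A \<and> K \<subseteq> nucleus A \<and> etale_algebra (A\<lparr>carrier := K\<rparr>) \<and>
        minimally_faithful (tensor_algebra (A\<lparr>carrier := K\<rparr>) (A\<lparr>carrier := K\<rparr>))
          (two_sided_module A))"

definition nucleus_algebra :: "('f, 'a) module \<Rightarrow> ('f, 'a) module" where
  "nucleus_algebra A = A\<lparr>carrier := nucleus A\<rparr>"

definition sigma_algebra :: "('f, 'a) module \<Rightarrow> ('f, 'a set) module" where
  "sigma_algebra A =
     quotient_module (nucleus_algebra A) (jacobson_radical (nucleus_algebra A))"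

end

theory Submission
  imports Defs
begin

text \<open>
  Let \<open>N\<close> be the nucleus and \<open>S = N / J(N)\<close>. The etale algebra \<open>K\<close> has a separability
  idempotent, so the tensor square of \<open>K\<close> is semisimple, and minimal faithfulness makes \<open>A\<close> a
  cyclic \<open>K\<close>-bimodule. Its sub-bimodule \<open>N\<close> is a direct summand, so \<open>N\<close> and \<open>S\<close> are cyclic too.

  For \<open>k\<close> in \<open>S\<close> put \<open>T\<^sub>k(x) = tr (b \<mapsto> x b k)\<close>, a symmetric associative trace form on \<open>S\<close>. If \<open>T\<^sub>k\<close> is
  nondegenerate with dual bases \<open>x\<^sub>i, y\<^sub>i\<close>, then \<open>c(a) = \<Sum> x\<^sub>i a y\<^sub>i\<close> satisfies \<open>T\<^sub>a(b) = T\<^sub>k(b c(a))\<close>;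
  hence \<open>c(k) = 1\<close>, and \<open>\<Sum> x\<^sub>i k \<otimes> y\<^sub>i\<close> is a separability idempotent of \<open>S\<close>. To find such a \<open>k\<close>,
  take the radical of \<open>T\<^sub>k\<close> as small as possible. If it were nonzero, it would contain a central
  idempotent \<open>e \<noteq> 0\<close>, because \<open>S\<close> is semisimple; cyclicity provides \<open>z, l\<close> in \<open>K\<close> with
  \<open>T\<^sub>l(e z) \<noteq> 0\<close>, and then \<open>T\<close> at \<open>k + e l\<close> has a smaller radical.
\<close>


section \<open>Linear algebra in a finite-dimensional subspace\<close>

text \<open>Over an imperfect field a semisimple algebra need not be separable, so the separability
  of \<open>K\<close> has to be carried over to \<open>S\<close>. The untwisted trace form of the
  regular representation does not achieve this: on p by p matrices in characteristic p it is zero,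
  since tr(b \<mapsto> x b) = p tr(x). The twist by k turns it into tr(x) tr(k), which explains the
  extra factor. Cyclicity is what provides enough twists: the operators given by the tensor square
  of \<open>K\<close> are self-adjoint for every bilinear map averaged over the separability
  idempotent, and if all values \<open>T l (e \<star> z)\<close> were zero, moving such operators
  across an averaged sum would give \<open>e \<star> g0 = 0\<close> for a generator
  \<open>g0\<close>. The linear algebra takes place in a subspace of a type on which the product is
  total and bilinear. Algebras given as records are moved there by coordinates, so that finite sums
  carry no membership conditions.\<close>

context vector_space
begin

text \<open>A basis of \<open>U\<close> extends to one of \<open>U'\<close>, properly because the
  spans differ; the finite set \<open>B\<close> bounds both. The extremal choices below (smallest
  complement, largest cyclic sub-bimodule, smallest radical) all reach their contradiction through
  this inequality.\<close>

lemma dim_strict_mono: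
  assumes "subspace U" "U \<subset> U'" "U' \<subseteq> span B" "finite B"
  shows "dim U < dim U'"
proof -
  obtain C where C: "C \<subseteq> U" "independent C" "U \<subseteq> span C" "card C = dim U"
    using basis_exists by blast
  obtain C' where C': "C \<subseteq> C'" "C' \<subseteq> U'" "independent C'" "U' \<subseteq> span C'"
    using maximal_independent_subset_extend[of C U'] C assms(2) by blast
  have fin: "finite C'"
    using independent_span_bound[OF assms(4) C'(3)] C'(2) assms(3) by blast
  have "span C = U"
    using C(1,3) assms(1) by (simp add: span_minimal subset_antisym)
  then have "C \<noteq> C'" using C'(4) assms(2) by blast
  then have "card C < card C'" using C'(1) fin by (simp add: psubset_card_mono psubset_eq)
  moreover have "card C' = dim U'" using C' by (simp add: basis_card_eq_dim)
  ultimately show ?thesis using C(4) by simp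
qed

lemma projection_exists:
  assumes "subspace U"
  obtains P where "Vector_Spaces.linear scale scale P" "\<And>x. P x \<in> U" "\<And>x. x \<in> U \<Longrightarrow> P x = x"
proof -
  interpret vector_space_pair scale scale by unfold_locales
  have "\<exists>g. g ` UNIV \<subseteq> U \<and> Vector_Spaces.linear scale scale g \<and> (\<forall>v\<in>U. g (id v) = v)"
    by (rule linear_exists_left_inverse_on) (auto simp: assms linear_id[unfolded id_def])
  then show thesis using that by auto
qed

text \<open>The coordinate functionals are linear on the whole type, being extended from an
  independent set; only the expansion is confined to \<open>V\<close>.\<close>

lemma coordinates_exist:
  assumes "subspace V" "finite B0" "V \<subseteq> span B0"
  obtains B co where "finite B" "B \<subseteq> V"
    "\<And>b. Vector_Spaces.linear scale (*) (co b)"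
    "\<And>x. x \<in> V \<Longrightarrow> x = (\<Sum>b\<in>B. co b x *s b)"
    "\<And>b b'. b \<in> B \<Longrightarrow> b' \<in> B \<Longrightarrow> co b b' = (if b = b' then 1 else 0)"
proof -
  obtain B where B: "B \<subseteq> V" "independent B" "V \<subseteq> span B"
    using maximal_independent_subset[of V] by blast
  have fin: "finite B"
    using independent_span_bound[OF assms(2) B(2)] B(1) assms(3) by blast
  interpret f: vector_space "(*) :: 'a \<Rightarrow> 'a \<Rightarrow> 'a" by unfold_locales (auto simp: algebra_simps)
  interpret p: vector_space_pair scale "(*) :: 'a \<Rightarrow> 'a \<Rightarrow> 'a" by unfold_locales
  define co where "co b = p.construct B (\<lambda>b'. if b = b' then 1 else 0)" for b
  have lin: "Vector_Spaces.linear scale (*) (co b)" for b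
    unfolding co_def by (rule p.linear_construct[OF B(2)])
  have del: "co b b' = (if b = b' then 1 else 0)" if "b' \<in> B" for b b'
    unfolding co_def using p.construct_basis[OF B(2) that] by simp
  have exp: "x = (\<Sum>b\<in>B. co b x *s b)" if "x \<in> V" for x
  proof -
    have "x \<in> span B" using that B(3) by blast
    then obtain u where u: "x = (\<Sum>b\<in>B. u b *s b)"
      using span_finite[OF fin] by auto
    have "co b x = u b" if "b \<in> B" for b
    proof -
      interpret l: Vector_Spaces.linear scale "(*)" "co b" by (rule lin)
      have "co b x = (\<Sum>b'\<in>B. u b' * co b b')"
        unfolding u by (simp add: l.sum l.scale)
      also have "\<dots> = (\<Sum>b'\<in>B. if b = b' then u b' else 0)"
        by (rule sum.cong) (auto simp: del)
      also have "\<dots> = u b" using fin that by simp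
      finally show ?thesis .
    qed
    then show ?thesis using u by simp
  qed
  show thesis using that[OF fin B(1) lin exp] del by blast
qed

text \<open>The image of a basis is independent and has the same size, so a proper image would
  contradict strict monotonicity of the dimension. This later turns nondegeneracy of a trace form
  into a dual basis.\<close>

lemma injective_endomorphism_surj:
  assumes "subspace V" "finite B0" "V \<subseteq> span B0" "Vector_Spaces.linear scale scale h"
    "\<And>x. x \<in> V \<Longrightarrow> h x \<in> V" "\<And>x. x \<in> V \<Longrightarrow> h x = 0 \<Longrightarrow> x = 0" "y \<in> V"
  shows "\<exists>x\<in>V. h x = y"
proof -
  interpret vector_space_pair scale scale by unfold_locales
  have inj: "inj_on h V"
  proof (rule inj_onI)
    fix x y assume xy: "x \<in> V" "y \<in> V" "h x = h y"
    then have "h (x - y) = 0" using linear_diff[OF assms(4)] by simp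
    then show "x = y" using assms(6)[of "x - y"] xy assms(1) by (simp add: subspace_diff)
  qed
  have "h ` V = V"
  proof (rule ccontr)
    assume "h ` V \<noteq> V"
    then have "h ` V \<subset> V" using assms(5) by blast
    moreover have "subspace (h ` V)" by (rule linear_subspace_image[OF assms(4,1)])
    ultimately have lt: "dim (h ` V) < dim V"
      using dim_strict_mono assms(2,3) by blast
    obtain C where C: "C \<subseteq> V" "independent C" "V \<subseteq> span C" "card C = dim V"
      using basis_exists by blast
    have spC: "span C = V" using C assms(1) by (simp add: span_minimal subset_antisym)
    have "independent (h ` C)"
      using linear_independent_injective_image[OF assms(4) C(2)] inj spC by simp
    moreover have "h ` V \<subseteq> span (h ` C)"
      using linear_span_image[OF assms(4), of C] spC by simp
    ultimately have "card (h ` C) = dim (h ` V)"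
      using C(1) by (intro basis_card_eq_dim) auto
    moreover have "card (h ` C) = card C"
      using inj C(1) by (meson card_image inj_on_subset)
    ultimately show False using lt C(4) by simp
  qed
  then show ?thesis using assms(7) by (metis imageE)
qed

end

section \<open>Bimodules over a separable commutative subalgebra\<close>

text \<open>Bilinearity of the product holds on the whole type, closure and the unit laws only on
  \<open>V\<close>. Associativity is left out because the locale has to cover the nonassociative
  algebra as well as the quotient of its nucleus.\<close>

locale fd_algebra = vector_space scale
  for scale :: "'f::field \<Rightarrow> 'v::ab_group_add \<Rightarrow> 'v" (infixr "*s" 75) +
  fixes V B0 :: "'v set" and mul :: "'v \<Rightarrow> 'v \<Rightarrow> 'v" (infixl "\<star>" 70) and unit :: 'v
  assumes subspace_V: "subspace V" and finite_B0: "finite B0" and V_le: "V \<subseteq> span B0"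
    and mul_add_left: "(x + y) \<star> z = x \<star> z + y \<star> z"
    and mul_add_right: "x \<star> (y + z) = x \<star> y + x \<star> z"
    and mul_scale_left: "(c *s x) \<star> y = c *s (x \<star> y)"
    and mul_scale_right: "x \<star> (c *s y) = c *s (x \<star> y)"
    and mul_closed: "\<lbrakk>x \<in> V; y \<in> V\<rbrakk> \<Longrightarrow> x \<star> y \<in> V"
    and unit_in: "unit \<in> V"
    and unit_left: "x \<in> V \<Longrightarrow> unit \<star> x = x"
    and unit_right: "x \<in> V \<Longrightarrow> x \<star> unit = x"
begin

lemma mul_zero_left: "0 \<star> x = 0"
  using mul_scale_left[of 0 0 x] by simp

lemma mul_zero_right: "x \<star> 0 = 0"
  using mul_scale_right[of x 0 0] by simp

lemma mul_diff_left: "(x - y) \<star> z = x \<star> z - y \<star> z"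
  using mul_add_left[of "x - y" y z] by (simp add: algebra_simps)

lemma mul_diff_right: "x \<star> (y - z) = x \<star> y - x \<star> z"
  using mul_add_right[of x "y - z" z] by (simp add: algebra_simps)

lemma mul_sum_left: "sum g I \<star> x = (\<Sum>i\<in>I. g i \<star> x)"
  by (induction I rule: infinite_finite_induct) (simp_all add: mul_zero_left mul_add_left)

lemma mul_sum_right: "x \<star> sum g I = (\<Sum>i\<in>I. x \<star> g i)"
  by (induction I rule: infinite_finite_induct) (simp_all add: mul_zero_right mul_add_right)

lemmas mul_sum = mul_sum_left mul_sum_right

definition endo :: "('v \<Rightarrow> 'v) \<Rightarrow> bool" where
  "endo h \<longleftrightarrow> (\<forall>x y. h (x + y) = h x + h y) \<and> (\<forall>c x. h (c *s x) = c *s h x)"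

lemma endo_linear: "endo h \<longleftrightarrow> Vector_Spaces.linear scale scale h"
  unfolding endo_def Vector_Spaces.linear_iff using vector_space_axioms by blast

lemma endo_add: "endo h \<Longrightarrow> h (x + y) = h x + h y"
  and endo_scale: "endo h \<Longrightarrow> h (c *s x) = c *s h x"
  by (simp_all add: endo_def)

lemma endo_zero: "endo h \<Longrightarrow> h 0 = 0"
  using endo_scale[of h 0 0] by simp

lemma endo_sum: "endo h \<Longrightarrow> h (sum g I) = (\<Sum>i\<in>I. h (g i))"
  by (induction I rule: infinite_finite_induct) (simp_all add: endo_zero endo_add)

definition bilin :: "('v \<Rightarrow> 'v \<Rightarrow> 'v) \<Rightarrow> bool" where
  "bilin G \<longleftrightarrow> (\<forall>x. endo (G x)) \<and> (\<forall>y. endo (\<lambda>x. G x y))"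

lemma bilinI:
  assumes "\<And>x y z. G (x + y) z = G x z + G y z" "\<And>x y z. G x (y + z) = G x y + G x z"
    "\<And>c x y. G (c *s x) y = c *s G x y" "\<And>c x y. G x (c *s y) = c *s G x y"
  shows "bilin G"
  using assms by (simp add: bilin_def endo_def)

lemma bilin_simps:
  assumes "bilin G"
  shows "G (x + y) z = G x z + G y z" "G x (y + z) = G x y + G x z"
    "G (c *s x) y = c *s G x y" "G x (c *s y) = c *s G x y"
  using assms by (simp_all add: bilin_def endo_def)

lemma bilin_zero: "bilin G \<Longrightarrow> G 0 y = 0" "bilin G \<Longrightarrow> G x 0 = 0"
  using bilin_simps(3)[of G 0 0 y] bilin_simps(4)[of G x 0 0] by simp_all

lemma V_add: "x \<in> V \<Longrightarrow> y \<in> V \<Longrightarrow> x + y \<in> V"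
  and V_scale: "x \<in> V \<Longrightarrow> c *s x \<in> V"
  and V_zero: "0 \<in> V"
  and V_diff: "x \<in> V \<Longrightarrow> y \<in> V \<Longrightarrow> x - y \<in> V"
  and V_sum: "(\<And>i. i \<in> I \<Longrightarrow> g i \<in> V) \<Longrightarrow> sum g I \<in> V"
  using subspace_V by (auto simp: subspace_add subspace_scale subspace_0 subspace_diff subspace_sum)

end

text \<open>
  The pairs \<open>(p i, q i)\<close> represent a separability idempotent of the subalgebra \<open>K\<close>; instead of
  an identity in the tensor square of \<open>K\<close>, its defining property is stated for all bilinear maps.
\<close>

locale separable_bimodule = fd_algebra +
  fixes K :: "'b set" and m :: nat and p q :: "nat \<Rightarrow> 'b"
  assumes subspace_K: "subspace K" and K_le: "K \<subseteq> V"
    and K_mul: "\<lbrakk>k \<in> K; l \<in> K\<rbrakk> \<Longrightarrow> k \<star> l \<in> K"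
    and unit_K: "unit \<in> K"
    and K_comm: "\<lbrakk>k \<in> K; l \<in> K\<rbrakk> \<Longrightarrow> k \<star> l = l \<star> k"
    and K_left: "\<lbrakk>k \<in> K; x \<in> V; y \<in> V\<rbrakk> \<Longrightarrow> (k \<star> x) \<star> y = k \<star> (x \<star> y)"
    and K_right: "\<lbrakk>k \<in> K; x \<in> V; y \<in> V\<rbrakk> \<Longrightarrow> (x \<star> y) \<star> k = x \<star> (y \<star> k)"
    and pK: "i < m \<Longrightarrow> p i \<in> K" and qK: "i < m \<Longrightarrow> q i \<in> K"
    and pq_unit: "(\<Sum>i<m. p i \<star> q i) = unit"
    and pq_swap: "\<lbrakk>bilin G; z \<in> K\<rbrakk> \<Longrightarrow> (\<Sum>i<m. G (z \<star> p i) (q i)) = (\<Sum>i<m. G (p i) (z \<star> q i))"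
begin

lemma KV: "k \<in> K \<Longrightarrow> k \<in> V" using K_le by blast

lemmas pqV = KV[OF pK] KV[OF qK]


lemma bimodule_assoc:
  assumes "k \<in> K" "l \<in> K" "x \<in> V"
  shows "k \<star> (l \<star> x) = (k \<star> l) \<star> x" "(x \<star> k) \<star> l = x \<star> (k \<star> l)" "k \<star> (x \<star> l) = (k \<star> x) \<star> l"
  using assms by (simp_all add: K_left K_right KV)

section \<open>Sub-bimodules and the operators given by the tensor square of
  \<open>K\<close>\<close>

definition sub_bimodule :: "'b set \<Rightarrow> bool" where
  "sub_bimodule U \<longleftrightarrow> subspace U \<and> U \<subseteq> V \<and> (\<forall>k\<in>K. \<forall>x\<in>U. k \<star> x \<in> U \<and> x \<star> k \<in> U)"

lemma sub_bimodule_V: "sub_bimodule V"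
  by (simp add: sub_bimodule_def subspace_V mul_closed KV)

text \<open>The image of the tensor square of \<open>K\<close> in the endomorphisms of
  \<open>V\<close>. The clause \<open>eq_on\<close> makes membership depend on the values in
  \<open>V\<close> only, since the functions have irrelevant values elsewhere.\<close>

inductive_set ops :: "('b \<Rightarrow> 'b) set" where
  single: "\<lbrakk>k \<in> K; l \<in> K\<rbrakk> \<Longrightarrow> (\<lambda>x. (k \<star> x) \<star> l) \<in> ops"
| add: "\<lbrakk>f \<in> ops; g \<in> ops\<rbrakk> \<Longrightarrow> (\<lambda>x. f x + g x) \<in> ops"
| eq_on: "\<lbrakk>f \<in> ops; \<And>x. x \<in> V \<Longrightarrow> g x = f x\<rbrakk> \<Longrightarrow> g \<in> ops"

lemma ops_sub_bimodule:
  assumes "f \<in> ops" "sub_bimodule U" "x \<in> U"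
  shows "f x \<in> U"
  using assms
proof (induction arbitrary: x)
  case (eq_on f g)
  then show ?case unfolding sub_bimodule_def by (metis subsetD)
qed (auto simp: sub_bimodule_def subspace_add)

lemmas ops_V = ops_sub_bimodule[OF _ sub_bimodule_V]

lemma ops_linear:
  assumes "f \<in> ops" "x \<in> V" "y \<in> V"
  shows "f (x + y) = f x + f y" "f (c *s x) = c *s f x"
  using assms
  by (induction) (simp_all add: mul_add_left mul_add_right mul_scale_left mul_scale_right V_add
      V_scale algebra_simps)

text \<open>The operators are sums of left and right multiplications by \<open>K\<close>, and these
  commute with every bimodule endomorphism h.\<close>

lemma ops_commute:
  assumes "f \<in> ops" "endo h" "\<And>x. x \<in> V \<Longrightarrow> h x \<in> V" "x \<in> V"
    and "\<And>k x. \<lbrakk>k \<in> K; x \<in> V\<rbrakk> \<Longrightarrow> h (k \<star> x) = k \<star> h x"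
    and "\<And>k x. \<lbrakk>k \<in> K; x \<in> V\<rbrakk> \<Longrightarrow> h (x \<star> k) = h x \<star> k"
  shows "h (f x) = f (h x)"
  using assms
  by (induction) (simp_all add: endo_add mul_closed KV)

text \<open>As \<open>K\<close> is commutative, left and right multiplications by its elements are
  themselves bimodule endomorphisms.\<close>

lemma ops_mul:
  assumes "f \<in> ops" "k \<in> K" "x \<in> V"
  shows "f (k \<star> x) = k \<star> f x" "f (x \<star> k) = f x \<star> k"
proof -
  show "f (k \<star> x) = k \<star> f x"
  proof (rule ops_commute[OF assms(1) _ _ assms(3), symmetric])
    show "endo ((\<star>) k)" by (simp add: endo_def mul_add_right mul_scale_right)
  qed (use assms(2) in \<open>simp_all add: mul_closed KV K_comm bimodule_assoc\<close>)
  show "f (x \<star> k) = f x \<star> k"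
  proof (rule ops_commute[OF assms(1) _ _ assms(3), symmetric])
    show "endo (\<lambda>x. x \<star> k)" by (simp add: endo_def mul_add_left mul_scale_left)
  qed (use assms(2) in \<open>simp_all add: mul_closed KV K_comm bimodule_assoc\<close>)
qed

lemma ops_zero: "(\<lambda>x. 0) \<in> ops"
  using ops.single[of 0 0] subspace_K by (simp add: subspace_0 mul_zero_left)

lemma ops_id: "(\<lambda>x. x) \<in> ops"
  by (rule ops.eq_on[OF ops.single[OF unit_K unit_K]]) (simp add: unit_left unit_right)

lemma ops_sandwich:
  assumes "f \<in> ops" "k \<in> K" "l \<in> K"
  shows "(\<lambda>x. (k \<star> f x) \<star> l) \<in> ops"
  using assms(1)
proof induction
  case (single k' l')
  show ?case
    by (rule ops.eq_on[OF ops.single[of "k \<star> k'" "l' \<star> l"]])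
      (use single assms in \<open>simp_all add: K_mul bimodule_assoc mul_closed KV\<close>)
next
  case (add f g)
  show ?case
    by (rule ops.eq_on[OF ops.add[OF add.IH]]) (simp add: mul_add_left mul_add_right)
next
  case (eq_on f g)
  then show ?case by (intro ops.eq_on[OF eq_on.IH]) simp
qed

lemma ops_scale:
  assumes "f \<in> ops"
  shows "(\<lambda>x. c *s f x) \<in> ops"
  by (rule ops.eq_on[OF ops_sandwich[OF assms, of "c *s unit" unit]])
    (use assms in \<open>simp_all add: unit_K subspace_K subspace_scale mul_scale_left unit_left unit_right
      ops_V\<close>)

lemma ops_sum: "(\<And>i. i \<in> I \<Longrightarrow> f i \<in> ops) \<Longrightarrow> (\<lambda>x. \<Sum>i\<in>I. f i x) \<in> ops"
  by (induction I rule: infinite_finite_induct) (simp_all add: ops_zero ops.add)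

definition cyc :: "'b \<Rightarrow> 'b set" where
  "cyc a = {f a |f. f \<in> ops}"

lemma cycI: "f \<in> ops \<Longrightarrow> x = f a \<Longrightarrow> x \<in> cyc a"
  unfolding cyc_def by blast

lemma cyc_self: "a \<in> cyc a"
  unfolding cyc_def using ops_id by force

lemma sub_bimodule_cyc:
  assumes "a \<in> V"
  shows "sub_bimodule (cyc a)"
  unfolding sub_bimodule_def
proof (intro conjI ballI subspaceI)
  show "0 \<in> cyc a" unfolding cyc_def using ops_zero by force
  show "x + y \<in> cyc a" if "x \<in> cyc a" "y \<in> cyc a" for x y
  proof -
    obtain f g where "f \<in> ops" "x = f a" "g \<in> ops" "y = g a"
      using \<open>x \<in> cyc a\<close> \<open>y \<in> cyc a\<close> unfolding cyc_def by blast
    then show ?thesis using cycI[OF ops.add[of f g]] by simp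
  qed
  show "c *s x \<in> cyc a" if "x \<in> cyc a" for c x
  proof -
    obtain f where "f \<in> ops" "x = f a" using \<open>x \<in> cyc a\<close> unfolding cyc_def by blast
    then show ?thesis using cycI[OF ops_scale[of f c]] by simp
  qed
  show "cyc a \<subseteq> V" unfolding cyc_def using assms by (auto intro: ops_V)
  show "k \<star> x \<in> cyc a" if kx: "k \<in> K" "x \<in> cyc a" for k x
  proof -
    obtain f where f: "f \<in> ops" "x = f a" using kx(2) unfolding cyc_def by blast
    have "k \<star> x = (k \<star> f a) \<star> unit" using f kx assms by (simp add: unit_right mul_closed KV ops_V)
    then show ?thesis using cycI[OF ops_sandwich[OF f(1) kx(1) unit_K]] by simp
  qed
  show "x \<star> k \<in> cyc a" if kx: "k \<in> K" "x \<in> cyc a" for k x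
  proof -
    obtain f where f: "f \<in> ops" "x = f a" using kx(2) unfolding cyc_def by blast
    have "x \<star> k = (unit \<star> f a) \<star> k" using f kx assms by (simp add: unit_left ops_V)
    then show ?thesis using cycI[OF ops_sandwich[OF f(1) unit_K kx(1)]] by simp
  qed
qed

lemma cyc_minimal: "sub_bimodule U \<Longrightarrow> a \<in> U \<Longrightarrow> cyc a \<subseteq> U"
  unfolding cyc_def using ops_sub_bimodule by blast

section \<open>Averaging over the separability idempotent\<close>

lemma pq_sandwich:
  assumes "x \<in> V"
  shows "(\<Sum>i<m. \<Sum>j<m. (p i \<star> ((q i \<star> x) \<star> q j)) \<star> p j) = x"
    "(\<Sum>i<m. \<Sum>j<m. (q i \<star> ((p i \<star> x) \<star> p j)) \<star> q j) = x"
proof -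
  have "(\<Sum>i<m. \<Sum>j<m. (p i \<star> ((q i \<star> x) \<star> q j)) \<star> p j)
      = (\<Sum>i<m. \<Sum>j<m. ((p i \<star> q i) \<star> x) \<star> (p j \<star> q j))"
    by (intro sum.cong refl) (use assms in \<open>simp add: bimodule_assoc pK qK KV mul_closed K_comm\<close>)
  also have "\<dots> = (unit \<star> x) \<star> unit"
    unfolding pq_unit[symmetric] mul_sum by (rule sum.swap)
  finally show "(\<Sum>i<m. \<Sum>j<m. (p i \<star> ((q i \<star> x) \<star> q j)) \<star> p j) = x"
    using assms by (simp add: unit_left unit_right)
  have "(\<Sum>i<m. \<Sum>j<m. (q i \<star> ((p i \<star> x) \<star> p j)) \<star> q j)
      = (\<Sum>i<m. \<Sum>j<m. ((p i \<star> q i) \<star> x) \<star> (p j \<star> q j))"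
    by (intro sum.cong refl) (use assms in \<open>simp add: bimodule_assoc pK qK KV mul_closed K_comm\<close>)
  also have "\<dots> = (unit \<star> x) \<star> unit"
    unfolding pq_unit[symmetric] mul_sum by (rule sum.swap)
  finally show "(\<Sum>i<m. \<Sum>j<m. (q i \<star> ((p i \<star> x) \<star> p j)) \<star> q j) = x"
    using assms by (simp add: unit_left unit_right)
qed

text \<open>Maschke averaging for bimodules: the sum over \<open>p i\<close>, \<open>q i\<close>
  plays the part of the normalized sum over a group and its inverses, with the index i on the left
  side and j on the right side.\<close>

definition avg :: "('b \<Rightarrow> 'b) \<Rightarrow> 'b \<Rightarrow> 'b" where
  "avg h x = (\<Sum>i<m. \<Sum>j<m. (p i \<star> h ((q i \<star> x) \<star> q j)) \<star> p j)"

lemma endo_avg: "endo h \<Longrightarrow> endo (avg h)"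
  unfolding endo_def avg_def
  by (simp add: mul_add_left mul_add_right mul_scale_left mul_scale_right sum.distrib scale_sum_right)

lemma avg_mem:
  assumes "sub_bimodule U" "\<And>x. x \<in> V \<Longrightarrow> h x \<in> U" "x \<in> V"
  shows "avg h x \<in> U"
  unfolding avg_def
  by (intro subspace_sum) (use assms in \<open>auto simp: sub_bimodule_def pK qK mul_closed KV\<close>)

lemma avg_id:
  assumes "sub_bimodule U" "\<And>x. x \<in> U \<Longrightarrow> h x = x" "x \<in> U"
  shows "avg h x = x"
proof -
  have "h ((q i \<star> x) \<star> q j) = (q i \<star> x) \<star> q j" if "i < m" "j < m" for i j
    by (rule assms(2)) (use assms(1,3) that in \<open>auto simp: sub_bimodule_def pK qK\<close>)
  then have "avg h x = (\<Sum>i<m. \<Sum>j<m. (p i \<star> ((q i \<star> x) \<star> q j)) \<star> p j)"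
    unfolding avg_def by simp
  then show ?thesis using pq_sandwich(1) assms(1,3) unfolding sub_bimodule_def by auto
qed

text \<open>With one index frozen, every term is bilinear in the remaining pair from
  \<open>p\<close> and \<open>q\<close>, so \<open>pq_swap\<close> carries z from inside h to the
  outside. Thus a merely linear h becomes a bimodule endomorphism.\<close>

lemma avg_mul:
  assumes "endo h" "\<And>x. x \<in> V \<Longrightarrow> h x \<in> V" "x \<in> V" "z \<in> K"
  shows "avg h (z \<star> x) = z \<star> avg h x" "avg h (x \<star> z) = avg h x \<star> z"
proof -
  have b: "bilin (\<lambda>a b. (a \<star> h ((b \<star> x) \<star> y)) \<star> w)" for y w
    using assms(1) by (intro bilinI)
      (simp_all add: endo_def mul_add_left mul_add_right mul_scale_left mul_scale_right)
  have "avg h (z \<star> x) = (\<Sum>j<m. \<Sum>i<m. (p i \<star> h (((z \<star> q i) \<star> x) \<star> q j)) \<star> p j)"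
    unfolding avg_def
    by (subst sum.swap, intro sum.cong refl) (use assms in \<open>simp add: bimodule_assoc qK K_comm\<close>)
  also have "\<dots> = (\<Sum>j<m. \<Sum>i<m. ((z \<star> p i) \<star> h ((q i \<star> x) \<star> q j)) \<star> p j)"
    by (intro sum.cong refl pq_swap[OF b assms(4), symmetric])
  also have "\<dots> = (\<Sum>j<m. \<Sum>i<m. z \<star> ((p i \<star> h ((q i \<star> x) \<star> q j)) \<star> p j))"
    by (intro sum.cong refl) (use assms in \<open>simp add: bimodule_assoc pK qK mul_closed KV K_mul\<close>)
  also have "\<dots> = z \<star> avg h x"
    unfolding avg_def mul_sum_right by (rule sum.swap)
  finally show "avg h (z \<star> x) = z \<star> avg h x" .
  have b': "bilin (\<lambda>a b. (w \<star> h ((y \<star> x) \<star> b)) \<star> a)" for y w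
    using assms(1) by (intro bilinI)
      (simp_all add: endo_def mul_add_left mul_add_right mul_scale_left mul_scale_right)
  have "avg h (x \<star> z) = (\<Sum>i<m. \<Sum>j<m. (p i \<star> h ((q i \<star> x) \<star> (z \<star> q j))) \<star> p j)"
    unfolding avg_def
    by (intro sum.cong refl) (use assms in \<open>simp add: bimodule_assoc qK mul_closed KV\<close>)
  also have "\<dots> = (\<Sum>i<m. \<Sum>j<m. (p i \<star> h ((q i \<star> x) \<star> q j)) \<star> (z \<star> p j))"
    by (intro sum.cong refl pq_swap[OF b' assms(4), symmetric])
  also have "\<dots> = (\<Sum>i<m. \<Sum>j<m. ((p i \<star> h ((q i \<star> x) \<star> q j)) \<star> p j) \<star> z)"
    by (intro sum.cong refl) (use assms in \<open>simp add: bimodule_assoc pK qK mul_closed KV K_comm\<close>)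
  also have "\<dots> = avg h x \<star> z"
    unfolding avg_def mul_sum_left by (rule refl)
  finally show "avg h (x \<star> z) = avg h x \<star> z" .
qed

text \<open>The average of a linear projection onto \<open>U\<close> is a bimodule retraction onto
  \<open>U\<close>. It commutes with \<open>ops\<close>, hence sends a generator of \<open>V\<close>
  to a generator of \<open>U\<close>.\<close>

lemma cyc_summand:
  assumes "a \<in> V" "cyc a = V" "sub_bimodule U"
  obtains b where "b \<in> U" "cyc b = U"
proof -
  obtain h where h: "Vector_Spaces.linear scale scale h" "\<And>x. h x \<in> U" "\<And>x. x \<in> U \<Longrightarrow> h x = x"
    using projection_exists assms(3) unfolding sub_bimodule_def by blast
  have UV: "x \<in> U \<Longrightarrow> x \<in> V" for x using assms(3) unfolding sub_bimodule_def by blast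
  have e: "endo h" using h(1) endo_linear by simp
  have b: "avg h a \<in> U" using avg_mem assms(1,3) h(2) by blast
  have "x \<in> cyc (avg h a)" if x: "x \<in> U" for x
  proof -
    obtain f where f: "f \<in> ops" "x = f a" using assms(2) UV[OF x] unfolding cyc_def by blast
    have "x = avg h x" using avg_id[OF assms(3) h(3) x] by simp
    also have "\<dots> = f (avg h a)"
      unfolding f(2)
      by (rule ops_commute[OF f(1) endo_avg[OF e] _ assms(1)])
        (use e h(2) UV assms(3) in \<open>auto simp: avg_mul intro: avg_mem[OF sub_bimodule_V]\<close>)
    finally show ?thesis unfolding cyc_def using f(1) by blast
  qed
  then have "cyc (avg h a) = U" using cyc_minimal[OF assms(3) b] by blast
  with b that show thesis by blast
qed

text \<open>The average of a bilinear map over the two-sided separability idempotent: the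
  \<open>p\<close> parts go to the first argument, the \<open>q\<close> parts to the second. The
  result is balanced over \<open>K\<close> on either side.\<close>

definition conv :: "('b \<Rightarrow> 'b \<Rightarrow> 'b) \<Rightarrow> 'b \<Rightarrow> 'b \<Rightarrow> 'b" where
  "conv G x y = (\<Sum>i<m. \<Sum>j<m. G ((p i \<star> x) \<star> p j) ((q i \<star> y) \<star> q j))"

lemma bilin_conv: "bilin G \<Longrightarrow> bilin (conv G)"
  by (intro bilinI) (simp_all add: conv_def mul_add_left mul_add_right mul_scale_left
      mul_scale_right bilin_simps sum.distrib scale_sum_right)

lemma conv_mul:
  assumes "bilin G" "x \<in> V" "y \<in> V" "u \<in> K"
  shows "conv G (u \<star> x) y = conv G x (u \<star> y)" "conv G (x \<star> u) y = conv G x (y \<star> u)"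
proof -
  have b: "bilin (\<lambda>a b. G ((a \<star> x) \<star> c) ((b \<star> y) \<star> d))" for c d
    using assms(1) by (intro bilinI)
      (simp_all add: mul_add_left mul_add_right mul_scale_left mul_scale_right bilin_simps)
  have "conv G (u \<star> x) y = (\<Sum>j<m. \<Sum>i<m. G (((u \<star> p i) \<star> x) \<star> p j) ((q i \<star> y) \<star> q j))"
    unfolding conv_def
    by (subst sum.swap, intro sum.cong refl) (use assms in \<open>simp add: bimodule_assoc pK K_comm\<close>)
  also have "\<dots> = (\<Sum>j<m. \<Sum>i<m. G ((p i \<star> x) \<star> p j) (((u \<star> q i) \<star> y) \<star> q j))"
    by (intro sum.cong refl pq_swap[OF b assms(4)])
  also have "\<dots> = conv G x (u \<star> y)"
    unfolding conv_def
    by (subst (2) sum.swap, intro sum.cong refl) (use assms in \<open>simp add: bimodule_assoc qK K_comm\<close>)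
  finally show "conv G (u \<star> x) y = conv G x (u \<star> y)" .
  have b': "bilin (\<lambda>a b. G ((c \<star> x) \<star> a) ((d \<star> y) \<star> b))" for c d
    using assms(1) by (intro bilinI)
      (simp_all add: mul_add_left mul_add_right mul_scale_left mul_scale_right bilin_simps)
  have "conv G (x \<star> u) y = (\<Sum>i<m. \<Sum>j<m. G ((p i \<star> x) \<star> (u \<star> p j)) ((q i \<star> y) \<star> q j))"
    unfolding conv_def
    by (intro sum.cong refl) (use assms in \<open>simp add: bimodule_assoc pK mul_closed KV\<close>)
  also have "\<dots> = (\<Sum>i<m. \<Sum>j<m. G ((p i \<star> x) \<star> p j) ((q i \<star> y) \<star> (u \<star> q j)))"
    by (intro sum.cong refl pq_swap[OF b' assms(4)])
  also have "\<dots> = conv G x (y \<star> u)"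
    unfolding conv_def
    by (intro sum.cong refl) (use assms in \<open>simp add: bimodule_assoc qK mul_closed KV\<close>)
  finally show "conv G (x \<star> u) y = conv G x (y \<star> u)" .
qed

text \<open>Factors from \<open>K\<close> can be moved between the two arguments on the left and on
  the right, so every operator is self-adjoint for an averaged map. Both the idempotent for an
  annihilator and the detection of central elements rest on this.\<close>

lemma conv_ops:
  assumes "f \<in> ops" "bilin G" "x \<in> V" "y \<in> V"
  shows "conv G (f x) y = conv G x (f y)"
  using assms(1)
proof induction
  case (single k l)
  then show ?case using assms(2-) by (simp add: conv_mul mul_closed KV bimodule_assoc)
next
  case (add f g)
  then show ?case by (simp add: bilin_simps[OF bilin_conv[OF assms(2)]])
next
  case (eq_on f g)
  then show ?case using assms by simp
qed

end

section \<open>Generators of minimally faithful bimodules\<close>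

context separable_bimodule
begin

lemma ops_zero_arg: "f \<in> ops \<Longrightarrow> f 0 = 0"
  using ops_linear(2)[of f 0 0 0] V_zero by simp

lemma ops_sum_arg:
  assumes "f \<in> ops" "\<And>i. i \<in> I \<Longrightarrow> g i \<in> V"
  shows "f (sum g I) = (\<Sum>i\<in>I. f (g i))"
  using assms(2)
  by (induction I rule: infinite_finite_induct)
    (simp_all add: ops_zero_arg[OF assms(1)] ops_linear(1)[OF assms(1)] V_sum)

text \<open>
  The operator \<open>f\<close> below plays the role of the idempotent \<open>1 - e\<close>, where \<open>e\<close> generates the
  annihilator of \<open>a\<close> in the tensor square of \<open>K\<close>.
\<close>

lemma annihilator_idempotent:
  assumes "a \<in> V"
  obtains f where "f \<in> ops" "f a = a"
    "\<And>g x. \<lbrakk>g \<in> ops; g a = 0; x \<in> V\<rbrakk> \<Longrightarrow> g (f x) = 0"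
proof -
  have U: "sub_bimodule (cyc a)" by (rule sub_bimodule_cyc[OF assms])
  obtain h where h: "Vector_Spaces.linear scale scale h" "\<And>x. h x \<in> cyc a"
      "\<And>x. x \<in> cyc a \<Longrightarrow> h x = x"
    using projection_exists U unfolding sub_bimodule_def by blast
  have e: "endo h" using h(1) endo_linear by simp
  obtain B co where B: "finite B" "B \<subseteq> V" "\<And>b. Vector_Spaces.linear scale (*) (co b)"
      "\<And>x. x \<in> V \<Longrightarrow> x = (\<Sum>b\<in>B. co b x *s b)"
    using coordinates_exist[OF subspace_V finite_B0 V_le] by metis
  have co: "co b (x + y) = co b x + co b y" "co b (c *s x) = c * co b x" for b x y c
    using B(3)[of b] unfolding Vector_Spaces.linear_iff by auto
  \<comment> \<open>Since \<open>h b\<close> lies in \<open>cyc a\<close>, it is some operator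
    \<open>\<gamma> b\<close> applied to a. Replacing this a by a variable x in the formula for
    \<open>avg h a\<close> defines \<open>f\<close>, which therefore satisfies
    \<open>f a = avg h a = a\<close>.\<close>
  have "\<exists>g. g \<in> ops \<and> h b = g a" for b using h(2)[of b] unfolding cyc_def by blast
  then obtain \<gamma> where \<gamma>: "\<And>b. \<gamma> b \<in> ops" "\<And>b. h b = \<gamma> b a" by metis
  define G where "G b x y = co b y *s x" for b x y
  have bil: "bilin (G b)" for b
    unfolding G_def by (intro bilinI) (simp_all add: co algebra_simps)
  define f where "f x = (\<Sum>b\<in>B. conv (G b) (\<gamma> b x) a)" for x
  have "f \<in> ops"
    unfolding f_def conv_def G_def
    by (intro ops_sum ops_scale ops_sandwich) (simp_all add: \<gamma> pK)
  moreover have "f a = a"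
  proof -
    have "f a = (\<Sum>b\<in>B. \<Sum>i<m. \<Sum>j<m. co b ((q i \<star> a) \<star> q j) *s ((p i \<star> h b) \<star> p j))"
      unfolding f_def conv_def G_def \<gamma>(2) by (rule refl)
    also have "\<dots> = (\<Sum>i<m. \<Sum>j<m. \<Sum>b\<in>B. co b ((q i \<star> a) \<star> q j) *s ((p i \<star> h b) \<star> p j))"
      by (subst sum.swap, intro sum.cong refl, rule sum.swap)
    also have "\<dots> = (\<Sum>i<m. \<Sum>j<m.
        (p i \<star> h (\<Sum>b\<in>B. co b ((q i \<star> a) \<star> q j) *s b)) \<star> p j)"
      by (simp add: endo_sum[OF e] endo_scale[OF e] mul_sum mul_scale_left mul_scale_right)
    also have "\<dots> = avg h a"
      unfolding avg_def
      by (intro sum.cong refl) (use assms B(4)[symmetric] in \<open>simp add: mul_closed qK KV\<close>)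
    also have "\<dots> = a"
      by (rule avg_id[OF U h(3) cyc_self])
    finally show ?thesis .
  qed
  \<comment> \<open>The operator g commutes with the multiplications by \<open>K\<close> and so
    reaches \<open>\<gamma> b x\<close>; self-adjointness then moves it to the other argument a,
    which it kills.\<close>
  moreover have "g (f x) = 0" if g: "g \<in> ops" "g a = 0" "x \<in> V" for g x
  proof -
    have "g (conv (G b) (\<gamma> b x) a) = 0" for b
    proof -
      have v: "\<gamma> b x \<in> V" using \<gamma> g(3) ops_V by blast
      have "g (conv (G b) (\<gamma> b x) a) = conv (G b) (g (\<gamma> b x)) a"
      proof -
        have w: "(p i \<star> \<gamma> b x) \<star> p j \<in> V" if "i < m" "j < m" for i j
          using that v by (intro mul_closed) (simp_all add: pK KV)
        have "g (conv (G b) (\<gamma> b x) a)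
            = (\<Sum>i<m. \<Sum>j<m. g (co b ((q i \<star> a) \<star> q j) *s ((p i \<star> \<gamma> b x) \<star> p j)))"
          unfolding conv_def G_def
          by (subst ops_sum_arg[OF g(1)], intro V_sum V_scale w, simp_all,
              intro sum.cong refl, subst ops_sum_arg[OF g(1)], intro V_scale w, simp_all)
        also have "\<dots> = (\<Sum>i<m. \<Sum>j<m. co b ((q i \<star> a) \<star> q j) *s ((p i \<star> g (\<gamma> b x)) \<star> p j))"
          using v by (intro sum.cong refl) (simp add: ops_linear(2)[OF g(1)] w ops_mul[OF g(1)] pK KV
              mul_closed)
        finally show ?thesis unfolding conv_def G_def .
      qed
      also have "\<dots> = conv (G b) (\<gamma> b x) (g a)"
        by (rule conv_ops[OF g(1) bil v assms])
      also have "\<dots> = 0"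
        using g(2) bilin_zero(2)[OF bilin_conv[OF bil]] by simp
      finally show ?thesis .
    qed
    moreover have "conv (G b) (\<gamma> b x) a \<in> V" for b
      unfolding conv_def G_def
      by (intro V_sum V_scale mul_closed) (use \<gamma> g(3) in \<open>auto simp: pK KV intro: ops_V\<close>)
    ultimately show ?thesis
      unfolding f_def by (simp add: ops_sum_arg[OF g(1)])
  qed
  ultimately show thesis using that by blast
qed

text \<open>For a with \<open>cyc a\<close> of maximal dimension, the operator f attached to its
  annihilator must be the identity on \<open>V\<close>, as a nonzero x - f x could be added to a to
  generate more. So whatever kills a kills \<open>V\<close>; that is, \<open>cyc a\<close> is
  faithful, and minimality makes it all of \<open>V\<close>.\<close>

lemma cyclic_generator:
  assumes min: "\<And>U. \<lbrakk>sub_bimodule U;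
      \<And>f. \<lbrakk>f \<in> ops; \<forall>x\<in>U. f x = 0\<rbrakk> \<Longrightarrow> \<forall>x\<in>V. f x = 0\<rbrakk> \<Longrightarrow> U = V"
  shows "\<exists>a\<in>V. cyc a = V"
proof -
  have bound: "dim (cyc b) \<le> card B0" if "b \<in> V" for b
    using dim_le_card[of "cyc b" B0] sub_bimodule_cyc[OF that] V_le finite_B0
    unfolding sub_bimodule_def by blast
  have "\<exists>a. a \<in> V \<and> (\<forall>b. b \<in> V \<longrightarrow> dim (cyc b) \<le> dim (cyc a))"
    using bound by (intro Lattices_Big.ex_has_greatest_nat[where k = 0 and b = "Suc (card B0)"]) (auto simp: less_Suc_eq_le V_zero)
  then obtain a where a: "a \<in> V" "\<And>b. b \<in> V \<Longrightarrow> dim (cyc b) \<le> dim (cyc a)"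
    by blast
  obtain f where f: "f \<in> ops" "f a = a"
      "\<And>g x. \<lbrakk>g \<in> ops; g a = 0; x \<in> V\<rbrakk> \<Longrightarrow> g (f x) = 0"
    using annihilator_idempotent[OF a(1)] by blast
  have f_id: "f x = x" if x: "x \<in> V" for x
  proof (rule ccontr)
    assume ne: "f x \<noteq> x"
    \<comment> \<open>f sends b to a, so \<open>cyc b\<close> contains a. But f fixes
      \<open>cyc a\<close> pointwise and moves b, so b lies outside \<open>cyc a\<close>.\<close>
    define b where "b = a + (x - f x)"
    have fx: "f x \<in> V" "x - f x \<in> V" using f(1) x by (simp_all add: ops_V V_diff)
    have bV: "b \<in> V" unfolding b_def using a(1) fx by (simp add: V_add)
    have fdiff: "f (y - z) = f y - f z" if "y \<in> V" "z \<in> V" for y z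
      using ops_linear(1)[OF f(1), of "y - z" z] that by (simp add: V_diff algebra_simps)
    \<comment> \<open>The operator y - f y annihilates a, hence also f x. This gives f (f x) = f
      x.\<close>
    have d: "(\<lambda>y. y + (-1) *s f y) \<in> ops" by (intro ops.add ops_id ops_scale f(1))
    have "f x + (-1) *s f (f x) = 0"
      using f(3)[OF d _ x] f(2) by simp
    then have "f (x - f x) = 0" using fdiff[OF x fx(1)] by simp
    then have fb: "f b = a"
      unfolding b_def using ops_linear(1)[OF f(1) a(1) fx(2)] f(2) by simp
    then have "a \<in> cyc b" using f(1) cycI by metis
    then have sub: "cyc a \<subseteq> cyc b" using cyc_minimal sub_bimodule_cyc[OF bV] by blast
    have fixed: "f y = y" if "y \<in> cyc a" for y
    proof -
      have "sub_bimodule {y \<in> V. f y = y}"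
        unfolding sub_bimodule_def subspace_def
        by (auto simp: V_zero ops_zero_arg[OF f(1)] V_add V_scale ops_linear[OF f(1)] mul_closed KV ops_mul[OF f(1)])
      then show ?thesis using cyc_minimal[of "{y \<in> V. f y = y}" a] that a(1) f(2) by blast
    qed
    have "b \<notin> cyc a"
    proof
      assume "b \<in> cyc a"
      then have "b = a" using fixed fb by metis
      then show False using ne unfolding b_def by simp
    qed
    then have "cyc a \<subset> cyc b" using sub cyc_self by blast
    moreover have "subspace (cyc a)" "subspace (cyc b)" "cyc b \<subseteq> span B0"
      using sub_bimodule_cyc[OF a(1)] sub_bimodule_cyc[OF bV] V_le unfolding sub_bimodule_def by auto
    ultimately have "dim (cyc a) < dim (cyc b)" using dim_strict_mono finite_B0 by blast
    then show False using a(2)[OF bV] by simp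
  qed
  have "cyc a = V"
  proof (rule min[OF sub_bimodule_cyc[OF a(1)]])
    fix g assume g: "g \<in> ops" "\<forall>x\<in>cyc a. g x = 0"
    then have "g a = 0" using cyc_self by blast
    then show "\<forall>x\<in>V. g x = 0" using f(3)[OF g(1)] f_id by metis
  qed
  then show ?thesis using a(1) by blast
qed

end

section \<open>Trace forms and dual bases\<close>

context fd_algebra
begin

definition left_ideal_sp :: "'v set \<Rightarrow> bool" where
  "left_ideal_sp M \<longleftrightarrow> subspace M \<and> M \<subseteq> V \<and> (\<forall>r\<in>V. \<forall>x\<in>M. r \<star> x \<in> M)"

end

text \<open>\<open>maximal_ideals\<close> expresses that the Jacobson radical is zero: a nonzero x
  avoids some maximal left ideal \<open>M\<close>. Maximality is stated elementwise, as the
  existence of left inverses modulo \<open>M\<close> for the elements outside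
  \<open>M\<close>.\<close>

locale semisimple_algebra = fd_algebra +
  assumes assoc: "\<lbrakk>x \<in> V; y \<in> V; z \<in> V\<rbrakk> \<Longrightarrow> (x \<star> y) \<star> z = x \<star> (y \<star> z)"
    and maximal_ideals: "\<lbrakk>x \<in> V; x \<noteq> 0\<rbrakk> \<Longrightarrow>
      \<exists>M. left_ideal_sp M \<and> x \<notin> M \<and> (\<forall>y\<in>V - M. \<exists>r\<in>V. unit - r \<star> y \<in> M)"
begin

text \<open>Among the left ideals \<open>C\<close> whose sum with \<open>I\<close> contains the
  unit, one of least dimension meets \<open>I\<close> only in 0: a maximal left ideal missing a
  common element would cut \<open>C\<close> down further. Writing the unit as e + c, each x in
  \<open>I\<close> equals x e + x c, and x c lies in both \<open>I\<close> and
  \<open>C\<close>.\<close>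

lemma left_ideal_right_unit:
  assumes I: "left_ideal_sp I"
  obtains e where "e \<in> I" "\<And>x. x \<in> I \<Longrightarrow> x \<star> e = x"
proof -
  define P where "P C \<longleftrightarrow> left_ideal_sp C \<and> (\<exists>i\<in>I. \<exists>c\<in>C. unit = i + c)" for C
  have "0 \<in> I" using I unfolding left_ideal_sp_def by (blast intro: subspace_0)
  moreover have "unit = 0 + unit" by simp
  ultimately have "P V"
    unfolding P_def left_ideal_sp_def using unit_in subspace_V mul_closed by blast
  from ex_has_least_nat[of P V dim, OF this]
  obtain C where C: "P C" "\<And>C'. P C' \<Longrightarrow> dim C \<le> dim C'" by blast
  obtain e c where e: "e \<in> I" "c \<in> C" "unit = e + c" using C(1) unfolding P_def by blast
  have CV: "left_ideal_sp C" "C \<subseteq> V" "I \<subseteq> V"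
    using C(1) I unfolding P_def left_ideal_sp_def by auto
  have disj: "y = 0" if y: "y \<in> I" "y \<in> C" for y
  proof (rule ccontr)
    assume "y \<noteq> 0"
    have cV: "c \<in> V" "y \<in> V" using e(2) y CV by auto
    obtain M where M: "left_ideal_sp M" "y \<notin> M" "\<forall>y\<in>V - M. \<exists>r\<in>V. unit - r \<star> y \<in> M"
      using maximal_ideals[OF cV(2) \<open>y \<noteq> 0\<close>] by blast
    have "y \<in> V - M" using cV(2) M(2) by simp
    with M(3) obtain r where r: "r \<in> V" "unit - r \<star> y \<in> M" by blast
    \<comment> \<open>The summand c is replaced by c (1 - r y), which lies in \<open>M\<close> as a
      left multiple of an element of \<open>M\<close>, and in \<open>C\<close> because y does. The
      difference (c r) y lies in \<open>I\<close> and is absorbed by e.\<close>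
    have eq: "c \<star> (unit - r \<star> y) = c - (c \<star> r) \<star> y"
      using cV r(1) by (simp add: mul_diff_right unit_right assoc)
    have "c \<star> (unit - r \<star> y) \<in> M" using M(1) r(2) cV unfolding left_ideal_sp_def by blast
    moreover have "c \<star> (unit - r \<star> y) \<in> C"
      unfolding eq using CV(1) e(2) y(2) cV r(1)
      by (auto simp: left_ideal_sp_def mul_closed intro!: subspace_diff)
    moreover have "e + (c \<star> r) \<star> y \<in> I"
      using I e(1) y(1) cV r(1) by (auto simp: left_ideal_sp_def mul_closed intro!: subspace_add)
    moreover have "unit = (e + (c \<star> r) \<star> y) + c \<star> (unit - r \<star> y)"
      unfolding eq using e(3) by (simp add: algebra_simps)
    moreover have "left_ideal_sp (C \<inter> M)"
      using CV(1) M(1) unfolding left_ideal_sp_def by (auto intro: subspace_inter)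
    ultimately have "P (C \<inter> M)" unfolding P_def by blast
    then have "dim C \<le> dim (C \<inter> M)" by (rule C(2))
    moreover have "dim (C \<inter> M) < dim C"
      by (rule dim_strict_mono[OF _ _ _ finite_B0])
        (use \<open>left_ideal_sp (C \<inter> M)\<close> CV y(2) M(2) V_le in \<open>auto simp: left_ideal_sp_def\<close>)
    ultimately show False by simp
  qed
  have "x \<star> e = x" if x: "x \<in> I" for x
  proof -
    have xV: "x \<in> V" "e \<in> V" "c \<in> V" using x e CV by auto
    have "x = x \<star> e + x \<star> c"
      using unit_right[OF xV(1)] unfolding e(3) by (simp add: mul_add_right)
    moreover have "x \<star> c = 0"
    proof (rule disj)
      show "x \<star> c \<in> C" using CV(1) xV e(2) unfolding left_ideal_sp_def by blast
      have "x \<star> c = x - x \<star> e" using calculation by (simp add: algebra_simps)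
      then show "x \<star> c \<in> I"
        using I x xV e(1) by (auto simp: left_ideal_sp_def intro!: subspace_diff)
    qed
    ultimately show ?thesis by simp
  qed
  then show thesis using that e(1) by blast
qed

text \<open>The part \<open>W\<close> of \<open>I\<close> annihilated by \<open>I\<close> from the
  left is a left ideal, so it has a right unit w in \<open>W\<close>; then x = x w = 0 for all x in
  \<open>W\<close>. Since x - e x lies in \<open>W\<close>, the right unit e is also a left unit of
  \<open>I\<close>, and e s = e s e = s e.\<close>

lemma ideal_central_unit:
  assumes I: "left_ideal_sp I" "\<And>x r. \<lbrakk>x \<in> I; r \<in> V\<rbrakk> \<Longrightarrow> x \<star> r \<in> I"
  obtains e where "e \<in> I" "\<And>x. x \<in> I \<Longrightarrow> x \<star> e = x" "\<And>s. s \<in> V \<Longrightarrow> e \<star> s = s \<star> e"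
proof -
  obtain e where e: "e \<in> I" "\<And>x. x \<in> I \<Longrightarrow> x \<star> e = x"
    using left_ideal_right_unit[OF I(1)] by blast
  have IV: "x \<in> V" if "x \<in> I" for x using that I(1) unfolding left_ideal_sp_def by blast
  have Il: "r \<star> x \<in> I" if "x \<in> I" "r \<in> V" for x r
    using that I(1) unfolding left_ideal_sp_def by blast
  define W where "W = {x \<in> I. \<forall>y\<in>I. y \<star> x = 0}"
  have W: "left_ideal_sp W"
    using I(1) unfolding left_ideal_sp_def W_def subspace_def
    by (auto simp: mul_zero_right mul_add_right mul_scale_right assoc[symmetric] IV I(2))
  obtain w where w: "w \<in> W" "\<And>x. x \<in> W \<Longrightarrow> x \<star> w = x"
    using left_ideal_right_unit[OF W] by blast
  have W0: "x = 0" if "x \<in> W" for x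
    using w that unfolding W_def by (metis (mono_tags, lifting) mem_Collect_eq)
  have left: "e \<star> x = x" if x: "x \<in> I" for x
  proof -
    have "x - e \<star> x \<in> W"
      unfolding W_def using x e I(1) Il IV
      by (auto simp: mul_diff_right assoc[symmetric] left_ideal_sp_def intro!: subspace_diff)
    then show ?thesis using W0 by fastforce
  qed
  have "e \<star> s = s \<star> e" if s: "s \<in> V" for s
    using e(2)[OF I(2)[OF e(1) s]] left[OF Il[OF e(1) s]] s IV[OF e(1)] by (simp add: assoc)
  then show thesis using that e by blast
qed

end

section \<open>Twisted trace forms and their radicals\<close>

locale separable_core = separable_bimodule + semisimple_algebra +
  fixes B :: "'b set" and co :: "'b \<Rightarrow> 'b \<Rightarrow> 'a" and g0 :: 'b
  assumes g0: "g0 \<in> V" "cyc g0 = V"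
    and finite_B: "finite B" and B_le: "B \<subseteq> V"
    and co_linear: "Vector_Spaces.linear scale (*) (co b)"
    and co_expand: "x \<in> V \<Longrightarrow> x = (\<Sum>b\<in>B. co b x *s b)"
    and co_basis: "\<lbrakk>b \<in> B; b' \<in> B\<rbrakk> \<Longrightarrow> co b b' = (if b = b' then 1 else 0)"
begin

lemma BV: "b \<in> B \<Longrightarrow> b \<in> V" using B_le by blast

lemma co_add: "co b (x + y) = co b x + co b y"
  and co_scale: "co b (c *s x) = c * co b x"
  using co_linear[of b] unfolding Vector_Spaces.linear_iff by auto

lemma co_zero: "co b 0 = 0"
  using co_scale[of b 0 0] by simp

lemma co_sum: "co b (sum g I) = (\<Sum>i\<in>I. co b (g i))"
  by (induction I rule: infinite_finite_induct) (simp_all add: co_zero co_add)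

lemma expand: "x \<in> V \<Longrightarrow> (\<Sum>b\<in>B. co b x *s b) = x"
  using co_expand by simp

definition tr :: "('b \<Rightarrow> 'b) \<Rightarrow> 'a" where
  "tr h = (\<Sum>b\<in>B. co b (h b))"

lemma tr_comm:
  assumes "endo f" "endo g" "\<And>x. x \<in> V \<Longrightarrow> f x \<in> V" "\<And>x. x \<in> V \<Longrightarrow> g x \<in> V"
  shows "tr (\<lambda>x. f (g x)) = tr (\<lambda>x. g (f x))"
proof -
  have *: "tr (\<lambda>x. f (g x)) = (\<Sum>b\<in>B. \<Sum>c\<in>B. co c (g b) * co b (f c))"
    if fg: "endo f" "\<And>x. x \<in> V \<Longrightarrow> g x \<in> V" for f g
    unfolding tr_def
  proof (rule sum.cong[OF refl])
    fix b assume b: "b \<in> B"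
    have "co b (f (g b)) = co b (f (\<Sum>c\<in>B. co c (g b) *s c))"
      using expand[OF fg(2)[OF BV[OF b]]] by simp
    also have "\<dots> = (\<Sum>c\<in>B. co c (g b) * co b (f c))"
      by (simp add: endo_sum[OF fg(1)] endo_scale[OF fg(1)] co_sum co_scale)
    finally show "co b (f (g b)) = (\<Sum>c\<in>B. co c (g b) * co b (f c))" .
  qed
  have "tr (\<lambda>x. f (g x)) = (\<Sum>b\<in>B. \<Sum>c\<in>B. co c (g b) * co b (f c))"
    by (rule *[OF assms(1,4)])
  also have "\<dots> = (\<Sum>c\<in>B. \<Sum>b\<in>B. co b (f c) * co c (g b))"
    by (subst sum.swap) (simp add: mult.commute)
  also have "\<dots> = tr (\<lambda>x. g (f x))"
    by (rule *[OF assms(2,3), symmetric])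
  finally show ?thesis .
qed

definition T :: "'b \<Rightarrow> 'b \<Rightarrow> 'a" where
  "T k x = tr (\<lambda>b. (x \<star> b) \<star> k)"

lemma T_add: "T k (x + y) = T k x + T k y"
  and T_scale: "T k (c *s x) = c * T k x"
  and T_add_left: "T (k + l) x = T k x + T l x"
  by (simp_all add: T_def tr_def mul_add_left mul_add_right mul_scale_left co_add co_scale sum.distrib
      sum_distrib_left)

lemma T_zero: "T k 0 = 0"
  using T_scale[of k 0 0] by simp

lemma T_sum: "T k (sum g I) = (\<Sum>i\<in>I. T k (g i))"
  by (induction I rule: infinite_finite_induct) (simp_all add: T_zero T_add)

lemma T_diff: "T k (x - y) = T k x - T k y"
  using T_add[of k "x - y" y] by simp

text \<open>By associativity the operator b \<mapsto> x y b k is left multiplication by x after b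
  \<mapsto> y b k. Exchanging the two factors preserves the trace and yields b \<mapsto> y x b
  k.\<close>

lemma T_sym:
  assumes "x \<in> V" "y \<in> V" "k \<in> V"
  shows "T k (x \<star> y) = T k (y \<star> x)"
proof -
  have "T k (x \<star> y) = tr (\<lambda>b. x \<star> ((y \<star> b) \<star> k))"
    unfolding T_def tr_def by (intro sum.cong refl) (use assms BV in \<open>simp add: assoc mul_closed\<close>)
  also have "\<dots> = tr (\<lambda>b. (y \<star> (x \<star> b)) \<star> k)"
    by (rule tr_comm)
      (use assms in \<open>simp_all add: endo_def mul_add_left mul_add_right mul_scale_left mul_scale_right
        mul_closed\<close>)
  also have "\<dots> = T k (y \<star> x)"
    unfolding T_def tr_def by (intro sum.cong refl) (use assms BV in \<open>simp add: assoc mul_closed\<close>)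
  finally show ?thesis .
qed

lemma T_central_shift:
  assumes "e \<in> V" "\<And>s. s \<in> V \<Longrightarrow> e \<star> s = s \<star> e" "x \<in> V" "k \<in> V"
  shows "T (e \<star> k) x = T k (e \<star> x)"
  unfolding T_def tr_def
proof (intro sum.cong refl)
  fix b assume "b \<in> B"
  then have "b \<in> V" by (rule BV)
  then have "(x \<star> b) \<star> (e \<star> k) = (e \<star> (x \<star> b)) \<star> k"
    using assoc[of "x \<star> b" e k] assms(2)[of "x \<star> b"] assms(1,3,4) by (simp add: mul_closed)
  then show "co b ((x \<star> b) \<star> (e \<star> k)) = co b (((e \<star> x) \<star> b) \<star> k)"
    using assms(1,3) \<open>b \<in> V\<close> by (simp add: assoc)
qed

text \<open>One averaged sum is computed in two ways. Collecting the coordinates into traces gives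
  \<Sum> \<open>T (p j) (e \<star> p i)\<close> times \<open>q i \<star> g0 \<star> q j\<close>,
  which is zero by assumption. After an exchange of arguments the coordinates recombine into vectors
  and the same sum equals \<open>e \<star> g0\<close>.\<close>

lemma T_detects_central:
  assumes e: "e \<in> V" "\<And>s. s \<in> V \<Longrightarrow> e \<star> s = s \<star> e"
    and T0: "\<And>z k. \<lbrakk>z \<in> K; k \<in> K\<rbrakk> \<Longrightarrow> T k (e \<star> z) = 0"
  shows "e = 0"
proof -
  have "\<exists>f. f \<in> ops \<and> e \<star> b = f g0" if "b \<in> B" for b
    using g0 mul_closed[OF e(1) BV[OF that]] unfolding cyc_def by blast
  then obtain \<phi> where \<phi>: "\<And>b. b \<in> B \<Longrightarrow> \<phi> b \<in> ops" "\<And>b. b \<in> B \<Longrightarrow> e \<star> b = \<phi> b g0" by metis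
  define G where "G b x y = co b x *s y" for b x y
  have bil: "bilin (G b)" for b
    unfolding G_def by (intro bilinI) (simp_all add: co_add co_scale algebra_simps)
  have Ke: "(p i \<star> (e \<star> b)) \<star> p j = ((e \<star> p i) \<star> b) \<star> p j" if "i < m" "j < m" "b \<in> V" for i j b
    using assoc[of "p i" e b] e(2)[of "p i"] e(1) that by (simp add: pqV)
  have "0 = (\<Sum>i<m. \<Sum>j<m. T (p j) (e \<star> p i) *s ((q i \<star> g0) \<star> q j))"
    using T0 pK by simp
  also have "\<dots> = (\<Sum>i<m. \<Sum>j<m. \<Sum>b\<in>B. G b ((p i \<star> (e \<star> b)) \<star> p j) ((q i \<star> g0) \<star> q j))"
    unfolding T_def tr_def G_def by (intro sum.cong refl) (simp add: scale_sum_left Ke BV)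
  also have "\<dots> = (\<Sum>b\<in>B. conv (G b) (e \<star> b) g0)"
    unfolding conv_def
    by (subst sum.swap, intro sum.cong refl, subst (2) sum.swap, subst sum.swap, rule sum.swap)
  \<comment> \<open>Cyclicity enters here: \<open>e \<star> b\<close> is an operator applied to
    \<open>g0\<close>, and the other argument is \<open>g0\<close> too, so self-adjointness
    exchanges the two arguments.\<close>
  also have "\<dots> = (\<Sum>b\<in>B. conv (G b) g0 (e \<star> b))"
    by (intro sum.cong refl) (simp add: \<phi> conv_ops[OF _ bil] g0)
  also have "\<dots> = (\<Sum>i<m. \<Sum>j<m. \<Sum>b\<in>B. G b ((p i \<star> g0) \<star> p j) ((q i \<star> (e \<star> b)) \<star> q j))"
    unfolding conv_def
    by (subst sum.swap, intro sum.cong refl, rule sum.swap)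
  also have "\<dots> = (\<Sum>i<m. \<Sum>j<m.
      (q i \<star> (e \<star> (\<Sum>b\<in>B. co b ((p i \<star> g0) \<star> p j) *s b))) \<star> q j)"
    unfolding G_def by (simp add: mul_sum mul_scale_left mul_scale_right)
  also have "\<dots> = (\<Sum>i<m. \<Sum>j<m. (q i \<star> (e \<star> ((p i \<star> g0) \<star> p j))) \<star> q j)"
    by (intro sum.cong refl) (simp add: expand g0 mul_closed pqV)
  also have "\<dots> = (\<Sum>i<m. \<Sum>j<m. (q i \<star> ((p i \<star> (e \<star> g0)) \<star> p j)) \<star> q j)"
  proof (intro sum.cong refl)
    fix i j assume "i \<in> {..<m}" "j \<in> {..<m}"
    then have "e \<star> ((p i \<star> g0) \<star> p j) = (p i \<star> (e \<star> g0)) \<star> p j"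
      using e(2)[of "p i"] e(1) g0(1) by (simp add: assoc[symmetric] pqV mul_closed)
    then show "(q i \<star> (e \<star> ((p i \<star> g0) \<star> p j))) \<star> q j = (q i \<star> ((p i \<star> (e \<star> g0)) \<star> p j)) \<star> q j"
      by simp
  qed
  also have "\<dots> = e \<star> g0"
    by (rule pq_sandwich(2)) (simp add: mul_closed e g0)
  finally have eg: "e \<star> g0 = 0" by simp
  obtain f where f: "f \<in> ops" "unit = f g0" using g0 unit_in unfolding cyc_def by blast
  \<comment> \<open>As e is central, multiplication by e commutes with f, so e kills the unit
    \<open>f g0\<close> together with the generator.\<close>
  have "e \<star> f g0 = f (e \<star> g0)"
  proof (rule ops_commute[OF f(1) _ _ g0(1)])
    show "endo ((\<star>) e)" by (simp add: endo_def mul_add_right mul_scale_right)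
    show "e \<star> (k \<star> x) = k \<star> (e \<star> x)" if "k \<in> K" "x \<in> V" for k x
      using that e(1) e(2)[of k] by (simp add: assoc[symmetric] KV)
    show "e \<star> (x \<star> k) = (e \<star> x) \<star> k" if "k \<in> K" "x \<in> V" for k x
      using that e(1) by (simp add: assoc KV)
  qed (simp add: e mul_closed)
  then have "e \<star> unit = 0" using eg f ops_zero_arg by simp
  then show "e = 0" using unit_right e(1) by simp
qed

definition Rad :: "'b \<Rightarrow> 'b set" where
  "Rad k = {x \<in> V. \<forall>s\<in>V. T k (x \<star> s) = 0}"

lemma RadD: "x \<in> Rad k \<Longrightarrow> x \<in> V" "x \<in> Rad k \<Longrightarrow> s \<in> V \<Longrightarrow> T k (x \<star> s) = 0"
  by (simp_all add: Rad_def)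

lemma subspace_Rad: "subspace (Rad k)"
  unfolding Rad_def subspace_def
  by (auto simp: V_zero V_add V_scale mul_zero_left mul_add_left mul_scale_left T_zero T_add T_scale)

text \<open>The defining condition involves right multiples only; closure under left multiplication
  comes from the symmetry of the trace form, which rewrites T(r x s) as T(x s r).\<close>

lemma Rad_ideal:
  assumes "k \<in> V"
  shows "left_ideal_sp (Rad k)" "\<lbrakk>x \<in> Rad k; r \<in> V\<rbrakk> \<Longrightarrow> x \<star> r \<in> Rad k"
proof -
  show "x \<star> r \<in> Rad k" if "x \<in> Rad k" "r \<in> V"
    using that by (simp add: Rad_def mul_closed assoc)
  have "r \<star> x \<in> Rad k" if "x \<in> Rad k" "r \<in> V" for x r
  proof -
    have "T k ((r \<star> x) \<star> s) = 0" if "s \<in> V" for s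
    proof -
      have "T k ((r \<star> x) \<star> s) = T k ((x \<star> s) \<star> r)"
        using \<open>x \<in> Rad k\<close> \<open>r \<in> V\<close> \<open>s \<in> V\<close> assms T_sym[of r "x \<star> s" k]
        by (simp add: assoc RadD mul_closed)
      then show ?thesis
        using \<open>x \<in> Rad k\<close> \<open>r \<in> V\<close> \<open>s \<in> V\<close> by (simp add: assoc RadD mul_closed)
    qed
    then show ?thesis using that by (simp add: Rad_def mul_closed)
  qed
  then show "left_ideal_sp (Rad k)"
    unfolding left_ideal_sp_def using subspace_Rad RadD(1) by blast
qed

text \<open>The form at k + e l is \<open>T k x + T l (e \<star> x)\<close>. As e lies in
  \<open>Rad k\<close>, the first summand vanishes on multiples of e, while the second depends only
  on e x. The two do not interact, so the new radical is contained in the old one and can only lose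
  elements.\<close>

lemma nondegenerate_trace_form: "\<exists>k\<in>V. Rad k = {0}"
proof -
  have "\<exists>k. k \<in> V \<and> (\<forall>l. l \<in> V \<longrightarrow> dim (Rad k) \<le> dim (Rad l))"
    by (rule ex_has_least_nat[of "\<lambda>k. k \<in> V" 0 "\<lambda>k. dim (Rad k)"]) (rule V_zero)
  then obtain k where k: "k \<in> V" "\<And>l. l \<in> V \<Longrightarrow> dim (Rad k) \<le> dim (Rad l)" by blast
  have "Rad k = {0}"
  proof (rule ccontr)
    assume "Rad k \<noteq> {0}"
    moreover have "0 \<in> Rad k" by (rule subspace_0[OF subspace_Rad])
    ultimately obtain x0 where x0: "x0 \<in> Rad k" "x0 \<noteq> 0" by blast
    obtain e where e: "e \<in> Rad k" "\<And>x. x \<in> Rad k \<Longrightarrow> x \<star> e = x" "\<And>s. s \<in> V \<Longrightarrow> e \<star> s = s \<star> e"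
      using ideal_central_unit[OF Rad_ideal[OF k(1)]] by blast
    have eV: "e \<in> V" by (rule RadD(1)[OF e(1)])
    have "e \<noteq> 0" using e(2)[OF x0(1)] x0(2) mul_zero_right by auto
    then obtain z l where zl: "z \<in> K" "l \<in> K" "T l (e \<star> z) \<noteq> 0"
      using T_detects_central[OF eV e(3)] by blast
    define k' where "k' = k + e \<star> l"
    have V: "l \<in> V" "z \<in> V" "k' \<in> V" unfolding k'_def using zl k(1) eV by (simp_all add: KV V_add mul_closed)
    have T': "T k' x = T k x + T l (e \<star> x)" if "x \<in> V" for x
      unfolding k'_def T_add_left using T_central_shift[OF eV e(3) that V(1)] by simp
    have "Rad k' \<subseteq> Rad k"
    proof
      fix x assume x: "x \<in> Rad k'"
      have xV: "x \<in> V" by (rule RadD(1)[OF x])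
      have "T k (x \<star> s) = 0" if s: "s \<in> V" for s
      proof -
        \<comment> \<open>Testing against s e in place of s isolates the component at e: there
          \<open>T k\<close> is zero because e lies in \<open>Rad k\<close>, so vanishing of
          \<open>T k'\<close> forces the added term to vanish, for s as well as for s e.\<close>
        have c: "e \<star> (x \<star> s) = x \<star> (s \<star> e)" using e(3)[of "x \<star> s"] eV xV s by (simp add: assoc mul_closed)
        have "e \<star> (x \<star> (s \<star> e)) = (e \<star> e) \<star> (x \<star> s)"
          unfolding c[symmetric] using eV xV s by (simp add: assoc mul_closed)
        then have ee: "e \<star> (x \<star> (s \<star> e)) = e \<star> (x \<star> s)" using e(2)[OF e(1)] by simp
        have "T k' (x \<star> (s \<star> e)) = 0" using RadD(2)[OF x] s eV by (simp add: mul_closed)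
        moreover have "T k (x \<star> (s \<star> e)) = 0"
          unfolding c[symmetric] using RadD(2)[OF e(1)] xV s by (simp add: mul_closed)
        ultimately have "T l (e \<star> (x \<star> s)) = 0"
          using T'[of "x \<star> (s \<star> e)"] ee xV s eV by (simp add: mul_closed)
        then show ?thesis
          using T'[of "x \<star> s"] RadD(2)[OF x s] xV s by (simp add: mul_closed)
      qed
      then show "x \<in> Rad k" using xV by (simp add: Rad_def)
    qed
    \<comment> \<open>On \<open>e \<star> z\<close> the old form is zero and the added term is
      \<open>T l (e \<star> z)\<close>, nonzero by the choice of z and l.\<close>
    moreover have "e \<notin> Rad k'"
    proof
      assume "e \<in> Rad k'"
      then have "T k' (e \<star> z) = 0" using RadD(2) V by blast
      moreover have "e \<star> (e \<star> z) = e \<star> z"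
        using e(2)[OF e(1)] assoc[OF eV eV V(2)] by simp
      ultimately show False
        using T'[of "e \<star> z"] RadD(2)[OF e(1) V(2)] zl(3) eV V by (simp add: mul_closed)
    qed
    ultimately have "Rad k' \<subset> Rad k" using e(1) by blast
    moreover have "Rad k \<subseteq> span B0" using RadD(1) V_le by blast
    ultimately have "dim (Rad k') < dim (Rad k)"
      using dim_strict_mono[OF subspace_Rad] finite_B0 by blast
    then show False using k(2)[OF V(3)] by simp
  qed
  then show ?thesis using k(1) by blast
qed

text \<open>Left multiplication by s on \<open>B\<close> and right multiplication by s on the basis
  dual to \<open>B\<close> under \<open>T k\<close> have transposed matrices, hence the common
  \<open>M\<close>. The products sum to the unit because \<open>T k\<close> of (\<Sum> u b y b) s is
  the trace of b \<mapsto> s b k, that is \<open>T k s\<close>, and the form is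
  nondegenerate.\<close>

lemma dual_bases:
  "\<exists>u y M. (\<forall>b\<in>B. u b \<in> V \<and> y b \<in> V) \<and>
     (\<forall>s\<in>V. \<forall>b\<in>B. s \<star> u b = (\<Sum>b'\<in>B. M s b' b *s u b') \<and>
       y b \<star> s = (\<Sum>b'\<in>B. M s b b' *s y b')) \<and>
     (\<Sum>b\<in>B. u b \<star> y b) = unit"
proof -
  obtain k where k: "k \<in> V" "Rad k = {0}" using nondegenerate_trace_form by blast
  have nondeg: "x = y" if "x \<in> V" "y \<in> V" "\<And>s. s \<in> V \<Longrightarrow> T k (x \<star> s) = T k (y \<star> s)" for x y
  proof -
    have "x - y \<in> Rad k" using that by (simp add: Rad_def V_diff mul_diff_left T_diff)
    then show ?thesis using k(2) by simp
  qed
  \<comment> \<open>\<open>\<Theta> y\<close> records the functional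
    \<open>T k (y \<star> _)\<close> by its values on \<open>B\<close>. Nondegeneracy makes \<Theta>
    injective, hence onto, and the preimages of the elements of \<open>B\<close> form the dual
    basis.\<close>
  define \<Theta> where "\<Theta> y = (\<Sum>b\<in>B. T k (y \<star> b) *s b)" for y
  have ex: "\<exists>y\<in>V. \<Theta> y = v" if "v \<in> V" for v
  proof (rule injective_endomorphism_surj[OF subspace_V finite_B0 V_le _ _ _ that])
    show "Vector_Spaces.linear scale scale \<Theta>"
      unfolding endo_linear[symmetric] \<Theta>_def endo_def
      by (simp add: mul_add_left mul_scale_left T_add T_scale scale_left_distrib sum.distrib
          scale_sum_right)
    show "\<Theta> x \<in> V" for x unfolding \<Theta>_def by (intro V_sum V_scale BV)
    show "x = 0" if x: "x \<in> V" "\<Theta> x = 0" for x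
    proof -
      have T0: "T k (x \<star> b) = 0" if "b \<in> B" for b
      proof -
        have "co b (\<Theta> x) = (\<Sum>c\<in>B. if c = b then T k (x \<star> c) else 0)"
          unfolding \<Theta>_def co_sum co_scale
          by (intro sum.cong refl) (use that in \<open>simp add: co_basis\<close>)
        then show ?thesis using x(2) finite_B that by (simp add: co_zero)
      qed
      have "T k (x \<star> s) = 0" if "s \<in> V" for s
        by (subst co_expand[OF that]) (simp add: mul_sum mul_scale_right T_sum T_scale T0)
      then show ?thesis using nondeg[OF x(1) V_zero] by (simp add: mul_zero_left T_zero)
    qed
  qed
  have "\<exists>y. y \<in> V \<and> \<Theta> y = b" if "b \<in> B" for b using ex[OF BV[OF that]] by blast
  then obtain y where y: "\<And>b. b \<in> B \<Longrightarrow> y b \<in> V" "\<And>b. b \<in> B \<Longrightarrow> \<Theta> (y b) = b" by metis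
  have T_y_B: "T k (y b \<star> b') = (if b = b' then 1 else 0)" if "b \<in> B" "b' \<in> B" for b b'
  proof -
    have "co b' (\<Theta> (y b)) = (\<Sum>c\<in>B. if c = b' then T k (y b \<star> c) else 0)"
      unfolding \<Theta>_def co_sum co_scale
      by (intro sum.cong refl) (use that in \<open>simp add: co_basis\<close>)
    then show ?thesis using y(2)[OF that(1)] finite_B that by (auto simp: co_basis split: if_splits)
  qed
  have T_y: "T k (y b \<star> x) = co b x" if "b \<in> B" "x \<in> V" for b x
  proof -
    have "T k (y b \<star> x) = (\<Sum>c\<in>B. co c x * T k (y b \<star> c))"
      by (subst co_expand[OF that(2)]) (simp add: mul_sum mul_scale_right T_sum T_scale)
    also have "\<dots> = (\<Sum>c\<in>B. if c = b then co c x else 0)"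
      by (intro sum.cong refl) (use that T_y_B in auto)
    finally show ?thesis using finite_B that by simp
  qed
  \<comment> \<open>The factor k is placed into u so that the sum of the products u b y b, tested by
    the form, reproduces the twisted trace.\<close>
  define u where "u b = b \<star> k" for b
  define M where "M s b' b = co b' (s \<star> b)" for s b' b
  have left: "s \<star> u b = (\<Sum>b'\<in>B. M s b' b *s u b')" if "s \<in> V" "b \<in> B" for s b
  proof -
    have "s \<star> u b = (s \<star> b) \<star> k" unfolding u_def using that k(1) BV by (simp add: assoc)
    also have "\<dots> = (\<Sum>b'\<in>B. co b' (s \<star> b) *s b') \<star> k"
      using that BV by (simp add: expand mul_closed)
    finally show ?thesis unfolding M_def u_def by (simp add: mul_sum mul_scale_left)
  qed
  have right: "y b \<star> s = (\<Sum>b'\<in>B. M s b b' *s y b')" if s: "s \<in> V" "b \<in> B" for s b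
  proof (rule nondeg)
    show "y b \<star> s \<in> V" using s y(1) mul_closed by simp
    show "(\<Sum>b'\<in>B. M s b b' *s y b') \<in> V" by (intro V_sum V_scale y(1))
    fix x assume x: "x \<in> V"
    have "T k ((y b \<star> s) \<star> x) = co b (s \<star> x)"
      using s x y(1) by (simp add: assoc T_y mul_closed)
    also have "\<dots> = (\<Sum>b'\<in>B. co b' x * co b (s \<star> b'))"
      by (subst co_expand[OF x]) (simp add: mul_sum mul_scale_right co_sum co_scale)
    also have "\<dots> = T k ((\<Sum>b'\<in>B. M s b b' *s y b') \<star> x)"
      unfolding M_def by (simp add: mul_sum mul_scale_left T_sum T_scale T_y x mult.commute)
    finally show "T k ((y b \<star> s) \<star> x) = T k ((\<Sum>b'\<in>B. M s b b' *s y b') \<star> x)" .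
  qed
  have "(\<Sum>b\<in>B. u b \<star> y b) = unit"
  proof (rule nondeg)
    have uV: "u b \<in> V" if "b \<in> B" for b unfolding u_def using that k(1) by (simp add: mul_closed BV)
    show "(\<Sum>b\<in>B. u b \<star> y b) \<in> V" by (intro V_sum mul_closed uV y(1))
    show "unit \<in> V" by (rule unit_in)
    fix s assume s: "s \<in> V"
    have "T k ((\<Sum>b\<in>B. u b \<star> y b) \<star> s) = (\<Sum>b\<in>B. T k ((u b \<star> y b) \<star> s))"
      by (simp add: mul_sum T_sum)
    also have "\<dots> = (\<Sum>b\<in>B. co b ((s \<star> b) \<star> k))"
    proof (intro sum.cong refl)
      fix b assume b: "b \<in> B"
      have "T k ((u b \<star> y b) \<star> s) = T k ((y b \<star> s) \<star> u b)"
        using T_sym[of "u b" "y b \<star> s" k] b s k(1) uV y(1) by (simp add: assoc mul_closed)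
      also have "\<dots> = co b (s \<star> u b)"
        using b s uV y(1) by (simp add: assoc T_y mul_closed)
      finally show "T k ((u b \<star> y b) \<star> s) = co b ((s \<star> b) \<star> k)"
        unfolding u_def using b s k(1) by (simp add: assoc BV)
    qed
    also have "\<dots> = T k (unit \<star> s)"
      using s by (simp add: T_def tr_def unit_left)
    finally show "T k ((\<Sum>b\<in>B. u b \<star> y b) \<star> s) = T k (unit \<star> s)" .
  qed
  moreover have "\<forall>b\<in>B. u b \<in> V \<and> y b \<in> V" using y(1) k(1) by (simp add: u_def mul_closed BV)
  ultimately show ?thesis using left right by blast
qed

end

section \<open>Algebras as records\<close>

context nonassoc_algebra
begin

lemma smult_zero_left: "x \<in> carrier A \<Longrightarrow> 0 \<odot> x = \<zero>"
  using smult_l_distr[of x 0 0] smult_closed[of x 0] by (metis add.r_cancel_one add_0)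

lemma smult_zero_right: "c \<odot> \<zero> = \<zero>"
  using smult_r_distr[of \<zero> \<zero> c] smult_closed[of \<zero> c] by (metis add.r_cancel_one l_zero zero_closed)

lemma smult_minus_one: "x \<in> carrier A \<Longrightarrow> (- 1) \<odot> x = \<ominus> x"
  using smult_l_distr[of x "- 1" 1] smult_closed[of x "- 1"] smult_one[of x] smult_zero_left[of x]
  by (simp add: minus_equality)

lemma mult_zero_left: "x \<in> carrier A \<Longrightarrow> \<zero> \<otimes> x = \<zero>"
  using smult_mult_l[of \<zero> x 0] by (simp add: smult_zero_left m_closed)

lemma mult_zero_right: "x \<in> carrier A \<Longrightarrow> x \<otimes> \<zero> = \<zero>"
  using smult_mult_r[of x \<zero> 0] by (simp add: smult_zero_left m_closed)

lemma finsum_smult: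
  assumes "finite I" "\<And>i. i \<in> I \<Longrightarrow> g i \<in> carrier A"
  shows "c \<odot> finsum A g I = (\<Oplus>i\<in>I. c \<odot> g i)"
  using assms by induction (auto simp: smult_zero_right smult_r_distr smult_closed)

lemma finsum_mult_right:
  assumes "finite I" "\<And>i. i \<in> I \<Longrightarrow> g i \<in> carrier A" "x \<in> carrier A"
  shows "x \<otimes> finsum A g I = (\<Oplus>i\<in>I. x \<otimes> g i)"
  using assms by induction (auto simp: mult_zero_right r_distr m_closed)

end

lemma quotient_module_simps:
  "carrier (quotient_module N I) = a_rcosets\<^bsub>N\<^esub> I"
  "mult (quotient_module N I) = rcoset_mult N I"
  "one (quotient_module N I) = I +>\<^bsub>N\<^esub> \<one>\<^bsub>N\<^esub>"
  "zero (quotient_module N I) = I"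
  "add (quotient_module N I) = set_add N"
  "smult (quotient_module N I) = (\<lambda>r X. \<Union>x\<in>X. I +>\<^bsub>N\<^esub> (r \<odot>\<^bsub>N\<^esub> x))"
  by (simp_all add: quotient_module_def FactRing_def ring.defs module.defs)

section \<open>Quotients by two-sided ideals\<close>

locale algebra_ideal = assoc_algebra N + ideal I N for N (structure) and I
begin

abbreviation "Q \<equiv> quotient_module N I"

lemma ideal_smult: "x \<in> I \<Longrightarrow> c \<odot> x \<in> I"
  using I_l_closed[of x "c \<odot> \<one>"] smult_mult_l[of \<one> x c] one_closed
  by (simp add: Icarr smult_closed)

lemma coset_eq_iff:
  assumes "x \<in> carrier N" "y \<in> carrier N"
  shows "I +> x = I +> y \<longleftrightarrow> x \<ominus> y \<in> I"
  using quotient_eq_iff_same_a_r_cos[OF is_ideal assms] by simp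

lemma coset_self: "x \<in> carrier N \<Longrightarrow> x \<in> I +> x"
  by (rule a_rcos_self)

lemma in_coset_iff:
  assumes "x \<in> carrier N"
  shows "y \<in> I +> x \<longleftrightarrow> y \<in> carrier N \<and> y \<ominus> x \<in> I"
proof
  assume y: "y \<in> I +> x"
  have yN: "y \<in> carrier N" using a_r_coset_subset_G[OF a_subset assms] y by blast
  have "I +> y = I +> x" using a_repr_independence[OF y assms a_subgroup] by simp
  then show "y \<in> carrier N \<and> y \<ominus> x \<in> I" using coset_eq_iff[OF yN assms] yN by simp
next
  assume "y \<in> carrier N \<and> y \<ominus> x \<in> I"
  then show "y \<in> I +> x" using coset_eq_iff[of y x] assms coset_self[of y] by simp
qed

lemma carrier_Q: "carrier Q = (+>) I ` carrier N"
  unfolding quotient_module_simps A_RCOSETS_def' by auto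

lemma Q_mult: "\<lbrakk>x \<in> carrier N; y \<in> carrier N\<rbrakk> \<Longrightarrow> (I +> x) \<otimes>\<^bsub>Q\<^esub> (I +> y) = I +> (x \<otimes> y)"
  unfolding quotient_module_simps by (rule rcoset_mult_add)

lemma Q_add: "\<lbrakk>x \<in> carrier N; y \<in> carrier N\<rbrakk> \<Longrightarrow> (I +> x) \<oplus>\<^bsub>Q\<^esub> (I +> y) = I +> (x \<oplus> y)"
  unfolding quotient_module_simps by (rule a_rcos_sum)

lemma Q_one: "\<one>\<^bsub>Q\<^esub> = I +> \<one>"
  by (simp add: quotient_module_simps)

lemma Q_zero: "\<zero>\<^bsub>Q\<^esub> = I"
  by (simp add: quotient_module_simps)

text \<open>Scalar multiplication on cosets is a union over all representatives. Any two of them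
  differ by an element of \<open>I\<close>, and so do their multiples by c, so the union is a single
  coset.\<close>

lemma Q_smult:
  assumes "x \<in> carrier N"
  shows "c \<odot>\<^bsub>Q\<^esub> (I +> x) = I +> (c \<odot> x)"
proof -
  have "I +> (c \<odot> y) = I +> (c \<odot> x)" if "y \<in> I +> x" for y
  proof -
    have y: "y \<in> carrier N" "y \<ominus> x \<in> I" using that in_coset_iff[OF assms] by auto
    have "y = (y \<ominus> x) \<oplus> x" using y(1) assms by (simp add: a_minus_def a_assoc l_neg)
    then have "c \<odot> y = c \<odot> (y \<ominus> x) \<oplus> c \<odot> x"
      using y assms by (metis Icarr smult_r_distr)
    then have "c \<odot> y \<ominus> c \<odot> x = c \<odot> (y \<ominus> x)"
      using y assms by (simp add: a_minus_def a_assoc smult_closed r_neg)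
    then show ?thesis using coset_eq_iff smult_closed y assms ideal_smult by simp
  qed
  then show ?thesis
    unfolding quotient_module_simps using coset_self[OF assms] by blast
qed

lemma Q_cases:
  assumes "X \<in> carrier Q"
  obtains x where "x \<in> carrier N" "X = I +> x"
  using assms unfolding carrier_Q by blast

lemma coset_in_Q: "x \<in> carrier N \<Longrightarrow> I +> x \<in> carrier Q"
  unfolding carrier_Q by blast

lemma coset_zero: "I +> \<zero> = I"
  using a_rcos_const[OF zero_closed] .

lemma ring_Q: "ring Q"
proof (rule ringI)
  show "abelian_group Q"
  proof (rule abelian_groupI)
    show "\<zero>\<^bsub>Q\<^esub> \<in> carrier Q" using coset_in_Q[of \<zero>] by (simp add: coset_zero Q_zero)
    fix X assume "X \<in> carrier Q"
    then obtain x where x: "x \<in> carrier N" "X = I +> x" by (rule Q_cases)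
    show "\<zero>\<^bsub>Q\<^esub> \<oplus>\<^bsub>Q\<^esub> X = X"
      using Q_add[of \<zero> x] x by (simp add: coset_zero Q_zero)
    show "\<exists>Y\<in>carrier Q. Y \<oplus>\<^bsub>Q\<^esub> X = \<zero>\<^bsub>Q\<^esub>"
      using x by (intro bexI[of _ "I +> (\<ominus> x)"])
        (simp_all add: Q_add coset_in_Q coset_zero Q_zero l_neg)
  qed (auto elim!: Q_cases simp: Q_add coset_in_Q a_ac)
  show "Group.monoid Q"
    by (rule monoidI) (auto elim!: Q_cases simp: Q_mult Q_one coset_in_Q m_assoc)
qed (auto elim!: Q_cases simp: Q_mult Q_add l_distr r_distr)

lemma assoc_algebra_Q: "assoc_algebra Q"
proof -
  interpret Q: ring Q by (rule ring_Q)
  have nQ: "nonassoc_algebra Q"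
  proof
    fix c d X Y assume "X \<in> carrier Q" "Y \<in> carrier Q"
    then obtain x y where xy: "x \<in> carrier N" "X = I +> x" "y \<in> carrier N" "Y = I +> y"
      by (elim Q_cases)
    show "c \<odot>\<^bsub>Q\<^esub> X \<in> carrier Q"
      unfolding xy Q_smult[OF xy(1)] using xy by (intro coset_in_Q smult_closed)
    show "(c + d) \<odot>\<^bsub>Q\<^esub> X = c \<odot>\<^bsub>Q\<^esub> X \<oplus>\<^bsub>Q\<^esub> d \<odot>\<^bsub>Q\<^esub> X"
      "c \<odot>\<^bsub>Q\<^esub> (X \<oplus>\<^bsub>Q\<^esub> Y) = c \<odot>\<^bsub>Q\<^esub> X \<oplus>\<^bsub>Q\<^esub> c \<odot>\<^bsub>Q\<^esub> Y"
      "(c * d) \<odot>\<^bsub>Q\<^esub> X = c \<odot>\<^bsub>Q\<^esub> (d \<odot>\<^bsub>Q\<^esub> X)"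
      "1 \<odot>\<^bsub>Q\<^esub> X = X"
      "(c \<odot>\<^bsub>Q\<^esub> X) \<otimes>\<^bsub>Q\<^esub> Y = c \<odot>\<^bsub>Q\<^esub> (X \<otimes>\<^bsub>Q\<^esub> Y)"
      "X \<otimes>\<^bsub>Q\<^esub> (c \<odot>\<^bsub>Q\<^esub> Y) = c \<odot>\<^bsub>Q\<^esub> (X \<otimes>\<^bsub>Q\<^esub> Y)"
      using xy
      by (simp_all add: Q_smult Q_add Q_mult smult_closed m_closed smult_l_distr smult_r_distr smult_assoc
          smult_one smult_mult_l smult_mult_r)
  qed (simp_all add: Q.l_distr Q.r_distr)
  show ?thesis by (intro assoc_algebra.intro nQ ring_Q)
qed

end

section \<open>The tensor product of two associative algebras\<close>

abbreviation keys :: "('k \<Rightarrow>\<^sub>0 'f::zero) \<Rightarrow> 'k set" where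
  "keys \<equiv> Poly_Mapping.keys"

abbreviation lookup :: "('k \<Rightarrow>\<^sub>0 'f::zero) \<Rightarrow> 'k \<Rightarrow> 'f" where
  "lookup \<equiv> Poly_Mapping.lookup"

abbreviation scl :: "'f::field \<Rightarrow> ('k \<Rightarrow>\<^sub>0 'f) \<Rightarrow> ('k \<Rightarrow>\<^sub>0 'f)" where
  "scl c \<equiv> Poly_Mapping.map ((*) c)"

abbreviation mon :: "'k \<Rightarrow> 'f::field \<Rightarrow> ('k \<Rightarrow>\<^sub>0 'f)" where
  "mon \<equiv> Poly_Mapping.single"

lemma lookup_scl: "lookup (scl c f) k = c * lookup f k"
  by transfer (simp add: when_def)

lemma scl_add: "scl c (f + g) = scl c f + scl c g"
  and scl_add_left: "scl (c + d) f = scl c f + scl d f"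
  and scl_scl: "scl c (scl d f) = scl (c * d) f"
  and scl_one: "scl 1 f = f"
  and scl_minus_one: "scl (- 1) f = - f"
  and scl_diff: "scl c (f - g) = scl c f - scl c g"
  by (rule poly_mapping_eqI; simp add: lookup_scl lookup_add lookup_minus algebra_simps)+

lemma scl_mono: "scl c (mon p d) = mon p (c * d)"
  by (rule poly_mapping_eqI) (simp add: lookup_scl lookup_single when_def)

lemma scl_zero: "scl c (0 :: 'k \<Rightarrow>\<^sub>0 'f::field) = 0"
  by (rule poly_mapping_eqI) (simp add: lookup_scl)

lemma scl_sum: "scl c (sum g I) = (\<Sum>i\<in>I. scl c (g i))"
  by (induction I rule: infinite_finite_induct) (simp_all add: scl_zero scl_add)

lemma keys_scl: "keys (scl c f) \<subseteq> keys f"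
  by (auto simp: in_keys_iff lookup_scl)

lemma sum_monos:
  assumes "finite P" "keys f \<subseteq> P"
  shows "f = (\<Sum>p\<in>P. mon p (lookup f p))"
proof (rule poly_mapping_eqI)
  fix k
  have "(\<Sum>p\<in>P. lookup (mon p (lookup f p)) k)
      = (\<Sum>p\<in>P. if p = k then lookup f k else 0)"
    by (intro sum.cong refl) (simp add: lookup_single when_def)
  also have "\<dots> = lookup f k"
    using assms by (auto simp: in_keys_iff)
  finally show "lookup f k
      = lookup (\<Sum>p\<in>P. mon p (lookup f p)) k"
    by (simp add: lookup_sum)
qed

text \<open>This reduces additive statements about formal sums to single basis elements, while
  keeping the support in the set \<open>C\<close> on which the laws of the underlying algebra are
  available.\<close>

lemma mono_induct [consumes 1, case_names zero mon add]:
  assumes "keys f \<subseteq> C"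
    and "P 0" "\<And>p c. p \<in> C \<Longrightarrow> P (mon p c)"
    and "\<And>f g. \<lbrakk>keys f \<subseteq> C; keys g \<subseteq> C; P f; P g\<rbrakk> \<Longrightarrow> P (f + g)"
  shows "P f"
proof -
  have "keys (\<Sum>p\<in>S. mon p (lookup f p)) \<subseteq> C
      \<and> P (\<Sum>p\<in>S. mon p (lookup f p))"
    if "finite S" "S \<subseteq> C" for S
    using that
  proof (induction S)
    case (insert p S)
    have "keys (mon p (lookup f p)) \<subseteq> C" using insert.prems by simp
    moreover have "keys (mon p (lookup f p)
        + (\<Sum>p\<in>S. mon p (lookup f p))) \<subseteq> C"
      using insert calculation by (intro order.trans[OF keys_add]) auto
    ultimately show ?case using insert assms(3,4) by simp
  qed (simp add: assms(2))
  from this[OF _ assms(1)] sum_monos[of "keys f" f] show ?thesis by simp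
qed

text \<open>
  No law is assumed for the operation on basis elements, as multiplication in an algebra is only
  controlled on its carrier.
\<close>

definition pmul :: "('k \<Rightarrow> 'k \<Rightarrow> 'k) \<Rightarrow> ('k \<Rightarrow>\<^sub>0 'f::field) \<Rightarrow> ('k \<Rightarrow>\<^sub>0 'f) \<Rightarrow> ('k \<Rightarrow>\<^sub>0 'f)" where
  "pmul opr f g = (\<Sum>p\<in>keys f. \<Sum>q\<in>keys g.
     mon (opr p q) (lookup f p * lookup g q))"

text \<open>Terms outside the supports vanish, so different formal sums can share one index set;
  additivity in each argument follows from this.\<close>

lemma pmul_superset:
  assumes "finite P" "keys f \<subseteq> P" "finite Q" "keys g \<subseteq> Q"
  shows "pmul opr f g
    = (\<Sum>p\<in>P. \<Sum>q\<in>Q. mon (opr p q) (lookup f p * lookup g q))"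
proof -
  have "pmul opr f g = (\<Sum>p\<in>keys f. \<Sum>q\<in>Q.
      mon (opr p q) (lookup f p * lookup g q))"
    unfolding pmul_def
    by (intro sum.cong refl sum.mono_neutral_left) (use assms in \<open>auto simp: in_keys_iff\<close>)
  also have "\<dots> = (\<Sum>p\<in>P. \<Sum>q\<in>Q.
      mon (opr p q) (lookup f p * lookup g q))"
    by (intro sum.mono_neutral_left) (use assms in \<open>auto simp: in_keys_iff\<close>)
  finally show ?thesis .
qed

lemma pmul_add_left: "pmul opr (f + f') g = pmul opr f g + pmul opr f' g"
proof -
  let ?P = "keys f \<union> keys f'" and ?Q = "keys g"
  have P: "pmul opr h g
    = (\<Sum>p\<in>?P. \<Sum>q\<in>?Q. mon (opr p q) (lookup h p * lookup g q))"
    if "keys h \<subseteq> ?P" for h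
    by (rule pmul_superset) (use that in simp_all)
  show ?thesis
    by (subst (1 2 3) P)
      (simp_all add: keys_add lookup_add distrib_right single_add sum.distrib)
qed

lemma pmul_add_right: "pmul opr f (g + g') = pmul opr f g + pmul opr f g'"
proof -
  let ?Q = "keys g \<union> keys g'" and ?P = "keys f"
  have P: "pmul opr f h
    = (\<Sum>p\<in>?P. \<Sum>q\<in>?Q. mon (opr p q) (lookup f p * lookup h q))"
    if "keys h \<subseteq> ?Q" for h
    by (rule pmul_superset) (use that in simp_all)
  show ?thesis
    by (subst (1 2 3) P)
      (simp_all add: keys_add lookup_add distrib_left single_add sum.distrib)
qed

lemma pmul_mono: "pmul opr (mon p c) (mon q d) = mon (opr p q) (c * d)"
  by (subst pmul_superset[of "{p}" _ "{q}"]) auto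

lemma pmul_zero: "pmul opr 0 g = 0" "pmul opr f 0 = 0"
  by (simp_all add: pmul_def)

lemma pmul_diff: "pmul opr (f - f') g = pmul opr f g - pmul opr f' g"
  "pmul opr f (g - g') = pmul opr f g - pmul opr f g'"
  using pmul_add_left[of opr "f - f'" f' g] pmul_add_right[of opr f "g - g'" g']
  by (simp_all add: algebra_simps)

lemma pmul_scl: "pmul opr (scl c f) g = scl c (pmul opr f g)"
  "pmul opr f (scl c g) = scl c (pmul opr f g)"
proof -
  show "pmul opr (scl c f) g = scl c (pmul opr f g)"
    by (subst (1 2) pmul_superset[of "keys f" _ "keys g"])
      (simp_all add: keys_scl lookup_scl scl_sum scl_mono mult_ac)
  show "pmul opr f (scl c g) = scl c (pmul opr f g)"
    by (subst (1 2) pmul_superset[of "keys f" _ "keys g"])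
      (simp_all add: keys_scl lookup_scl scl_sum scl_mono mult_ac)
qed

lemma pmul_sum_right: "pmul opr f (sum g I) = (\<Sum>i\<in>I. pmul opr f (g i))"
  by (induction I rule: infinite_finite_induct) (simp_all add: pmul_zero pmul_add_right)

lemma keys_pmul:
  assumes "keys f \<subseteq> C" "keys g \<subseteq> C"
    "\<And>p q. \<lbrakk>p \<in> C; q \<in> C\<rbrakk> \<Longrightarrow> opr p q \<in> C"
  shows "keys (pmul opr f g) \<subseteq> C"
  using assms(1)
proof (induction rule: mono_induct)
  case (mon p c)
  show ?case using assms(2)
  proof (induction rule: mono_induct)
    case (add f g)
    then show ?case unfolding pmul_add_right by (intro order.trans[OF keys_add]) auto
  qed (use assms(3) mon in \<open>simp_all add: pmul_zero pmul_mono\<close>)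
next
  case (add f g)
  then show ?case unfolding pmul_add_left by (intro order.trans[OF keys_add]) auto
qed (simp add: pmul_zero)

lemma pmul_assoc:
  assumes "keys f \<subseteq> C" "keys g \<subseteq> C" "keys h \<subseteq> C"
    "\<And>p q r. \<lbrakk>p \<in> C; q \<in> C; r \<in> C\<rbrakk> \<Longrightarrow> opr (opr p q) r = opr p (opr q r)"
  shows "pmul opr (pmul opr f g) h = pmul opr f (pmul opr g h)"
  using assms(1)
proof (induction rule: mono_induct)
  case (mon p c)
  show ?case using assms(2)
  proof (induction rule: mono_induct)
    case (mon q d)
    show ?case using assms(3)
    proof (induction rule: mono_induct)
      case (mon r e)
      then show ?case using \<open>p \<in> C\<close> \<open>q \<in> C\<close> by (simp add: pmul_mono assms(4) mult.assoc)
    qed (simp_all add: pmul_zero pmul_add_right)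
  qed (simp_all add: pmul_zero pmul_add_right pmul_add_left)
qed (simp_all add: pmul_zero pmul_add_left)

lemma keys_relation:
  "keys (mon p a - (mon q b + mon r c)) \<subseteq> {p, q, r}"
  "keys (mon p a - mon q b) \<subseteq> {p, q}"
  by (auto simp: in_keys_iff lookup_minus lookup_add lookup_single when_def split: if_splits)

section \<open>The algebra of formal sums of pairs and its ideal of relations\<close>

definition pair_opr :: "('f, 'a) module \<Rightarrow> ('f, 'b) module \<Rightarrow> 'a \<times> 'b \<Rightarrow> 'a \<times> 'b \<Rightarrow> 'a \<times> 'b" where
  "pair_opr R S p q = (fst p \<otimes>\<^bsub>R\<^esub> fst q, snd p \<otimes>\<^bsub>S\<^esub> snd q)"

lemma pair_algebra_simps:
  "carrier (pair_algebra R S) = {f. keys f \<subseteq> carrier R \<times> carrier S}"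
  "mult (pair_algebra R S) = pmul (pair_opr R S)"
  "one (pair_algebra R S) = mon (\<one>\<^bsub>R\<^esub>, \<one>\<^bsub>S\<^esub>) 1"
  "zero (pair_algebra R S) = 0"
  "add (pair_algebra R S) = (+)"
  "smult (pair_algebra R S) = scl"
  by (simp_all add: pair_algebra_def pmul_def pair_opr_def fun_eq_iff case_prod_unfold)

locale algebra_pair = R: assoc_algebra R + S: assoc_algebra S
  for R :: "('f::field, 'a) module" and S :: "('f, 'b) module"
begin

abbreviation "P \<equiv> pair_algebra R S"
abbreviation "rel \<equiv> tensor_relations R S"

lemma pair_opr_closed:
  "\<lbrakk>p \<in> carrier R \<times> carrier S; q \<in> carrier R \<times> carrier S\<rbrakk>
    \<Longrightarrow> pair_opr R S p q \<in> carrier R \<times> carrier S"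
  by (auto simp: pair_opr_def)

lemma pmul_one:
  assumes "keys f \<subseteq> carrier R \<times> carrier S"
  shows "pmul (pair_opr R S) (mon (\<one>\<^bsub>R\<^esub>, \<one>\<^bsub>S\<^esub>) 1) f = f"
    "pmul (pair_opr R S) f (mon (\<one>\<^bsub>R\<^esub>, \<one>\<^bsub>S\<^esub>) 1) = f"
  using assms
  by (induction rule: mono_induct)
    (auto simp: pmul_zero pmul_add_right pmul_add_left pmul_mono pair_opr_def)

lemma abelian_group_P: "abelian_group P"
proof (rule abelian_groupI)
  fix x assume x: "x \<in> carrier P"
  then have "- x \<in> carrier P" by (simp add: pair_algebra_simps)
  then show "\<exists>y\<in>carrier P. y \<oplus>\<^bsub>P\<^esub> x = \<zero>\<^bsub>P\<^esub>"
    by (intro bexI[of _ "- x"]) (simp_all add: pair_algebra_simps)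
next
  fix x y assume "x \<in> carrier P" "y \<in> carrier P"
  then show "x \<oplus>\<^bsub>P\<^esub> y \<in> carrier P"
    using keys_add[of x y] by (auto simp: pair_algebra_simps)
qed (simp_all add: pair_algebra_simps add_ac)

lemma ring_P: "ring P"
proof (rule ringI[OF abelian_group_P])
  show "Group.monoid P"
  proof (rule monoidI)
    show "x \<otimes>\<^bsub>P\<^esub> y \<in> carrier P" if "x \<in> carrier P" "y \<in> carrier P" for x y
      using that keys_pmul[where C = "carrier R \<times> carrier S", OF _ _ pair_opr_closed]
      by (simp add: pair_algebra_simps)
    show "x \<otimes>\<^bsub>P\<^esub> y \<otimes>\<^bsub>P\<^esub> z = x \<otimes>\<^bsub>P\<^esub> (y \<otimes>\<^bsub>P\<^esub> z)"
      if "x \<in> carrier P" "y \<in> carrier P" "z \<in> carrier P" for x y z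
      unfolding pair_algebra_simps
      by (rule pmul_assoc[where C = "carrier R \<times> carrier S"])
        (use that in \<open>auto simp: pair_algebra_simps pair_opr_def R.m_assoc S.m_assoc\<close>)
  qed (simp_all add: pair_algebra_simps pmul_one)
qed (simp_all add: pair_algebra_simps pmul_add_left pmul_add_right)

lemma assoc_algebra_P: "assoc_algebra P"
proof -
  interpret P: ring P by (rule ring_P)
  have "nonassoc_algebra P"
  proof
    show "c \<odot>\<^bsub>P\<^esub> x \<in> carrier P" if "x \<in> carrier P" for c x
      using that keys_scl[of c x] by (auto simp: pair_algebra_simps)
  qed (simp_all add: P.l_distr P.r_distr,
      simp_all add: pair_algebra_simps scl_add scl_add_left scl_scl scl_one pmul_scl)
  then show ?thesis by (intro assoc_algebra.intro ring_P)
qed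

sublocale P: assoc_algebra P by (rule assoc_algebra_P)

lemma rel_diff: "f \<in> rel \<Longrightarrow> g \<in> rel \<Longrightarrow> f - g \<in> rel"
  using tensor_relations.add[of f R S "scl (- 1) g"] tensor_relations.scale[of g R S "- 1"]
  by (simp add: scl_minus_one)

lemma rel_sum: "(\<And>i. i \<in> I \<Longrightarrow> g i \<in> rel) \<Longrightarrow> sum g I \<in> rel"
  by (induction I rule: infinite_finite_induct)
    (simp_all add: tensor_relations.zero tensor_relations.add)

lemma keys_rel: "f \<in> rel \<Longrightarrow> keys f \<subseteq> carrier R \<times> carrier S"
proof (induction rule: tensor_relations.induct)
  case (add f g)
  then show ?case using keys_add[of f g] by auto
next
  case (scale f c)
  then show ?case using keys_scl[of c f] by auto
next
  case (add_left x x' y)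
  show ?case by (rule order.trans[OF keys_relation(1)]) (use add_left in simp)
next
  case (add_right x y y')
  show ?case by (rule order.trans[OF keys_relation(1)]) (use add_right in simp)
next
  case (smult_left x y c)
  show ?case by (rule order.trans[OF keys_relation(2)]) (use smult_left in \<open>simp add: R.smult_closed\<close>)
next
  case (smult_right x y c)
  show ?case by (rule order.trans[OF keys_relation(2)]) (use smult_right in \<open>simp add: S.smult_closed\<close>)
qed simp

text \<open>A basis element times a generating relation is again a relation of the same kind, up to
  the scalar d. The general case follows by linearity in both factors.\<close>

lemma rel_pmul:
  assumes "g \<in> carrier P" "f \<in> rel"
  shows "pmul (pair_opr R S) g f \<in> rel" "pmul (pair_opr R S) f g \<in> rel"
proof -
  have *: "pmul (pair_opr R S) (mon (a, b) d) f \<in> rel \<and> pmul (pair_opr R S) f (mon (a, b) d) \<in> rel"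
    if ab: "a \<in> carrier R" "b \<in> carrier S" for a b d
    using assms(2)
  proof (induction rule: tensor_relations.induct)
    case zero
    then show ?case by (simp add: pmul_zero tensor_relations.zero)
  next
    case (add f g)
    then show ?case by (simp add: pmul_add_left pmul_add_right tensor_relations.add)
  next
    case (scale f c)
    then show ?case by (simp add: pmul_scl tensor_relations.scale)
  next
    case (add_left x x' y)
    note r = tensor_relations.scale[OF tensor_relations.add_left, of _ R _ _ S d]
    show ?case
      using r[of "a \<otimes>\<^bsub>R\<^esub> x" "a \<otimes>\<^bsub>R\<^esub> x'" "b \<otimes>\<^bsub>S\<^esub> y"] r[of "x \<otimes>\<^bsub>R\<^esub> a" "x' \<otimes>\<^bsub>R\<^esub> a" "y \<otimes>\<^bsub>S\<^esub> b"]
        add_left ab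
      by (simp add: pmul_diff pmul_add_left pmul_add_right pmul_mono pair_opr_def R.l_distr R.r_distr
          scl_diff scl_add scl_mono)
  next
    case (add_right x y y')
    note r = tensor_relations.scale[OF tensor_relations.add_right, of _ R _ S _ d]
    show ?case
      using r[of "a \<otimes>\<^bsub>R\<^esub> x" "b \<otimes>\<^bsub>S\<^esub> y" "b \<otimes>\<^bsub>S\<^esub> y'"] r[of "x \<otimes>\<^bsub>R\<^esub> a" "y \<otimes>\<^bsub>S\<^esub> b" "y' \<otimes>\<^bsub>S\<^esub> b"]
        add_right ab
      by (simp add: pmul_diff pmul_add_left pmul_add_right pmul_mono pair_opr_def S.l_distr S.r_distr
          scl_diff scl_add scl_mono)
  next
    case (smult_left x y c)
    note r = tensor_relations.scale[OF tensor_relations.smult_left, of _ R _ S d c]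
    show ?case
      using r[of "a \<otimes>\<^bsub>R\<^esub> x" "b \<otimes>\<^bsub>S\<^esub> y"] r[of "x \<otimes>\<^bsub>R\<^esub> a" "y \<otimes>\<^bsub>S\<^esub> b"] smult_left ab
      by (simp add: pmul_diff pmul_mono pair_opr_def R.smult_mult_l R.smult_mult_r scl_diff scl_mono
          mult.commute)
  next
    case (smult_right x y c)
    note r = tensor_relations.scale[OF tensor_relations.smult_right, of _ R _ S d c]
    show ?case
      using r[of "a \<otimes>\<^bsub>R\<^esub> x" "b \<otimes>\<^bsub>S\<^esub> y"] r[of "x \<otimes>\<^bsub>R\<^esub> a" "y \<otimes>\<^bsub>S\<^esub> b"] smult_right ab
      by (simp add: pmul_diff pmul_mono pair_opr_def S.smult_mult_l S.smult_mult_r scl_diff scl_mono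
          mult.commute)
  qed
  have "keys g \<subseteq> carrier R \<times> carrier S" using assms(1) by (simp add: pair_algebra_simps)
  then show "pmul (pair_opr R S) g f \<in> rel" "pmul (pair_opr R S) f g \<in> rel"
    by (induction rule: mono_induct)
      (auto simp: pmul_zero pmul_add_left pmul_add_right * tensor_relations.zero tensor_relations.add)
qed

lemma P_minus: "f \<in> carrier P \<Longrightarrow> \<ominus>\<^bsub>P\<^esub> f = - f"
  by (rule P.minus_equality) (simp_all add: pair_algebra_simps)

lemma ideal_rel: "ideal rel P"
proof (rule idealI[OF ring_P])
  show "subgroup rel (add_monoid P)"
  proof (rule P.add.subgroupI)
    show "rel \<subseteq> carrier P" using keys_rel by (auto simp: pair_algebra_simps)
    show "rel \<noteq> {}" using tensor_relations.zero by blast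
    show "\<ominus>\<^bsub>P\<^esub> f \<in> rel" if "f \<in> rel" for f
    proof -
      have "f \<in> carrier P" using that keys_rel by (auto simp: pair_algebra_simps)
      then have "\<ominus>\<^bsub>P\<^esub> f = 0 - f" using P_minus by simp
      then show ?thesis using rel_diff[OF tensor_relations.zero that] by simp
    qed
    show "f \<oplus>\<^bsub>P\<^esub> g \<in> rel" if "f \<in> rel" "g \<in> rel" for f g
      using that by (simp add: pair_algebra_simps tensor_relations.add)
  qed
  show "g \<otimes>\<^bsub>P\<^esub> f \<in> rel" "f \<otimes>\<^bsub>P\<^esub> g \<in> rel" if "f \<in> rel" "g \<in> carrier P" for f g
    using rel_pmul[OF that(2,1)] by (simp_all add: pair_algebra_simps(2))
qed

sublocale T: algebra_ideal P rel
  by (intro algebra_ideal.intro P.assoc_algebra_axioms ideal_rel)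

lemma assoc_algebra_tensor: "assoc_algebra (tensor_algebra R S)"
  unfolding tensor_algebra_def by (rule T.assoc_algebra_Q)

end

section \<open>A separability criterion\<close>

lemma keys_relation_subset:
  "\<lbrakk>p \<in> C; q \<in> C; r \<in> C\<rbrakk> \<Longrightarrow> keys (mon p a - (mon q b + mon r c)) \<subseteq> C"
  "\<lbrakk>p \<in> C; q \<in> C\<rbrakk> \<Longrightarrow> keys (mon p a - mon q b) \<subseteq> C"
  using keys_relation[of p a q b] by blast+

section \<open>The two-sided action of formal sums\<close>

context nonassoc_algebra
begin

text \<open>The formula inside \<open>two_sided_module\<close>, for one explicit formal sum instead
  of a chosen representative of a coset.\<close>

definition act :: "(('a \<times> 'a) \<Rightarrow>\<^sub>0 'f) \<Rightarrow> 'a \<Rightarrow> 'a" where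
  "act f a = (\<Oplus>p\<in>keys f. lookup f p \<odot> ((fst p \<otimes> a) \<otimes> snd p))"

abbreviation "C2 \<equiv> carrier A \<times> carrier A"

lemma act_term_closed:
  "\<lbrakk>p \<in> C2; a \<in> carrier A\<rbrakk> \<Longrightarrow> c \<odot> ((fst p \<otimes> a) \<otimes> snd p) \<in> carrier A"
  by (auto simp: m_closed smult_closed)

lemma act_superset:
  assumes "finite P" "keys f \<subseteq> P" "P \<subseteq> C2" "a \<in> carrier A"
  shows "act f a = (\<Oplus>p\<in>P. lookup f p \<odot> ((fst p \<otimes> a) \<otimes> snd p))"
  unfolding act_def
proof (rule add.finprod_mono_neutral_cong_left[OF assms(1,2)])
  show "lookup f i \<odot> (fst i \<otimes> a \<otimes> snd i) = \<zero>" if "i \<in> P - keys f" for i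
    using assms(3,4) that by (auto simp: in_keys_iff intro!: smult_zero_left m_closed)
  show "(\<lambda>p. lookup f p \<odot> (fst p \<otimes> a \<otimes> snd p)) \<in> P \<rightarrow> carrier A"
    using assms(3,4) act_term_closed by blast
qed simp

lemma act_closed:
  assumes "keys f \<subseteq> C2" "a \<in> carrier A"
  shows "act f a \<in> carrier A"
  unfolding act_def by (rule finsum_closed) (use assms act_term_closed in blast)

lemma act_add:
  assumes "keys f \<subseteq> C2" "keys g \<subseteq> C2" "a \<in> carrier A"
  shows "act (f + g) a = act f a \<oplus> act g a"
proof -
  let ?P = "keys f \<union> keys g"
  let ?t = "\<lambda>h p. lookup h p \<odot> ((fst p \<otimes> a) \<otimes> snd p)"
  have *: "act h a = finsum A (?t h) ?P" if "keys h \<subseteq> ?P" for h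
    by (rule act_superset) (use that assms in auto)
  have cl: "?t h \<in> ?P \<rightarrow> carrier A" for h
    using assms act_term_closed by (intro Pi_I) blast
  have "act (f + g) a = (\<Oplus>p\<in>?P. ?t f p \<oplus> ?t g p)"
    unfolding *[OF keys_add]
    by (rule finsum_cong') (use assms in \<open>auto simp: lookup_add smult_l_distr m_closed smult_closed\<close>)
  also have "\<dots> = finsum A (?t f) ?P \<oplus> finsum A (?t g) ?P"
    by (rule finsum_addf[OF cl cl])
  also have "\<dots> = act f a \<oplus> act g a" by (simp add: *)
  finally show ?thesis .
qed

lemma act_zero: "act 0 a = \<zero>"
  by (simp add: act_def)

lemma act_mon:
  assumes "x \<in> carrier A" "y \<in> carrier A" "a \<in> carrier A"
  shows "act (mon (x, y) c) a = c \<odot> ((x \<otimes> a) \<otimes> y)"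
  by (subst act_superset[of "{(x, y)}"]) (use assms in \<open>auto simp: m_closed smult_closed\<close>)

lemma act_scl:
  assumes "keys f \<subseteq> C2" "a \<in> carrier A"
  shows "act (scl c f) a = c \<odot> act f a"
  using assms(1)
proof (induction rule: mono_induct)
  case (mon p d)
  then obtain x y where p: "p = (x, y)" "x \<in> carrier A" "y \<in> carrier A" by blast
  show ?case
    unfolding p scl_mono act_mon[OF p(2,3) assms(2)]
    using p assms(2) by (intro smult_assoc m_closed)
next
  case (add f g)
  have k: "keys (scl c f) \<subseteq> C2" "keys (scl c g) \<subseteq> C2"
    by (rule order.trans[OF keys_scl add.hyps(1)], rule order.trans[OF keys_scl add.hyps(2)])
  show ?case
    unfolding scl_add act_add[OF k assms(2)] act_add[OF add.hyps assms(2)] add.IH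
    using add.hyps assms(2) by (simp add: smult_r_distr act_closed)
qed (simp add: scl_zero act_zero smult_zero_right)

lemma act_diff:
  assumes "keys f \<subseteq> C2" "keys g \<subseteq> C2" "a \<in> carrier A"
    "act f a = act g a"
  shows "act (f - g) a = \<zero>"
proof -
  have k: "keys (f - g) \<subseteq> C2" using keys_diff[of f g] assms by blast
  have "act (f - g) a \<oplus> act g a = \<zero> \<oplus> act g a"
    using act_add[OF k assms(2,3)] assms by (simp add: act_closed)
  then show ?thesis using assms k by (simp add: act_closed)
qed

text \<open>Each bilinearity relation acts as zero by bilinearity of the product and of the scalar
  action, also in a nonassociative algebra. The inclusion of the keys is carried along because
  additivity of \<open>act\<close> depends on it in the induction.\<close>

lemma act_rel:
  assumes "f \<in> tensor_relations (A\<lparr>carrier := K\<rparr>) (A\<lparr>carrier := K\<rparr>)" "K \<subseteq> carrier A" "a \<in> carrier A"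
  shows "keys f \<subseteq> C2 \<and> act f a = \<zero>"
  using assms(1)
proof (induction rule: tensor_relations.induct)
  case (add f g)
  then show ?case using keys_add[of f g] assms(3) by (auto simp: act_add)
next
  case (scale f c)
  then show ?case using keys_scl[of c f] assms(3) by (auto simp: act_scl smult_zero_right)
next
  case (add_left x x' y)
  then have c: "x \<in> carrier A" "x' \<in> carrier A" "y \<in> carrier A" using assms(2) by auto
  have k: "keys (mon (x, y) 1 + mon (x', y) (1::'f)) \<subseteq> C2"
    by (rule order.trans[OF keys_add]) (use c in simp)
  have "act (mon (x \<oplus> x', y) 1) a = act (mon (x, y) 1 + mon (x', y) 1) a"
    using c assms(3) by (simp add: act_add act_mon l_distr smult_r_distr m_closed smult_one)
  then show ?case
    using c k assms(3) by (intro conjI act_diff keys_relation_subset) simp_all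
next
  case (add_right x y y')
  then have c: "x \<in> carrier A" "y \<in> carrier A" "y' \<in> carrier A" using assms(2) by auto
  have k: "keys (mon (x, y) 1 + mon (x, y') (1::'f)) \<subseteq> C2"
    by (rule order.trans[OF keys_add]) (use c in simp)
  have "act (mon (x, y \<oplus> y') 1) a = act (mon (x, y) 1 + mon (x, y') 1) a"
    using c assms(3) by (simp add: act_add act_mon r_distr smult_r_distr m_closed smult_one)
  then show ?case
    using c k assms(3) by (intro conjI act_diff keys_relation_subset) simp_all
next
  case (smult_left x y c)
  then have k: "x \<in> carrier A" "y \<in> carrier A" using assms(2) by auto
  then have "act (mon (c \<odot> x, y) 1) a = act (mon (x, y) c) a"
    using assms(3) by (simp add: act_mon smult_mult_l m_closed smult_closed smult_one)
  then show ?case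
    using k assms(3) by (intro conjI act_diff keys_relation_subset) (simp_all add: smult_closed)
next
  case (smult_right x y c)
  then have k: "x \<in> carrier A" "y \<in> carrier A" using assms(2) by auto
  then have "act (mon (x, c \<odot> y) 1) a = act (mon (x, y) c) a"
    using assms(3) by (simp add: act_mon smult_mult_r m_closed smult_closed smult_one)
  then show ?case
    using k assms(3) by (intro conjI act_diff keys_relation_subset) (simp_all add: smult_closed)
qed (simp add: act_zero)

lemma pair_coset: "X +>\<^bsub>pair_algebra R S\<^esub> f = (\<lambda>r. r + f) ` X"
  unfolding a_r_coset_def r_coset_def by (auto simp: pair_algebra_simps)

lemma two_sided_module_simps:
  "carrier (two_sided_module A) = carrier A" "zero (two_sided_module A) = \<zero>"
  "add (two_sided_module A) = add A"
  "smult (two_sided_module A) T a = act (SOME f. f \<in> T) a"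
  by (simp_all add: two_sided_module_def act_def Let_def)

text \<open>The representative picked by choice is r + f for some relation r, and r acts as zero.
  The algebras \<open>R\<close> and \<open>S\<close> are arbitrary, since a coset depends only on
  addition of formal sums.\<close>

lemma two_sided_smult_coset:
  assumes "K \<subseteq> carrier A" "keys f \<subseteq> C2" "a \<in> carrier A"
  shows "(tensor_relations (A\<lparr>carrier := K\<rparr>) (A\<lparr>carrier := K\<rparr>) +>\<^bsub>pair_algebra R S\<^esub> f)
    \<odot>\<^bsub>two_sided_module A\<^esub> a = act f a"
proof -
  let ?X = "tensor_relations (A\<lparr>carrier := K\<rparr>) (A\<lparr>carrier := K\<rparr>)"
  have "f \<in> (\<lambda>r. r + f) ` ?X" using tensor_relations.zero by force
  then have "(SOME g. g \<in> (\<lambda>r. r + f) ` ?X) \<in> (\<lambda>r. r + f) ` ?X" by (rule someI)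
  then obtain r where r: "r \<in> ?X" "(SOME g. g \<in> (\<lambda>r. r + f) ` ?X) = r + f" by blast
  show ?thesis
    unfolding two_sided_module_simps pair_coset r(2)
    using act_rel[OF r(1) assms(1,3)] assms by (simp add: act_add act_closed)
qed

end

lemma opposite_simps:
  "carrier (opposite_algebra A) = carrier A" "add (opposite_algebra A) = add A"
  "zero (opposite_algebra A) = zero A" "one (opposite_algebra A) = one A"
  "smult (opposite_algebra A) = smult A" "x \<otimes>\<^bsub>opposite_algebra A\<^esub> y = y \<otimes>\<^bsub>A\<^esub> x"
  by (simp_all add: opposite_algebra_def)

text \<open>The relations mention only the carrier, the addition and the scalar multiplication,
  which an algebra shares with its opposite.\<close>

lemma tensor_relations_opposite:
  "tensor_relations R (opposite_algebra S) = tensor_relations R S"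
proof -
  have "f \<in> tensor_relations R S'"
    if "f \<in> tensor_relations R S"
      and eq: "carrier S' = carrier S" "add S' = add S" "smult S' = smult S" for f S S'
    using that(1)
  proof (induction rule: tensor_relations.induct)
    case (add_left x x' y)
    then show ?case using tensor_relations.add_left[of x R x' y S'] eq by simp
  next
    case (add_right x y y')
    then show ?case using tensor_relations.add_right[of x R y S' y'] eq by simp
  next
    case (smult_left x y c)
    then show ?case using tensor_relations.smult_left[of x R y S' c] eq by simp
  next
    case (smult_right x y c)
    then show ?case using tensor_relations.smult_right[of x R y S' c] eq by simp
  qed (simp_all add: tensor_relations.zero tensor_relations.add tensor_relations.scale)
  from this[of _ S "opposite_algebra S"] this[of _ "opposite_algebra S" S] show ?thesis
    by (auto simp: opposite_simps)
qed

lemma free_module_simps: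
  "carrier (free_module R I) = {f. (\<forall>i. f i \<in> carrier R) \<and> (\<forall>i. i \<notin> I \<longrightarrow> f i = \<zero>\<^bsub>R\<^esub>) \<and>
     finite {i. f i \<noteq> \<zero>\<^bsub>R\<^esub>}}"
  "add (free_module R I) = (\<lambda>f g i. f i \<oplus>\<^bsub>R\<^esub> g i)"
  "smult (free_module R I) = (\<lambda>r f i. r \<otimes>\<^bsub>R\<^esub> f i)"
  by (simp_all add: free_module_def)

context assoc_algebra
begin

lemma assoc_algebra_opposite: "assoc_algebra (opposite_algebra A)"
proof -
  have r: "ring (opposite_algebra A)"
  proof (rule ringI)
    show "abelian_group (opposite_algebra A)"
      by (rule abelian_groupI) (auto simp: opposite_simps a_ac intro!: bexI[of _ "\<ominus> _"] l_neg)
    show "Group.monoid (opposite_algebra A)"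
      by (rule monoidI) (auto simp: opposite_simps m_assoc)
  qed (simp_all add: opposite_simps l_distr r_distr)
  then interpret O: ring "opposite_algebra A" .
  have "nonassoc_algebra (opposite_algebra A)"
    by unfold_locales (simp_all add: opposite_simps smult_closed smult_l_distr smult_r_distr
        smult_assoc smult_one smult_mult_l smult_mult_r l_distr r_distr)
  then show ?thesis by (intro assoc_algebra.intro r)
qed

end

text \<open>
  A locale of its own, because interpreting the pair inside \<open>assoc_algebra\<close> would not terminate:
  the pair algebra is again such an algebra.
\<close>

locale enveloping_algebra = assoc_algebra A for A :: "('f::field, 'a) module" (structure)
begin

sublocale E: algebra_pair A "opposite_algebra A"
  by (intro algebra_pair.intro assoc_algebra_axioms assoc_algebra_opposite)

abbreviation "Env \<equiv> tensor_algebra A (opposite_algebra A)"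
abbreviation "cls f \<equiv> E.rel +>\<^bsub>E.P\<^esub> f"

lemma carrier_EP: "carrier E.P = {f. keys f \<subseteq> C2}"
  by (simp add: pair_algebra_simps opposite_simps)

lemma smult_cls:
  assumes "keys f \<subseteq> C2" "a \<in> carrier A"
  shows "cls f \<odot>\<^bsub>two_sided_module A\<^esub> a = act f a"
  using two_sided_smult_coset[OF order_refl assms]
  by (simp add: tensor_relations_opposite)

text \<open>Acting by x, y after x', y' gives x (x' a y') y = (x x') a (y' y). The second factor is
  thus multiplied in reversed order, as in the opposite algebra.\<close>

lemma act_pmul:
  assumes "keys f \<subseteq> C2" "keys g \<subseteq> C2" "a \<in> carrier A"
  shows "act (pmul (pair_opr A (opposite_algebra A)) f g) a = act f (act g a)"
proof -
  let ?m = "pmul (pair_opr A (opposite_algebra A))"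
  have km: "keys (?m f g) \<subseteq> C2"
    if "keys f \<subseteq> C2" "keys g \<subseteq> C2" for f g
    using keys_pmul[OF that, of "pair_opr A (opposite_algebra A)"] E.pair_opr_closed
    by (simp add: opposite_simps)
  have act_add_arg: "act (mon p c) (x \<oplus> y) = act (mon p c) x \<oplus> act (mon p c) y"
    if "p \<in> C2" "x \<in> carrier A" "y \<in> carrier A" for p c x y
    using that by (cases p) (auto simp: act_mon l_distr r_distr smult_r_distr m_closed)
  show ?thesis
    using assms(1)
  proof (induction rule: mono_induct)
    case (mon p c)
    have pk: "keys (mon p c) \<subseteq> C2" using mon by simp
    show ?case using assms(2)
    proof (induction rule: mono_induct)
      case zero
      show ?case using mon by (cases p) (auto simp: pmul_zero act_zero act_mon smult_zero_right)
    next
      case (mon q d)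
      then show ?case using \<open>p \<in> C2\<close> assms(3)
        by (cases p, cases q)
          (auto simp: pmul_mono pair_opr_def opposite_simps act_mon m_closed smult_closed smult_mult_l
            smult_mult_r smult_assoc m_assoc)
    next
      case (add g1 g2)
      show ?case
        unfolding pmul_add_right act_add[OF km[OF pk add.hyps(1)] km[OF pk add.hyps(2)] assms(3)]
        using add mon assms(3) by (simp add: act_add act_closed act_add_arg)
    qed
  next
    case (add f1 f2)
    show ?case
      unfolding pmul_add_left act_add[OF km[OF add.hyps(1) assms(2)] km[OF add.hyps(2) assms(2)] assms(3)]
        act_add[OF add.hyps act_closed[OF assms(2,3)]] add.IH by (rule refl)
  qed (simp add: pmul_zero act_zero)
qed

lemma Env_cases:
  assumes "X \<in> carrier Env"
  obtains f where "keys f \<subseteq> C2" "X = cls f"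
  using E.T.Q_cases[of X] assms unfolding tensor_algebra_def by (auto simp: carrier_EP)

lemma Env_simps:
  assumes "keys f \<subseteq> C2" "keys g \<subseteq> C2"
  shows "cls f \<oplus>\<^bsub>Env\<^esub> cls g = cls (f + g)"
    "cls f \<otimes>\<^bsub>Env\<^esub> cls g = cls (pmul (pair_opr A (opposite_algebra A)) f g)"
    "cls f \<in> carrier Env"
  using assms E.T.Q_add[of f g] E.T.Q_mult[of f g] E.T.coset_in_Q[of f]
  unfolding tensor_algebra_def by (simp_all add: carrier_EP pair_algebra_simps(2,5))

lemma Env_const: "\<one>\<^bsub>Env\<^esub> = cls (mon (\<one>, \<one>) 1)" "\<zero>\<^bsub>Env\<^esub> = cls 0"
  using E.T.Q_one E.T.Q_zero E.T.coset_zero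
  unfolding tensor_algebra_def by (simp_all add: pair_algebra_simps(3,4) opposite_simps)

lemma cls_eqI:
  assumes "keys f \<subseteq> C2" "keys g \<subseteq> C2" "f - g \<in> E.rel"
  shows "cls f = cls g"
proof -
  have c: "f \<in> carrier E.P" "g \<in> carrier E.P" using assms by (simp_all add: carrier_EP)
  have "f \<ominus>\<^bsub>E.P\<^esub> g = f - g"
    unfolding a_minus_def E.P_minus[OF c(2)] by (simp add: pair_algebra_simps(5))
  then show ?thesis using E.T.coset_eq_iff[OF c] assms(3) by simp
qed

lemma keys_pmul_C2:
  assumes "keys f \<subseteq> C2" "keys g \<subseteq> C2"
  shows "keys (pmul (pair_opr A (opposite_algebra A)) f g) \<subseteq> C2"
  using keys_pmul[OF assms, of "pair_opr A (opposite_algebra A)"] E.pair_opr_closed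
  by (simp add: opposite_simps)

lemma keys_add_C2:
  assumes "keys f \<subseteq> C2" "keys g \<subseteq> C2"
  shows "keys (f + g) \<subseteq> C2"
  using keys_add[of f g] assms by blast

lemma left_module_Env: "left_module Env (two_sided_module A)"
proof -
  interpret T: assoc_algebra Env by (rule E.assoc_algebra_tensor)
  have ag: "abelian_group (two_sided_module A)"
    by (rule abelian_groupI)
      (auto simp: two_sided_module_simps a_ac intro!: bexI[of _ "\<ominus> _"] l_neg)
  have act_arg: "act f (x \<oplus> y) = act f x \<oplus> act f y"
    if "keys f \<subseteq> C2" "x \<in> carrier A" "y \<in> carrier A" for f x y
    using that(1)
  proof (induction rule: mono_induct)
    case (mon p c)
    then show ?case
      using that by (cases p) (auto simp: act_mon l_distr r_distr smult_r_distr m_closed)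
  next
    case (add f g)
    then show ?case using that by (simp add: act_add act_closed a_ac)
  qed (simp add: act_zero)
  show ?thesis
  proof (intro left_module.intro T.ring_axioms ag left_module_axioms.intro)
    fix r x assume "r \<in> carrier Env" "x \<in> carrier (two_sided_module A)"
    then show "r \<odot>\<^bsub>two_sided_module A\<^esub> x \<in> carrier (two_sided_module A)"
      by (auto elim!: Env_cases simp: smult_cls two_sided_module_simps(1) act_closed)
  next
    fix r s x assume "r \<in> carrier Env" "s \<in> carrier Env" "x \<in> carrier (two_sided_module A)"
    then obtain f g where fg: "keys f \<subseteq> C2" "r = cls f"
      "keys g \<subseteq> C2" "s = cls g" "x \<in> carrier A"
      by (auto elim!: Env_cases simp: two_sided_module_simps(1))
    show "(r \<oplus>\<^bsub>Env\<^esub> s) \<odot>\<^bsub>two_sided_module A\<^esub> x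
        = r \<odot>\<^bsub>two_sided_module A\<^esub> x \<oplus>\<^bsub>two_sided_module A\<^esub> s \<odot>\<^bsub>two_sided_module A\<^esub> x"
      using fg by (simp add: Env_simps smult_cls keys_add_C2 act_add two_sided_module_simps(3))
    show "(r \<otimes>\<^bsub>Env\<^esub> s) \<odot>\<^bsub>two_sided_module A\<^esub> x
        = r \<odot>\<^bsub>two_sided_module A\<^esub> (s \<odot>\<^bsub>two_sided_module A\<^esub> x)"
      using fg by (simp add: Env_simps smult_cls keys_pmul_C2 act_pmul act_closed)
  next
    fix r x y
    assume "r \<in> carrier Env" "x \<in> carrier (two_sided_module A)" "y \<in> carrier (two_sided_module A)"
    then show "r \<odot>\<^bsub>two_sided_module A\<^esub> (x \<oplus>\<^bsub>two_sided_module A\<^esub> y)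
        = r \<odot>\<^bsub>two_sided_module A\<^esub> x \<oplus>\<^bsub>two_sided_module A\<^esub> r \<odot>\<^bsub>two_sided_module A\<^esub> y"
      by (auto elim!: Env_cases simp: smult_cls two_sided_module_simps(1,3) act_arg)
  next
    fix x assume "x \<in> carrier (two_sided_module A)"
    then show "\<one>\<^bsub>Env\<^esub> \<odot>\<^bsub>two_sided_module A\<^esub> x = x"
      by (simp add: Env_const smult_cls two_sided_module_simps(1) act_mon smult_one)
  qed
qed

text \<open>Expansion of a linear combination in the left tensor factor, at the level of formal
  sums. The free coefficient d lets the lemma apply to basis elements with any scalar.\<close>

lemma rel_combination_left:
  assumes "finite J" "\<And>j. j \<in> J \<Longrightarrow> x j \<in> carrier A" "y \<in> carrier A"
  shows "mon (\<Oplus>j\<in>J. c j \<odot> x j, y) d - (\<Sum>j\<in>J. mon (x j, y) (d * c j)) \<in> E.rel"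
  using assms(1,2)
proof induction
  case empty
  \<comment> \<open>The empty combination requires the tensor of zero with y to be a relation; it
    arises from pulling out the scalar 0.\<close>
  have "mon (0 \<odot> \<zero>, y) 1 - mon (\<zero>, y) 0 \<in> E.rel"
    by (rule tensor_relations.smult_left) (use assms(3) in \<open>simp_all add: opposite_simps\<close>)
  then have "scl d (mon (\<zero>, y) 1) \<in> E.rel"
    by (intro tensor_relations.scale) (simp add: smult_zero_right)
  then show ?case by (simp add: scl_mono)
next
  case (insert j J)
  let ?s = "\<Oplus>j\<in>J. c j \<odot> x j"
  have c: "x j \<in> carrier A" "?s \<in> carrier A" "y \<in> carrier (opposite_algebra A)"
    using insert.prems assms(3) by (auto simp: smult_closed opposite_simps)
  have "scl d (mon (c j \<odot> x j \<oplus> ?s, y) 1 - (mon (c j \<odot> x j, y) 1 + mon (?s, y) 1)) \<in> E.rel"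
    by (intro tensor_relations.scale tensor_relations.add_left) (use c in \<open>simp_all add: smult_closed\<close>)
  moreover have "scl d (mon (c j \<odot> x j, y) 1 - mon (x j, y) (c j)) \<in> E.rel"
    by (intro tensor_relations.scale tensor_relations.smult_left) (use c in simp_all)
  moreover have "mon (?s, y) d - (\<Sum>j\<in>J. mon (x j, y) (d * c j)) \<in> E.rel"
    using insert by simp
  ultimately have "(scl d (mon (c j \<odot> x j \<oplus> ?s, y) 1 - (mon (c j \<odot> x j, y) 1 + mon (?s, y) 1))
      + scl d (mon (c j \<odot> x j, y) 1 - mon (x j, y) (c j)))
      + (mon (?s, y) d - (\<Sum>j\<in>J. mon (x j, y) (d * c j))) \<in> E.rel"
    by (intro tensor_relations.add)
  moreover have "(\<Oplus>j\<in>insert j J. c j \<odot> x j) = c j \<odot> x j \<oplus> ?s"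
    using insert by (intro finsum_insert) (auto simp: smult_closed)
  ultimately show ?case
    using insert.hyps by (simp add: scl_diff scl_add scl_mono algebra_simps)
qed

lemma rel_combination_right:
  assumes "finite J" "\<And>j. j \<in> J \<Longrightarrow> y j \<in> carrier A" "x \<in> carrier A"
  shows "mon (x, \<Oplus>j\<in>J. c j \<odot> y j) d - (\<Sum>j\<in>J. mon (x, y j) (d * c j)) \<in> E.rel"
  using assms(1,2)
proof induction
  case empty
  have "mon (x, 0 \<odot>\<^bsub>opposite_algebra A\<^esub> \<zero>) 1 - mon (x, \<zero>) 0 \<in> E.rel"
    by (rule tensor_relations.smult_right) (use assms(3) in \<open>simp_all add: opposite_simps\<close>)
  then have "scl d (mon (x, \<zero>) 1) \<in> E.rel"
    by (intro tensor_relations.scale) (simp add: smult_zero_right opposite_simps)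
  then show ?case by (simp add: scl_mono)
next
  case (insert j J)
  let ?s = "\<Oplus>j\<in>J. c j \<odot> y j"
  have c: "y j \<in> carrier A" "?s \<in> carrier A"
    using insert.prems assms(3) by (auto simp: smult_closed opposite_simps)
  have "scl d (mon (x, c j \<odot> y j \<oplus>\<^bsub>opposite_algebra A\<^esub> ?s) 1
      - (mon (x, c j \<odot> y j) 1 + mon (x, ?s) 1)) \<in> E.rel"
    by (intro tensor_relations.scale tensor_relations.add_right)
      (use c assms(3) in \<open>simp_all add: smult_closed opposite_simps\<close>)
  moreover have "scl d (mon (x, c j \<odot>\<^bsub>opposite_algebra A\<^esub> y j) 1 - mon (x, y j) (c j)) \<in> E.rel"
    by (intro tensor_relations.scale tensor_relations.smult_right)
      (use c assms(3) in \<open>simp_all add: opposite_simps\<close>)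
  moreover have "mon (x, ?s) d - (\<Sum>j\<in>J. mon (x, y j) (d * c j)) \<in> E.rel"
    using insert by simp
  ultimately have "(scl d (mon (x, c j \<odot> y j \<oplus>\<^bsub>opposite_algebra A\<^esub> ?s) 1
      - (mon (x, c j \<odot> y j) 1 + mon (x, ?s) 1))
      + scl d (mon (x, c j \<odot>\<^bsub>opposite_algebra A\<^esub> y j) 1 - mon (x, y j) (c j)))
      + (mon (x, ?s) d - (\<Sum>j\<in>J. mon (x, y j) (d * c j))) \<in> E.rel"
    by (intro tensor_relations.add)
  moreover have "(\<Oplus>j\<in>insert j J. c j \<odot> y j) = c j \<odot> y j \<oplus> ?s"
    using insert by (intro finsum_insert) (auto simp: smult_closed)
  ultimately show ?case
    using insert.hyps by (simp add: scl_diff scl_add scl_mono opposite_simps algebra_simps)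
qed

text \<open>The map x \<mapsto> \<Sum> x u i \<otimes> y i is a section of X \<mapsto> X \<odot> 1
  from the enveloping algebra to \<open>A\<close>: the condition \<open>unit\<close> makes it a
  right inverse, and the common matrix \<open>M\<close> makes it linear over the enveloping algebra.
  So \<open>A\<close> is a retract of a free module of rank one.\<close>

lemma separability_criterion:
  fixes u y :: "'i \<Rightarrow> 'a" and M :: "'a \<Rightarrow> 'i \<Rightarrow> 'i \<Rightarrow> 'f"
  assumes B: "finite B"
    and u: "\<And>i. i \<in> B \<Longrightarrow> u i \<in> carrier A" and y: "\<And>i. i \<in> B \<Longrightarrow> y i \<in> carrier A"
    and left: "\<And>s i. \<lbrakk>s \<in> carrier A; i \<in> B\<rbrakk> \<Longrightarrow> s \<otimes> u i = (\<Oplus>j\<in>B. M s j i \<odot> u j)"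
    and right: "\<And>s j. \<lbrakk>s \<in> carrier A; j \<in> B\<rbrakk> \<Longrightarrow> y j \<otimes> s = (\<Oplus>i\<in>B. M s j i \<odot> y i)"
    and unit: "(\<Oplus>i\<in>B. u i \<otimes> y i) = \<one>"
  shows "separable_algebra A"
proof -
  interpret T: assoc_algebra Env by (rule E.assoc_algebra_tensor)
  let ?m = "pmul (pair_opr A (opposite_algebra A))"
  \<comment> \<open>The coefficient c is a separate argument because basis elements of the
    enveloping algebra come with scalars; \<open>e_scale\<close> identifies \<open>e x c\<close>
    with the value at \<open>c \<odot> x\<close>.\<close>
  define e where "e x c = (\<Sum>i\<in>B. mon (x \<otimes> u i, y i) c)" for x and c :: 'f
  have keys_sum: "keys (sum g J) \<subseteq> C2"
    if "\<And>i. i \<in> J \<Longrightarrow> keys (g i) \<subseteq> C2" for g :: "'i \<Rightarrow> ('a \<times> 'a) \<Rightarrow>\<^sub>0 'f" and J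
    using that by (induction J rule: infinite_finite_induct) (simp_all add: keys_add_C2)
  have ke: "keys (e x c) \<subseteq> C2" if "x \<in> carrier A" for x c
    unfolding e_def by (rule keys_sum) (use that u y in \<open>simp add: m_closed\<close>)
  have e_add: "cls (e (x \<oplus> x') 1) = cls (e x 1) \<oplus>\<^bsub>Env\<^esub> cls (e x' 1)"
    if x: "x \<in> carrier A" "x' \<in> carrier A" for x x'
  proof -
    have "(\<Sum>i\<in>B. mon (x \<otimes> u i \<oplus> x' \<otimes> u i, y i) 1
        - (mon (x \<otimes> u i, y i) 1 + mon (x' \<otimes> u i, y i) 1)) \<in> E.rel"
      by (intro E.rel_sum tensor_relations.add_left)
        (use x u y in \<open>simp_all add: m_closed opposite_simps\<close>)
    also have "(\<Sum>i\<in>B. mon (x \<otimes> u i \<oplus> x' \<otimes> u i, y i) 1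
        - (mon (x \<otimes> u i, y i) 1 + mon (x' \<otimes> u i, y i) 1)) = e (x \<oplus> x') 1 - (e x 1 + e x' 1)"
      unfolding e_def using x u by (simp add: sum_subtractf sum.distrib l_distr)
    finally have "e (x \<oplus> x') 1 - (e x 1 + e x' 1) \<in> E.rel" .
    then have "cls (e (x \<oplus> x') 1) = cls (e x 1 + e x' 1)"
      by (intro cls_eqI keys_add_C2 ke) (use x in simp_all)
    then show ?thesis using Env_simps(1) ke x by simp
  qed
  have e_scale: "cls (e (c \<odot> x) 1) = cls (e x c)" if x: "x \<in> carrier A" for c x
  proof -
    have "(\<Sum>i\<in>B. mon (c \<odot> (x \<otimes> u i), y i) 1 - mon (x \<otimes> u i, y i) c) \<in> E.rel"
      by (intro E.rel_sum tensor_relations.smult_left)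
        (use x u y in \<open>simp_all add: m_closed opposite_simps\<close>)
    also have "(\<Sum>i\<in>B. mon (c \<odot> (x \<otimes> u i), y i) 1 - mon (x \<otimes> u i, y i) c)
        = e (c \<odot> x) 1 - e x c"
      unfolding e_def using x u by (simp add: sum_subtractf smult_mult_l)
    finally have "e (c \<odot> x) 1 - e x c \<in> E.rel" .
    then show ?thesis by (intro cls_eqI ke) (use x smult_closed in simp_all)
  qed
  \<comment> \<open>Both sides are congruent to \<open>?w\<close>: expanding y j b with
    \<open>M b\<close> in the right factor, or b u i with the same matrix in the left factor, gives
    the same double sum.\<close>
  have casimir: "cls (\<Sum>i\<in>B. mon (x \<otimes> u i, y i \<otimes> b) c) = cls (e (x \<otimes> b) c)"
    if x: "x \<in> carrier A" "b \<in> carrier A" for x b c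
  proof -
    let ?w = "\<Sum>j\<in>B. \<Sum>i\<in>B. mon (x \<otimes> u j, y i) (c * M b j i)"
    have "(\<Sum>j\<in>B. mon (x \<otimes> u j, \<Oplus>i\<in>B. M b j i \<odot> y i) c - (\<Sum>i\<in>B. mon (x \<otimes> u j, y i) (c * M b j i)))
        \<in> E.rel"
      by (intro E.rel_sum rel_combination_right B) (use x u y in \<open>simp_all add: m_closed\<close>)
    also have "(\<Sum>j\<in>B. mon (x \<otimes> u j, \<Oplus>i\<in>B. M b j i \<odot> y i) c - (\<Sum>i\<in>B. mon (x \<otimes> u j, y i) (c * M b j i)))
        = (\<Sum>j\<in>B. mon (x \<otimes> u j, y j \<otimes> b) c) - ?w"
      using right x by (simp add: sum_subtractf)
    finally have 1: "(\<Sum>j\<in>B. mon (x \<otimes> u j, y j \<otimes> b) c) - ?w \<in> E.rel" .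
    have xbu: "(x \<otimes> b) \<otimes> u i = (\<Oplus>j\<in>B. M b j i \<odot> (x \<otimes> u j))" if i: "i \<in> B" for i
    proof -
      have "(x \<otimes> b) \<otimes> u i = x \<otimes> (\<Oplus>j\<in>B. M b j i \<odot> u j)"
        unfolding m_assoc[OF x u[OF i]] left[OF x(2) i] by (rule refl)
      also have "\<dots> = (\<Oplus>j\<in>B. x \<otimes> (M b j i \<odot> u j))"
        by (rule finsum_mult_right[OF B _ x(1)]) (use u in \<open>simp add: smult_closed\<close>)
      also have "\<dots> = (\<Oplus>j\<in>B. M b j i \<odot> (x \<otimes> u j))"
        by (rule finsum_cong') (use x u in \<open>auto simp: smult_mult_r m_closed smult_closed\<close>)
      finally show ?thesis .
    qed
    have "(\<Sum>i\<in>B. mon (\<Oplus>j\<in>B. M b j i \<odot> (x \<otimes> u j), y i) c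
        - (\<Sum>j\<in>B. mon (x \<otimes> u j, y i) (c * M b j i))) \<in> E.rel"
      by (intro E.rel_sum rel_combination_left B) (use x u y in \<open>simp_all add: m_closed\<close>)
    also have "(\<Sum>i\<in>B. mon (\<Oplus>j\<in>B. M b j i \<odot> (x \<otimes> u j), y i) c
        - (\<Sum>j\<in>B. mon (x \<otimes> u j, y i) (c * M b j i))) = e (x \<otimes> b) c - ?w"
      unfolding e_def by (subst sum.swap) (simp add: sum_subtractf xbu)
    finally have 2: "e (x \<otimes> b) c - ?w \<in> E.rel" .
    have "(\<Sum>i\<in>B. mon (x \<otimes> u i, y i \<otimes> b) c) - e (x \<otimes> b) c \<in> E.rel"
      using E.rel_diff[OF 1 2] by simp
    then show ?thesis
      by (intro cls_eqI keys_sum ke) (use x u y in \<open>simp_all add: m_closed\<close>)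
  qed
  have e_act: "X \<otimes>\<^bsub>Env\<^esub> cls (e x 1) = cls (e (X \<odot>\<^bsub>two_sided_module A\<^esub> x) 1)"
    if X: "X \<in> carrier Env" and x: "x \<in> carrier A" for X x
  proof -
    obtain f where f: "keys f \<subseteq> C2" "X = cls f" using X by (rule Env_cases)
    have "cls (?m f (e x 1)) = cls (e (act f x) 1)"
      using f(1)
    proof (induction rule: mono_induct)
      case zero
      have "cls (e (0 \<odot> \<zero>) 1) = cls (e \<zero> 0)" by (rule e_scale) simp
      then show ?case by (simp add: pmul_zero act_zero smult_zero_right e_def)
    next
      case (mon p c)
      obtain a b where p: "p = (a, b)" "a \<in> carrier A" "b \<in> carrier A" using mon by auto
      have "?m (mon p c) (e x 1) = (\<Sum>i\<in>B. mon ((a \<otimes> x) \<otimes> u i, y i \<otimes> b) c)"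
        unfolding e_def pmul_sum_right
        using p x u by (intro sum.cong refl) (simp add: pmul_mono pair_opr_def opposite_simps m_assoc)
      moreover have "cls (e (act (mon p c) x) 1) = cls (e ((a \<otimes> x) \<otimes> b) c)"
        using p x by (simp add: act_mon e_scale m_closed)
      ultimately show ?case using casimir[of "a \<otimes> x" b c] p x by (simp add: m_closed)
    next
      case (add f g)
      have "cls (?m (f + g) (e x 1)) = cls (?m f (e x 1)) \<oplus>\<^bsub>Env\<^esub> cls (?m g (e x 1))"
        unfolding pmul_add_left using add.hyps ke x by (simp add: Env_simps keys_pmul_C2)
      then show ?case
        unfolding add.IH using add.hyps x by (simp add: act_add e_add act_closed)
    qed
    then show ?thesis using f ke x by (simp add: Env_simps smult_cls)
  qed
  \<comment> \<open>The free module of rank one needs an index from the element type of the module;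
    the unit of \<open>A\<close> serves as the only index.\<close>
  define s where "s x = (\<lambda>j. if j = \<one> then cls (e x 1) else \<zero>\<^bsub>Env\<^esub>)" for x
  define p where "p g = g \<one> \<odot>\<^bsub>two_sided_module A\<^esub> \<one>" for g :: "'a \<Rightarrow> (('a \<times> 'a) \<Rightarrow>\<^sub>0 'f) set"
  interpret L: left_module Env "two_sided_module A" by (rule left_module_Env)
  have "s \<in> left_module_hom Env (two_sided_module A) (free_module Env {\<one>})"
    unfolding left_module_hom_def
  proof (intro CollectI conjI ballI Pi_I)
    fix x assume "x \<in> carrier (two_sided_module A)"
    then have x: "x \<in> carrier A" by (simp add: two_sided_module_simps)
    have "finite {i. s x i \<noteq> \<zero>\<^bsub>Env\<^esub>}" by (rule finite_subset[of _ "{\<one>}"]) (auto simp: s_def)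
    then show "s x \<in> carrier (free_module Env {\<one>})"
      unfolding free_module_simps using Env_simps(3)[OF ke[OF x] ke[OF x]] by (auto simp: s_def)
    show "s (x \<oplus>\<^bsub>two_sided_module A\<^esub> x') = s x \<oplus>\<^bsub>free_module Env {\<one>}\<^esub> s x'"
      if "x' \<in> carrier (two_sided_module A)" for x'
      using that x by (auto simp: s_def free_module_simps two_sided_module_simps e_add fun_eq_iff)
    show "s (r \<odot>\<^bsub>two_sided_module A\<^esub> x) = r \<odot>\<^bsub>free_module Env {\<one>}\<^esub> s x"
      if "r \<in> carrier Env" for r
      using that x by (auto simp: s_def free_module_simps e_act fun_eq_iff)
  qed
  moreover have "p \<in> left_module_hom Env (free_module Env {\<one>}) (two_sided_module A)"
  proof -
    have "\<one> \<in> carrier (two_sided_module A)" by (simp add: two_sided_module_simps)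
    then show ?thesis
      unfolding left_module_hom_def p_def
      by (auto simp: free_module_simps L.lm_smult_closed L.lm_smult_l_distr L.lm_smult_assoc)
  qed
  moreover have "p (s x) = x" if "x \<in> carrier (two_sided_module A)" for x
  proof -
    have x: "x \<in> carrier A" using that by (simp add: two_sided_module_simps)
    have "act (\<Sum>i\<in>J. mon (x \<otimes> u i, y i) 1) \<one> = (\<Oplus>i\<in>J. x \<otimes> (u i \<otimes> y i))" if "J \<subseteq> B" for J
      using finite_subset[OF that B] that
    proof induction
      case (insert i J)
      have "act (mon (x \<otimes> u i, y i) 1 + (\<Sum>i\<in>J. mon (x \<otimes> u i, y i) 1)) \<one>
          = act (mon (x \<otimes> u i, y i) 1) \<one> \<oplus> act (\<Sum>i\<in>J. mon (x \<otimes> u i, y i) 1) \<one>"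
        by (intro act_add keys_sum) (use insert.prems x u y in \<open>auto simp: m_closed\<close>)
      moreover have "(\<Oplus>i\<in>insert i J. x \<otimes> (u i \<otimes> y i))
          = x \<otimes> (u i \<otimes> y i) \<oplus> (\<Oplus>i\<in>J. x \<otimes> (u i \<otimes> y i))"
        using insert x u y by (intro finsum_insert) (auto simp: m_closed)
      ultimately show ?case
        using insert x u y by (simp add: act_mon m_closed smult_one m_assoc)
    qed (simp add: act_zero)
    then have "act (e x 1) \<one> = x \<otimes> (\<Oplus>i\<in>B. u i \<otimes> y i)"
      unfolding e_def using finsum_mult_right[OF B _ x] u y by (simp add: m_closed)
    then show ?thesis
      using x ke by (simp add: p_def s_def smult_cls unit)
  qed
  ultimately have "projective_module Env (two_sided_module A)"
    unfolding projective_module_def using left_module_Env by blast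
  then show ?thesis unfolding separable_algebra_def using assoc_algebra_axioms by blast
qed

end

section \<open>Separability idempotents of etale algebras\<close>

text \<open>A nonzero combination d of least degree divides every combination, since a remainder
  modulo d is again a combination, of smaller degree. So d is a common divisor, hence a
  unit.\<close>

lemma coprime_poly_bezout:
  fixes p q :: "'f::field poly"
  assumes "coprime p q"
  obtains u v where "u * p + v * q = 1"
proof -
  define I where "I = {u * p + v * q |u v. True}"
  have I_comb: "a * d + b * e \<in> I" if de: "d \<in> I" "e \<in> I" for a b d e
  proof -
    obtain u v u' v' where "d = u * p + v * q" "e = u' * p + v' * q"
      using de unfolding I_def by blast
    then have "a * d + b * e = (a * u + b * u') * p + (a * v + b * v') * q"
      by (simp add: algebra_simps)
    then show ?thesis unfolding I_def by blast
  qed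
  have pI: "p \<in> I" unfolding I_def by (rule CollectI, rule exI[of _ 1], rule exI[of _ 0]) simp
  have qI: "q \<in> I" unfolding I_def by (rule CollectI, rule exI[of _ 0], rule exI[of _ 1]) simp
  have "p \<noteq> 0 \<or> q \<noteq> 0" using assms by auto
  then have "\<exists>d. d \<in> I \<and> d \<noteq> 0" using pI qI by blast
  then obtain d0 where "d0 \<in> I \<and> d0 \<noteq> 0" ..
  from ex_has_least_nat[of "\<lambda>d. d \<in> I \<and> d \<noteq> 0" d0 degree, OF this]
  obtain d where d: "d \<in> I" "d \<noteq> 0" "\<And>e. e \<in> I \<Longrightarrow> e \<noteq> 0 \<Longrightarrow> degree d \<le> degree e" by blast
  have dvd: "d dvd r" if "r \<in> I" for r
  proof (rule ccontr)
    assume "\<not> d dvd r"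
    then have ne: "r mod d \<noteq> 0" by (simp add: mod_eq_0_iff_dvd)
    have "r mod d = 1 * r + (- (r div d)) * d" by (simp add: minus_div_mult_eq_mod[symmetric])
    then have "r mod d \<in> I" using I_comb[OF that d(1)] by metis
    then have "degree d \<le> degree (r mod d)" using d(3) ne by blast
    then show False using degree_mod_less[OF d(2), of r] ne by simp
  qed
  have "is_unit d" using assms dvd[OF pI] dvd[OF qI] by (rule coprime_common_divisor)
  then obtain e where e: "1 = d * e" by (elim dvdE)
  obtain u v where "d = u * p + v * q" using d(1) unfolding I_def by blast
  then have "(e * u) * p + (e * v) * q = 1" using e by (simp add: algebra_simps)
  then show thesis by (rule that)
qed

text \<open>Multiplying a separable polynomial by X keeps it separable as long as 0 is not yet a
  root, because then X and \<open>P\<close> are coprime.\<close>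

lemma bezout_pCons_zero:
  fixes P :: "'f::field poly"
  assumes "coprime P (pderiv P)" "coeff P 0 \<noteq> 0"
  obtains u v where "u * pCons 0 P + v * pderiv (pCons 0 P) = 1"
proof -
  obtain u v where uv: "u * P + v * pderiv P = 1" using coprime_poly_bezout[OF assms(1)] .
  obtain a0 r where P: "P = pCons a0 r" by (cases P)
  let ?X = "[:0, 1:] :: 'f poly"
  \<comment> \<open>From P = a0 + X r, dividing by a0 gives the Bezout identity a X + b P =
    1.\<close>
  define b a where "b = [:1 / a0:]" and "a = - b * r"
  have a0: "a0 \<noteq> 0" using assms(2) P by simp
  have "b * [:a0:] = 1" unfolding b_def using a0 by simp
  moreover have "P = [:a0:] + ?X * r" unfolding P by simp
  ultimately have ab: "a * ?X + b * P = 1" unfolding a_def by (simp add: algebra_simps)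
  have X: "pCons 0 P = ?X * P" "pderiv (pCons 0 P) = P + ?X * pderiv P"
    by (simp_all add: pderiv_pCons)
  define w where "w = u * P + v * pderiv P"
  \<comment> \<open>In (a X + b P)^2 w, multiples of X P are left as they are. The terms X^2 P' and
    P^2 are rewritten with X P' = (X P)' - P and P = (X P)' - X P' respectively; collecting terms
    gives the two coefficients.\<close>
  have "(a * a * ?X * u + 2 * a * b * w - a * a * v - b * b * pderiv P * w) * pCons 0 P
      + (a * a * v * ?X + b * b * P * w) * pderiv (pCons 0 P)
      = (a * ?X + b * P) * (a * ?X + b * P) * w"
    unfolding X(2) unfolding X(1) w_def by (simp only: algebra_simps mult_2)
  also have "\<dots> = 1" using ab uv by (simp add: w_def)
  finally show thesis by (rule that)
qed

section \<open>Evaluation of polynomials at an element of an algebra\<close>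

context assoc_algebra
begin

lemma poly_at_ge:
  assumes "x \<in> carrier A" "degree p \<le> N"
  shows "poly_at A p x = (\<Oplus>i\<in>{..N}. coeff p i \<odot> x [^] i)"
  unfolding poly_at_def
  by (rule add.finprod_mono_neutral_cong_left)
    (use assms in \<open>auto simp: coeff_eq_0 smult_zero_left smult_closed\<close>)

lemma poly_at_zero: "poly_at A 0 x = \<zero>"
  by (simp add: poly_at_def smult_zero_left one_closed)

lemma poly_at_closed: "x \<in> carrier A \<Longrightarrow> poly_at A p x \<in> carrier A"
  unfolding poly_at_def by (rule finsum_closed) (auto simp: smult_closed)

lemma poly_at_pCons:
  assumes "x \<in> carrier A"
  shows "poly_at A (pCons a p) x = a \<odot> \<one> \<oplus> x \<otimes> poly_at A p x"
proof -
  have pow: "c \<odot> x [^] (i::nat) \<in> carrier A" for c i using assms by (simp add: smult_closed)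
  have comm: "x [^] i \<otimes> x = x \<otimes> x [^] i" for i :: nat
    using nat_pow_Suc2[OF assms, of i] by simp
  have "poly_at A (pCons a p) x = (\<Oplus>i\<in>{..Suc (degree p)}. coeff (pCons a p) i \<odot> x [^] i)"
    by (rule poly_at_ge[OF assms degree_pCons_le])
  also have "\<dots> = (\<Oplus>i\<in>{..degree p}. coeff (pCons a p) (Suc i) \<odot> x [^] Suc i)
      \<oplus> coeff (pCons a p) 0 \<odot> x [^] (0::nat)"
    by (rule finsum_Suc2) (use pow in auto)
  also have "(\<Oplus>i\<in>{..degree p}. coeff (pCons a p) (Suc i) \<odot> x [^] Suc i)
      = (\<Oplus>i\<in>{..degree p}. x \<otimes> (coeff p i \<odot> x [^] i))"
    by (rule finsum_cong')
      (use assms pow comm in \<open>auto simp: smult_mult_r smult_closed m_closed\<close>)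
  also have "\<dots> = x \<otimes> poly_at A p x"
    unfolding poly_at_def by (rule finsum_mult_right[symmetric]) (use assms pow in auto)
  finally show ?thesis
    using assms by (simp add: a_comm poly_at_closed smult_closed one_closed)
qed

lemma poly_at_add:
  assumes "x \<in> carrier A"
  shows "poly_at A (p + q) x = poly_at A p x \<oplus> poly_at A q x"
proof (induction p q rule: poly_induct2)
  case (pCons a p b q)
  have c: "poly_at A p x \<in> carrier A" "poly_at A q x \<in> carrier A" using assms poly_at_closed by auto
  then have d: "x \<otimes> poly_at A p x \<in> carrier A" "x \<otimes> poly_at A q x \<in> carrier A"
    "a \<odot> \<one> \<in> carrier A" "b \<odot> \<one> \<in> carrier A"
    using assms by (simp_all add: smult_closed)
  show ?case
    using c d assms pCons
    by (simp add: poly_at_pCons smult_l_distr r_distr a_ac)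
qed (simp add: poly_at_zero)

lemma poly_at_smult:
  assumes "x \<in> carrier A"
  shows "poly_at A (Polynomial.smult c p) x = c \<odot> poly_at A p x"
proof (induction p)
  case (pCons a p)
  have "poly_at A p x \<in> carrier A" using assms poly_at_closed by auto
  then show ?case
    using assms pCons
    by (simp add: poly_at_pCons smult_assoc smult_r_distr smult_mult_r smult_closed one_closed)
qed (simp add: poly_at_zero smult_zero_right)

lemma poly_at_mult:
  assumes "x \<in> carrier A"
  shows "poly_at A (p * q) x = poly_at A p x \<otimes> poly_at A q x"
proof (induction p)
  case (pCons a p)
  have c: "poly_at A p x \<in> carrier A" "poly_at A q x \<in> carrier A" using assms poly_at_closed by auto
  then have "a \<odot> poly_at A q x = (a \<odot> \<one>) \<otimes> poly_at A q x"
    by (simp add: smult_mult_l)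
  then show ?case
    using c assms pCons
    by (simp add: poly_at_add poly_at_smult poly_at_pCons smult_zero_left l_distr m_assoc smult_closed)
qed (use assms in \<open>simp add: poly_at_zero poly_at_closed\<close>)

lemma poly_at_one: "x \<in> carrier A \<Longrightarrow> poly_at A 1 x = \<one>"
  by (simp add: one_pCons poly_at_pCons poly_at_zero smult_one)

text \<open>The homomorphism laws are listed separately since h will be one component of an
  isomorphism onto a product.\<close>

lemma poly_at_hom:
  assumes "assoc_algebra B" "x \<in> carrier A"
    and "\<And>y. y \<in> carrier A \<Longrightarrow> h y \<in> carrier B"
    and "\<And>y z. \<lbrakk>y \<in> carrier A; z \<in> carrier A\<rbrakk> \<Longrightarrow> h (y \<oplus> z) = h y \<oplus>\<^bsub>B\<^esub> h z"
    and "\<And>y z. \<lbrakk>y \<in> carrier A; z \<in> carrier A\<rbrakk> \<Longrightarrow> h (y \<otimes> z) = h y \<otimes>\<^bsub>B\<^esub> h z"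
    and "\<And>c y. y \<in> carrier A \<Longrightarrow> h (c \<odot> y) = c \<odot>\<^bsub>B\<^esub> h y"
    and "h \<one> = \<one>\<^bsub>B\<^esub>"
  shows "h (poly_at A p x) = poly_at B p (h x)"
proof -
  interpret B: assoc_algebra B by (rule assms(1))
  show ?thesis
  proof (induction p)
    case 0
    have "h (0 \<odot> \<one>) = 0 \<odot>\<^bsub>B\<^esub> h \<one>" by (rule assms(6)) simp
    then show ?case by (simp add: poly_at_zero B.poly_at_zero smult_zero_left B.smult_zero_left assms(3))
  next
    case (pCons a p)
    then show ?case
      using assms(2-) poly_at_closed[OF assms(2)]
      by (simp add: poly_at_pCons B.poly_at_pCons smult_closed)
  qed
qed

end

text \<open>
  The values are polynomials because these form a single vector space type that contains a copy
  of every finite-dimensional space.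
\<close>

definition linear_map :: "('f::field, 'a) module \<Rightarrow> ('a \<Rightarrow> 'f poly) \<Rightarrow> bool" where
  "linear_map A g \<longleftrightarrow> (\<forall>x\<in>carrier A. \<forall>y\<in>carrier A. g (x \<oplus>\<^bsub>A\<^esub> y) = g x + g y) \<and>
     (\<forall>c. \<forall>x\<in>carrier A. g (c \<odot>\<^bsub>A\<^esub> x) = Polynomial.smult c (g x))"

definition bilinear_map :: "('f::field, 'a) module \<Rightarrow> ('a \<Rightarrow> 'a \<Rightarrow> 'f poly) \<Rightarrow> bool" where
  "bilinear_map A \<beta> \<longleftrightarrow> (\<forall>x\<in>carrier A. linear_map A (\<beta> x) \<and> linear_map A (\<lambda>y. \<beta> y x))"

lemma linear_mapD:
  assumes "linear_map A g" "x \<in> carrier A"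
  shows "y \<in> carrier A \<Longrightarrow> g (x \<oplus>\<^bsub>A\<^esub> y) = g x + g y" "g (c \<odot>\<^bsub>A\<^esub> x) = Polynomial.smult c (g x)"
  using assms by (auto simp: linear_map_def)

lemma sum_list_product:
  "sum_list (map F (List.product xs ys))
    = sum_list (map (\<lambda>x. sum_list (map (\<lambda>y. F (x, y)) ys)) xs)"
  by (induction xs) (auto simp: o_def)

lemma sum_list_swap:
  fixes F :: "'x \<Rightarrow> 'y \<Rightarrow> 'z::ab_group_add"
  shows "sum_list (map (\<lambda>x. sum_list (map (F x) ys)) xs)
    = sum_list (map (\<lambda>y. sum_list (map (\<lambda>x. F x y) xs)) ys)"
  by (induction xs) (simp_all add: sum_list_addf)

section \<open>Separating tensors in commutative algebras\<close>

locale comm_assoc_algebra = assoc_algebra A for A :: "('f::field, 'a) module" (structure) +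
  assumes mult_comm: "\<lbrakk>x \<in> carrier A; y \<in> carrier A\<rbrakk> \<Longrightarrow> x \<otimes> y = y \<otimes> x"
begin

lemma mult_left_comm:
  assumes "x \<in> carrier A" "y \<in> carrier A" "z \<in> carrier A"
  shows "x \<otimes> (y \<otimes> z) = y \<otimes> (x \<otimes> z)"
  using assms mult_comm[of x y] by (simp add: m_assoc[symmetric])

text \<open>The list stands for a tensor of product 1 that is annihilated by z \<otimes> 1 - 1
  \<otimes> z for all z in \<open>X\<close>, with equality of tensors tested by linear and bilinear
  maps. For \<open>X\<close> the whole carrier this is a separability idempotent.\<close>

definition separates :: "'a set \<Rightarrow> ('a \<times> 'a) list \<Rightarrow> bool" where
  "separates X Q \<longleftrightarrow> set Q \<subseteq> carrier A \<times> carrier A \<and>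
     (\<forall>g. linear_map A g \<longrightarrow> (\<Sum>(k, l)\<leftarrow>Q. g (k \<otimes> l)) = g \<one>) \<and>
     (\<forall>\<beta>. bilinear_map A \<beta> \<longrightarrow> (\<forall>z\<in>X.
        (\<Sum>(k, l)\<leftarrow>Q. \<beta> (z \<otimes> k) l) = (\<Sum>(k, l)\<leftarrow>Q. \<beta> k (z \<otimes> l))))"

lemma linear_map_mult:
  assumes "linear_map A g" "w \<in> carrier A"
  shows "linear_map A (\<lambda>x. g (w \<otimes> x))"
  using assms by (auto simp: linear_map_def r_distr smult_mult_r m_closed)

lemma bilinear_map_mult:
  assumes "bilinear_map A \<beta>" "w \<in> carrier A" "w' \<in> carrier A"
  shows "bilinear_map A (\<lambda>x y. \<beta> (w \<otimes> x) (w' \<otimes> y))"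
  using assms
  by (auto simp: bilinear_map_def m_closed intro!: linear_map_mult[of "\<beta> _"] linear_map_mult[of "\<lambda>y. \<beta> y _"])

lemma linear_map_zero: "linear_map A g \<Longrightarrow> g \<zero> = 0"
  using linear_mapD(2)[of A g \<zero> 0] by (simp add: smult_zero_left)

text \<open>
  The pairs represent \<open>(P(X) - P(Y)) / (X - Y)\<close> at \<open>X = x \<otimes> 1\<close>, \<open>Y = 1 \<otimes> x\<close>, built by the
  recursion \<open>X R(X) - Y R(Y) = (X - Y) R(X) + Y (R(X) - R(Y))\<close>.
\<close>

lemma difference_quotient:
  assumes x: "x \<in> carrier A"
  shows "\<exists>Q. set Q \<subseteq> carrier A \<times> carrier A \<and>
    (\<forall>g. linear_map A g \<longrightarrow> (\<Sum>(k, l)\<leftarrow>Q. g (k \<otimes> l)) = g (poly_at A (pderiv P) x)) \<and>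
    (\<forall>\<beta>. bilinear_map A \<beta> \<longrightarrow> (\<Sum>(k, l)\<leftarrow>Q. \<beta> (x \<otimes> k) l) - (\<Sum>(k, l)\<leftarrow>Q. \<beta> k (x \<otimes> l))
      = \<beta> (poly_at A P x) \<one> - \<beta> \<one> (poly_at A P x))"
proof (induction P)
  case 0
  have "\<beta> \<zero> \<one> = \<beta> \<one> \<zero>" if "bilinear_map A \<beta>" for \<beta>
    using that one_closed linear_map_zero[of "\<beta> \<one>"] linear_map_zero[of "\<lambda>y. \<beta> y \<one>"]
    unfolding bilinear_map_def by simp
  then show ?case
    by (intro exI[of _ "[]"]) (auto simp: poly_at_zero linear_map_zero)
next
  case (pCons a R)
  then obtain Q where Q: "set Q \<subseteq> carrier A \<times> carrier A"
    "\<And>g. linear_map A g \<Longrightarrow> (\<Sum>(k, l)\<leftarrow>Q. g (k \<otimes> l)) = g (poly_at A (pderiv R) x)"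
    "\<And>\<beta>. bilinear_map A \<beta> \<Longrightarrow> (\<Sum>(k, l)\<leftarrow>Q. \<beta> (x \<otimes> k) l) - (\<Sum>(k, l)\<leftarrow>Q. \<beta> k (x \<otimes> l))
      = \<beta> (poly_at A R x) \<one> - \<beta> \<one> (poly_at A R x)"
    by blast
  let ?r = "poly_at A R x" and ?r' = "poly_at A (pderiv R) x"
  \<comment> \<open>The new pair is R(X), and the mapped list is the quotient for \<open>R\<close>
    multiplied by Y; the constant a drops out of the difference. On the diagonal X = Y this gives R
    + X R', the derivative.\<close>
  let ?Q = "(?r, \<one>) # map (\<lambda>(k, l). (k, x \<otimes> l)) Q"
  have r: "?r \<in> carrier A" "?r' \<in> carrier A" using poly_at_closed[OF x] by auto
  have Qc: "k \<in> carrier A" "l \<in> carrier A" if "(k, l) \<in> set Q" for k l using Q(1) that by auto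
  have sub: "set ?Q \<subseteq> carrier A \<times> carrier A"
    using Q(1) r x by (auto simp: m_closed)
  have "(\<Sum>(k, l)\<leftarrow>?Q. g (k \<otimes> l)) = g (poly_at A (pderiv (pCons a R)) x)"
    if g: "linear_map A g" for g
  proof -
    have "(\<Sum>(k, l)\<leftarrow>?Q. g (k \<otimes> l)) = g ?r + (\<Sum>(k, l)\<leftarrow>Q. g (k \<otimes> (x \<otimes> l)))"
      using r by (simp add: o_def case_prod_unfold)
    also have "(\<Sum>(k, l)\<leftarrow>Q. g (k \<otimes> (x \<otimes> l))) = (\<Sum>(k, l)\<leftarrow>Q. g (x \<otimes> (k \<otimes> l)))"
    proof (intro arg_cong[where f = sum_list] map_cong refl, clarify)
      fix k l assume "(k, l) \<in> set Q"
      then have kl: "k \<in> carrier A" "l \<in> carrier A" using Qc by auto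
      then show "g (k \<otimes> (x \<otimes> l)) = g (x \<otimes> (k \<otimes> l))"
        using x mult_comm[of k x] by (simp add: m_assoc[symmetric])
    qed
    also have "\<dots> = g (x \<otimes> ?r')" by (rule Q(2)[OF linear_map_mult[OF g x]])
    also have "g ?r + \<dots> = g (poly_at A (pderiv (pCons a R)) x)"
      using g r x linear_mapD(1)[OF g r(1), of "x \<otimes> ?r'"]
      by (simp add: pderiv_pCons poly_at_add poly_at_pCons smult_zero_left m_closed)
    finally show ?thesis .
  qed
  moreover have "(\<Sum>(k, l)\<leftarrow>?Q. \<beta> (x \<otimes> k) l) - (\<Sum>(k, l)\<leftarrow>?Q. \<beta> k (x \<otimes> l))
      = \<beta> (poly_at A (pCons a R) x) \<one> - \<beta> \<one> (poly_at A (pCons a R) x)"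
    if b: "bilinear_map A \<beta>" for \<beta>
  proof -
    have b': "bilinear_map A (\<lambda>y z. \<beta> y (x \<otimes> z))"
      using b x linear_map_mult unfolding bilinear_map_def by (auto simp: m_closed)
    have l1: "linear_map A (\<beta> \<one>)" and l2: "linear_map A (\<lambda>y. \<beta> y \<one>)"
      using b one_closed unfolding bilinear_map_def by auto
    have "(\<Sum>(k, l)\<leftarrow>?Q. \<beta> (x \<otimes> k) l) - (\<Sum>(k, l)\<leftarrow>?Q. \<beta> k (x \<otimes> l))
        = \<beta> (x \<otimes> ?r) \<one> - \<beta> ?r (x \<otimes> \<one>)
          + ((\<Sum>(k, l)\<leftarrow>Q. \<beta> (x \<otimes> k) (x \<otimes> l)) - (\<Sum>(k, l)\<leftarrow>Q. \<beta> k (x \<otimes> (x \<otimes> l))))"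
      by (simp add: o_def case_prod_unfold)
    also have "\<dots> = \<beta> (x \<otimes> ?r) \<one> - \<beta> \<one> (x \<otimes> ?r)"
      using Q(3)[OF b'] by simp
    also have "\<dots> = \<beta> (poly_at A (pCons a R) x) \<one> - \<beta> \<one> (poly_at A (pCons a R) x)"
      using x r
      by (simp add: poly_at_pCons linear_mapD[OF l1] linear_mapD[OF l2] smult_closed m_closed)
    finally show ?thesis .
  qed
  ultimately show ?case using sub by blast
qed

text \<open>The difference quotient of \<open>P\<close> times x \<otimes> 1 - 1 \<otimes> x is P(x)
  \<otimes> 1 - 1 \<otimes> P(x) = 0, and its product is P'(x). Multiplying by v(x), which inverts
  P'(x) because P(x) = 0, normalizes the product to 1.\<close>

lemma separates_single:
  assumes x: "x \<in> carrier A" and P: "poly_at A P x = \<zero>" "u * P + v * pderiv P = 1"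
  shows "\<exists>Q. separates {x} Q"
proof -
  obtain Q where Q: "set Q \<subseteq> carrier A \<times> carrier A"
    "\<And>g. linear_map A g \<Longrightarrow> (\<Sum>(k, l)\<leftarrow>Q. g (k \<otimes> l)) = g (poly_at A (pderiv P) x)"
    "\<And>\<beta>. bilinear_map A \<beta> \<Longrightarrow> (\<Sum>(k, l)\<leftarrow>Q. \<beta> (x \<otimes> k) l) - (\<Sum>(k, l)\<leftarrow>Q. \<beta> k (x \<otimes> l))
      = \<beta> (poly_at A P x) \<one> - \<beta> \<one> (poly_at A P x)"
    using difference_quotient[OF x, of P] by blast
  let ?w = "poly_at A v x"
  have w: "?w \<in> carrier A" "poly_at A u x \<in> carrier A" "poly_at A (pderiv P) x \<in> carrier A"
    using poly_at_closed[OF x] by auto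
  have "\<one> = poly_at A (u * P + v * pderiv P) x" using poly_at_one[OF x] P(2) by simp
  also have "\<dots> = ?w \<otimes> poly_at A (pderiv P) x"
    using w x P(1) by (simp add: poly_at_add poly_at_mult)
  finally have unit: "?w \<otimes> poly_at A (pderiv P) x = \<one>" by simp
  have Qc: "k \<in> carrier A" "l \<in> carrier A" if "(k, l) \<in> set Q" for k l using Q(1) that by auto
  let ?Q = "map (\<lambda>(k, l). (?w \<otimes> k, l)) Q"
  have "separates {x} ?Q"
    unfolding separates_def
  proof (intro conjI allI impI ballI)
    show "set ?Q \<subseteq> carrier A \<times> carrier A" using Q(1) w by (auto simp: m_closed)
    show "(\<Sum>(k, l)\<leftarrow>?Q. g (k \<otimes> l)) = g \<one>" if g: "linear_map A g" for g
    proof -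
      have "(\<Sum>(k, l)\<leftarrow>?Q. g (k \<otimes> l)) = (\<Sum>(k, l)\<leftarrow>Q. g (?w \<otimes> (k \<otimes> l)))"
        unfolding map_map o_def case_prod_unfold fst_conv snd_conv
        by (intro arg_cong[where f = sum_list] map_cong refl) (use w Qc in \<open>auto simp: m_assoc\<close>)
      then show ?thesis using Q(2)[OF linear_map_mult[OF g w(1)]] unit by simp
    qed
    show "(\<Sum>(k, l)\<leftarrow>?Q. \<beta> (z \<otimes> k) l) = (\<Sum>(k, l)\<leftarrow>?Q. \<beta> k (z \<otimes> l))"
      if b: "bilinear_map A \<beta>" and z: "z \<in> {x}" for \<beta> z
    proof -
      have b': "bilinear_map A (\<lambda>y z. \<beta> (?w \<otimes> y) z)"
        using b w linear_map_mult[of "\<lambda>y. \<beta> y _" ?w] unfolding bilinear_map_def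
        by (auto simp: m_closed)
      have "(\<Sum>(k, l)\<leftarrow>?Q. \<beta> (z \<otimes> k) l) = (\<Sum>(k, l)\<leftarrow>Q. \<beta> (?w \<otimes> (x \<otimes> k)) l)"
        unfolding map_map o_def case_prod_unfold fst_conv snd_conv
      proof (intro arg_cong[where f = sum_list] map_cong refl)
        fix kl assume "kl \<in> set Q"
        then have "fst kl \<in> carrier A" using Qc by (metis prod.collapse)
        then have "z \<otimes> (?w \<otimes> fst kl) = ?w \<otimes> (x \<otimes> fst kl)"
          using z x w mult_comm[of x ?w] by (simp add: m_assoc[symmetric])
        then show "\<beta> (z \<otimes> (?w \<otimes> fst kl)) (snd kl) = \<beta> (?w \<otimes> (x \<otimes> fst kl)) (snd kl)" by simp
      qed
      moreover have "(\<Sum>(k, l)\<leftarrow>?Q. \<beta> k (z \<otimes> l)) = (\<Sum>(k, l)\<leftarrow>Q. \<beta> (?w \<otimes> k) (x \<otimes> l))"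
        using z by (simp add: o_def case_prod_unfold)
      moreover have "\<beta> (?w \<otimes> poly_at A P x) \<one> = 0" "\<beta> (?w \<otimes> \<one>) (poly_at A P x) = 0"
        using P(1) w b one_closed linear_map_zero[of "\<beta> ?w"] linear_map_zero[of "\<lambda>y. \<beta> y \<one>"]
        unfolding bilinear_map_def by simp_all
      ultimately show ?thesis using Q(3)[OF b'] by simp
    qed
  qed
  then show ?thesis by blast
qed

text \<open>The product of the two tensors in the tensor square has product 1 and is annihilated by
  whatever annihilates one of the factors; commutativity allows the necessary regrouping.\<close>

lemma separates_union:
  assumes "separates X Q" "separates Y Q'" "X \<subseteq> carrier A" "Y \<subseteq> carrier A"
  shows "\<exists>Q. separates (X \<union> Y) Q"
proof -
  let ?f = "\<lambda>((k, l), (k', l')). (k \<otimes> k', l \<otimes> l')"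
  let ?Q = "map ?f (List.product Q Q')"
  have Qc: "k \<in> carrier A" "l \<in> carrier A" if "(k, l) \<in> set Q" for k l
    using assms(1) that unfolding separates_def by auto
  have Qc': "k \<in> carrier A" "l \<in> carrier A" if "(k, l) \<in> set Q'" for k l
    using assms(2) that unfolding separates_def by auto
  have sum_Q: "(\<Sum>(k, l)\<leftarrow>?Q. F k l) = (\<Sum>(k, l)\<leftarrow>Q. \<Sum>(k', l')\<leftarrow>Q'. F (k \<otimes> k') (l \<otimes> l'))"
    for F :: "'a \<Rightarrow> 'a \<Rightarrow> 'f poly"
    unfolding map_map sum_list_product by (simp add: o_def case_prod_unfold)
  have cong: "(\<Sum>(k, l)\<leftarrow>Q. \<Sum>(k', l')\<leftarrow>Q'. F k l k' l') = (\<Sum>(k, l)\<leftarrow>Q. \<Sum>(k', l')\<leftarrow>Q'. G k l k' l')"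
    if "\<And>k l k' l'. \<lbrakk>k \<in> carrier A; l \<in> carrier A; k' \<in> carrier A; l' \<in> carrier A\<rbrakk>
      \<Longrightarrow> F k l k' l' = G k l k' l'" for F G :: "'a \<Rightarrow> 'a \<Rightarrow> 'a \<Rightarrow> 'a \<Rightarrow> 'f poly"
    by (intro arg_cong[where f = sum_list] map_cong refl, clarify,
        intro arg_cong[where f = sum_list] map_cong refl, clarify, rule that) (use Qc Qc' in auto)
  have swap: "(\<Sum>(k, l)\<leftarrow>Q. \<Sum>(k', l')\<leftarrow>Q'. F k l k' l') = (\<Sum>(k', l')\<leftarrow>Q'. \<Sum>(k, l)\<leftarrow>Q. F k l k' l')"
    for F :: "'a \<Rightarrow> 'a \<Rightarrow> 'a \<Rightarrow> 'a \<Rightarrow> 'f poly"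
    unfolding case_prod_unfold by (rule sum_list_swap)
  have "separates (X \<union> Y) ?Q"
    unfolding separates_def
  proof (intro conjI allI impI ballI)
    show "set ?Q \<subseteq> carrier A \<times> carrier A"
      using Qc Qc' by (auto simp: m_closed)
    show "(\<Sum>(k, l)\<leftarrow>?Q. g (k \<otimes> l)) = g \<one>" if g: "linear_map A g" for g
    proof -
      have "(\<Sum>(k, l)\<leftarrow>?Q. g (k \<otimes> l)) = (\<Sum>(k, l)\<leftarrow>Q. \<Sum>(k', l')\<leftarrow>Q'. g ((k \<otimes> l) \<otimes> (k' \<otimes> l')))"
        unfolding sum_Q
      proof (rule cong)
        fix k l k' l'
        assume c: "k \<in> carrier A" "l \<in> carrier A" "k' \<in> carrier A" "l' \<in> carrier A"
        then have "k' \<otimes> (l \<otimes> l') = l \<otimes> (k' \<otimes> l')"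
          using mult_comm[of k' l] by (simp add: m_assoc[symmetric])
        then have "(k \<otimes> k') \<otimes> (l \<otimes> l') = (k \<otimes> l) \<otimes> (k' \<otimes> l')"
          using c by (simp add: m_assoc m_closed)
        then show "g ((k \<otimes> k') \<otimes> (l \<otimes> l')) = g ((k \<otimes> l) \<otimes> (k' \<otimes> l'))" by simp
      qed
      also have "\<dots> = (\<Sum>(k, l)\<leftarrow>Q. g (k \<otimes> l))"
      proof (intro arg_cong[where f = sum_list] map_cong refl, clarify)
        fix k l assume "(k, l) \<in> set Q"
        then have c: "k \<otimes> l \<in> carrier A" using Qc by (simp add: m_closed)
        have "(\<Sum>(k', l')\<leftarrow>Q'. g ((k \<otimes> l) \<otimes> (k' \<otimes> l'))) = g ((k \<otimes> l) \<otimes> \<one>)"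
          using assms(2) linear_map_mult[OF g c] unfolding separates_def by blast
        then show "(\<Sum>(k', l')\<leftarrow>Q'. g ((k \<otimes> l) \<otimes> (k' \<otimes> l'))) = g (k \<otimes> l)" using c by simp
      qed
      also have "\<dots> = g \<one>" using assms(1) g unfolding separates_def by blast
      finally show ?thesis .
    qed
    show "(\<Sum>(k, l)\<leftarrow>?Q. \<beta> (z \<otimes> k) l) = (\<Sum>(k, l)\<leftarrow>?Q. \<beta> k (z \<otimes> l))"
      if b: "bilinear_map A \<beta>" and z: "z \<in> X \<union> Y" for \<beta> z
    proof -
      have zc: "z \<in> carrier A" using z assms(3,4) by blast
      note b' = bilinear_map_mult[OF b]
      show ?thesis
      \<comment> \<open>An element of \<open>Y\<close> is moved across in the inner sum over
        \<open>Q'\<close>; for an element of \<open>X\<close> the order of summation is exchanged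
        first.\<close>
      proof (cases "z \<in> Y")
        case True
        have "(\<Sum>(k, l)\<leftarrow>?Q. \<beta> (z \<otimes> k) l)
            = (\<Sum>(k, l)\<leftarrow>Q. \<Sum>(k', l')\<leftarrow>Q'. \<beta> (k \<otimes> (z \<otimes> k')) (l \<otimes> l'))"
          unfolding sum_Q
          by (rule cong) (use zc in \<open>simp add: m_assoc mult_comm mult_left_comm m_closed\<close>)
        also have "\<dots> = (\<Sum>(k, l)\<leftarrow>Q. \<Sum>(k', l')\<leftarrow>Q'. \<beta> (k \<otimes> k') (l \<otimes> (z \<otimes> l')))"
        proof (intro arg_cong[where f = sum_list] map_cong refl, clarify)
          fix k l assume "(k, l) \<in> set Q"
          then have "k \<in> carrier A" "l \<in> carrier A" using Qc by auto
          from b'[OF this] show "(\<Sum>(k', l')\<leftarrow>Q'. \<beta> (k \<otimes> (z \<otimes> k')) (l \<otimes> l'))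
              = (\<Sum>(k', l')\<leftarrow>Q'. \<beta> (k \<otimes> k') (l \<otimes> (z \<otimes> l')))"
            using assms(2) True unfolding separates_def by blast
        qed
        also have "\<dots> = (\<Sum>(k, l)\<leftarrow>?Q. \<beta> k (z \<otimes> l))"
          unfolding sum_Q
          by (rule cong) (use zc in \<open>simp add: m_assoc mult_comm mult_left_comm m_closed\<close>)
        finally show ?thesis .
      next
        case False
        then have zX: "z \<in> X" using z by blast
        have "(\<Sum>(k, l)\<leftarrow>?Q. \<beta> (z \<otimes> k) l)
            = (\<Sum>(k', l')\<leftarrow>Q'. \<Sum>(k, l)\<leftarrow>Q. \<beta> (k' \<otimes> (z \<otimes> k)) (l' \<otimes> l))"
          unfolding sum_Q swap[symmetric]
          by (rule cong) (use zc in \<open>simp add: m_assoc mult_comm mult_left_comm m_closed\<close>)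
        also have "\<dots> = (\<Sum>(k', l')\<leftarrow>Q'. \<Sum>(k, l)\<leftarrow>Q. \<beta> (k' \<otimes> k) (l' \<otimes> (z \<otimes> l)))"
        proof (intro arg_cong[where f = sum_list] map_cong refl, clarify)
          fix k l assume "(k, l) \<in> set Q'"
          then have "k \<in> carrier A" "l \<in> carrier A" using Qc' by auto
          from b'[OF this] show "(\<Sum>(k', l')\<leftarrow>Q. \<beta> (k \<otimes> (z \<otimes> k')) (l \<otimes> l'))
              = (\<Sum>(k', l')\<leftarrow>Q. \<beta> (k \<otimes> k') (l \<otimes> (z \<otimes> l')))"
            using assms(1) zX unfolding separates_def by blast
        qed
        also have "\<dots> = (\<Sum>(k, l)\<leftarrow>?Q. \<beta> k (z \<otimes> l))"
          unfolding sum_Q swap[symmetric]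
          by (rule cong) (use zc in \<open>simp add: m_assoc mult_comm mult_left_comm m_closed\<close>)
        finally show ?thesis .
      qed
    qed
  qed
  then show ?thesis by blast
qed

lemma separates_finite:
  assumes "finite X" "X \<subseteq> carrier A" "\<And>x. x \<in> X \<Longrightarrow> \<exists>Q. separates {x} Q"
  shows "\<exists>Q. separates X Q"
  using assms
proof induction
  case empty
  have "separates {} [(\<one>, \<one>)]" unfolding separates_def by simp
  then show ?case by blast
next
  case (insert x X)
  obtain Q where Q: "separates {x} Q" using insert.prems(2)[of x] by blast
  obtain Q' where Q': "separates X Q'" using insert by blast
  from separates_union[OF Q Q'] show ?case using insert.prems by simp
qed

text \<open>For a fixed list the condition is linear in z, so it can be checked on a spanning
  set.\<close>

definition separated :: "('a \<times> 'a) list \<Rightarrow> 'a set" where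
  "separated Q = {z \<in> carrier A. \<forall>\<beta>. bilinear_map A \<beta> \<longrightarrow>
     (\<Sum>(k, l)\<leftarrow>Q. \<beta> (z \<otimes> k) l) = (\<Sum>(k, l)\<leftarrow>Q. \<beta> k (z \<otimes> l))}"

lemma separated_closed:
  assumes Q: "set Q \<subseteq> carrier A \<times> carrier A" and x: "x \<in> separated Q"
  shows "y \<in> separated Q \<Longrightarrow> x \<oplus> y \<in> separated Q" "c \<odot> x \<in> separated Q"
proof -
  have xc: "x \<in> carrier A" using x by (simp add: separated_def)
  have cong: "(\<Sum>(k, l)\<leftarrow>Q. F k l) = (\<Sum>(k, l)\<leftarrow>Q. G k l)"
    if "\<And>k l. \<lbrakk>k \<in> carrier A; l \<in> carrier A\<rbrakk> \<Longrightarrow> F k l = G k l" for F G :: "'a \<Rightarrow> 'a \<Rightarrow> 'f poly"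
    by (intro arg_cong[where f = sum_list] map_cong refl, clarify, rule that) (use Q in auto)
  have lin: "linear_map A (\<beta> k)" "linear_map A (\<lambda>y. \<beta> y k)"
    if "bilinear_map A \<beta>" "k \<in> carrier A" for \<beta> k
    using that unfolding bilinear_map_def by auto
  show "x \<oplus> y \<in> separated Q" if y: "y \<in> separated Q"
    unfolding separated_def
  proof (intro CollectI conjI allI impI)
    have yc: "y \<in> carrier A" using y by (simp add: separated_def)
    show "x \<oplus> y \<in> carrier A" using xc yc by simp
    fix \<beta> assume b: "bilinear_map A \<beta>"
    have "(\<Sum>(k, l)\<leftarrow>Q. \<beta> ((x \<oplus> y) \<otimes> k) l)
        = (\<Sum>(k, l)\<leftarrow>Q. \<beta> (x \<otimes> k) l + \<beta> (y \<otimes> k) l)"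
      by (rule cong) (use xc yc linear_mapD(1)[OF lin(2)[OF b]] in \<open>simp add: l_distr m_closed\<close>)
    also have "\<dots> = (\<Sum>(k, l)\<leftarrow>Q. \<beta> k (x \<otimes> l) + \<beta> k (y \<otimes> l))"
      using x y b by (simp add: separated_def sum_list_addf case_prod_unfold)
    also have "\<dots> = (\<Sum>(k, l)\<leftarrow>Q. \<beta> k ((x \<oplus> y) \<otimes> l))"
      by (rule cong) (use xc yc linear_mapD(1)[OF lin(1)[OF b]] in \<open>simp add: l_distr m_closed\<close>)
    finally show "(\<Sum>(k, l)\<leftarrow>Q. \<beta> ((x \<oplus> y) \<otimes> k) l) = (\<Sum>(k, l)\<leftarrow>Q. \<beta> k ((x \<oplus> y) \<otimes> l))" .
  qed
  have sm: "(\<Sum>(k, l)\<leftarrow>Q. Polynomial.smult c (F k l)) = Polynomial.smult c (\<Sum>(k, l)\<leftarrow>Q. F k l)" for F :: "'a \<Rightarrow> 'a \<Rightarrow> 'f poly"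
    by (induction Q) (auto simp: smult_add_right)
  show "c \<odot> x \<in> separated Q"
    unfolding separated_def
  proof (intro CollectI conjI allI impI)
    show "c \<odot> x \<in> carrier A" using xc by (simp add: smult_closed)
    fix \<beta> assume b: "bilinear_map A \<beta>"
    have "(\<Sum>(k, l)\<leftarrow>Q. \<beta> ((c \<odot> x) \<otimes> k) l) = (\<Sum>(k, l)\<leftarrow>Q. Polynomial.smult c (\<beta> (x \<otimes> k) l))"
      by (rule cong) (use xc linear_mapD(2)[OF lin(2)[OF b]] in \<open>simp add: smult_mult_l m_closed\<close>)
    also have "\<dots> = (\<Sum>(k, l)\<leftarrow>Q. Polynomial.smult c (\<beta> k (x \<otimes> l)))"
      using x b by (simp add: separated_def sm)
    also have "\<dots> = (\<Sum>(k, l)\<leftarrow>Q. \<beta> k ((c \<odot> x) \<otimes> l))"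
      by (rule cong) (use xc linear_mapD(2)[OF lin(1)[OF b]] in \<open>simp add: smult_mult_l m_closed\<close>)
    finally show "(\<Sum>(k, l)\<leftarrow>Q. \<beta> ((c \<odot> x) \<otimes> k) l) = (\<Sum>(k, l)\<leftarrow>Q. \<beta> k ((c \<odot> x) \<otimes> l))" .
  qed
qed

end

section \<open>Products of finite separable field extensions\<close>

locale etale_presentation = assoc_algebra K
  for K :: "('f::field, 'a) module" (structure) +
  fixes n :: nat and E :: "nat \<Rightarrow> ('f, 'a) module" and h :: "'a \<Rightarrow> nat \<Rightarrow> 'a"
  assumes factors: "i < n \<Longrightarrow> finite_separable_extension (E i)"
    and iso: "h \<in> algebra_iso K (product_algebra {..<n} E)"
begin

lemma product_simps:
  "carrier (product_algebra {..<n} E) = (\<Pi>\<^sub>E i\<in>{..<n}. carrier (E i))"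
  "i < n \<Longrightarrow> (f \<otimes>\<^bsub>product_algebra {..<n} E\<^esub> g) i = f i \<otimes>\<^bsub>E i\<^esub> g i"
  "i < n \<Longrightarrow> \<one>\<^bsub>product_algebra {..<n} E\<^esub> i = \<one>\<^bsub>E i\<^esub>"
  "i < n \<Longrightarrow> (f \<oplus>\<^bsub>product_algebra {..<n} E\<^esub> g) i = f i \<oplus>\<^bsub>E i\<^esub> g i"
  "i < n \<Longrightarrow> (c \<odot>\<^bsub>product_algebra {..<n} E\<^esub> f) i = c \<odot>\<^bsub>E i\<^esub> f i"
  by (simp_all add: product_algebra_def)

lemma h_hom: "h \<in> ring_hom K (product_algebra {..<n} E)"
  and h_bij: "bij_betw h (carrier K) (carrier (product_algebra {..<n} E))"
  using iso by (simp_all add: algebra_iso_def algebra_hom_def)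

lemma factor_algebra: "i < n \<Longrightarrow> assoc_algebra (E i)"
  and factor_field: "i < n \<Longrightarrow> Ring.field (E i)"
  using factors by (simp_all add: finite_separable_extension_def)

lemma h_PiE: "x \<in> carrier K \<Longrightarrow> h x \<in> (\<Pi>\<^sub>E i\<in>{..<n}. carrier (E i))"
  using h_bij unfolding bij_betw_def product_simps by blast

lemma h_closed: "\<lbrakk>i < n; x \<in> carrier K\<rbrakk> \<Longrightarrow> h x i \<in> carrier (E i)"
  using h_PiE by (auto simp: PiE_iff)

lemma h_simps:
  assumes "i < n" "x \<in> carrier K"
  shows "y \<in> carrier K \<Longrightarrow> h (x \<otimes> y) i = h x i \<otimes>\<^bsub>E i\<^esub> h y i"
    "y \<in> carrier K \<Longrightarrow> h (x \<oplus> y) i = h x i \<oplus>\<^bsub>E i\<^esub> h y i"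
    "h (c \<odot> x) i = c \<odot>\<^bsub>E i\<^esub> h x i"
    "h \<one> i = \<one>\<^bsub>E i\<^esub>" "h \<zero> i = \<zero>\<^bsub>E i\<^esub>"
proof -
  interpret Ei: assoc_algebra "E i" by (rule factor_algebra[OF assms(1)])
  show "y \<in> carrier K \<Longrightarrow> h (x \<otimes> y) i = h x i \<otimes>\<^bsub>E i\<^esub> h y i"
    "y \<in> carrier K \<Longrightarrow> h (x \<oplus> y) i = h x i \<oplus>\<^bsub>E i\<^esub> h y i" "h \<one> i = \<one>\<^bsub>E i\<^esub>"
    using assms ring_hom_mult[OF h_hom] ring_hom_add[OF h_hom] ring_hom_one[OF h_hom]
    by (simp_all add: product_simps)
  show sm: "h (c \<odot> x) i = c \<odot>\<^bsub>E i\<^esub> h x i"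
    using iso assms by (simp add: algebra_iso_def algebra_hom_def product_simps)
  have "h (0 \<odot> x) i = 0 \<odot>\<^bsub>E i\<^esub> h x i"
    using iso assms by (simp add: algebra_iso_def algebra_hom_def product_simps)
  then show "h \<zero> i = \<zero>\<^bsub>E i\<^esub>"
    using assms h_closed by (simp add: smult_zero_left Ei.smult_zero_left)
qed

lemma h_eqI:
  assumes "x \<in> carrier K" "y \<in> carrier K" "\<And>i. i < n \<Longrightarrow> h x i = h y i"
  shows "x = y"
proof -
  have "h x = h y" by (rule PiE_ext[OF h_PiE h_PiE]) (use assms in auto)
  then show ?thesis using h_bij assms(1,2) unfolding bij_betw_def inj_on_def by blast
qed

lemma h_surj:
  assumes "\<And>i. i < n \<Longrightarrow> f i \<in> carrier (E i)"
  shows "\<exists>x\<in>carrier K. \<forall>i<n. h x i = f i"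
proof -
  have "restrict f {..<n} \<in> carrier (product_algebra {..<n} E)"
    unfolding product_simps using assms by auto
  then obtain x where "x \<in> carrier K" "restrict f {..<n} = h x"
    using h_bij unfolding bij_betw_def by blast
  then show ?thesis by (metis lessThan_iff restrict_apply')
qed

sublocale comm_assoc_algebra K
proof
  fix x y assume xy: "x \<in> carrier K" "y \<in> carrier K"
  show "x \<otimes> y = y \<otimes> x"
  proof (rule h_eqI)
    fix i assume i: "i < n"
    interpret Ei: Ring.field "E i" by (rule factor_field[OF i])
    show "h (x \<otimes> y) i = h (y \<otimes> x) i"
      using h_closed[OF i] xy by (simp add: h_simps[OF i] Ei.m_comm)
  qed (use xy in \<open>simp_all add: m_closed\<close>)
qed

text \<open>The inclusion of a factor as an ideal of \<open>K\<close>. It need not preserve units,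
  so a polynomial at \<open>emb i y\<close> has to be examined in every component.\<close>

definition emb :: "nat \<Rightarrow> 'a \<Rightarrow> 'a" where
  "emb i y = (SOME x. x \<in> carrier K \<and> (\<forall>j<n. h x j = (if j = i then y else \<zero>\<^bsub>E j\<^esub>)))"

lemma emb_props:
  assumes "i < n" "y \<in> carrier (E i)"
  shows "emb i y \<in> carrier K" "j < n \<Longrightarrow> h (emb i y) j = (if j = i then y else \<zero>\<^bsub>E j\<^esub>)"
proof -
  have "(if j = i then y else \<zero>\<^bsub>E j\<^esub>) \<in> carrier (E j)" if "j < n" for j
  proof -
    interpret Ej: assoc_algebra "E j" by (rule factor_algebra[OF that])
    show ?thesis using assms by simp
  qed
  from h_surj[OF this]
  have "\<exists>x. x \<in> carrier K \<and> (\<forall>j<n. h x j = (if j = i then y else \<zero>\<^bsub>E j\<^esub>))" by blast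
  from someI_ex[OF this]
  show "emb i y \<in> carrier K" "j < n \<Longrightarrow> h (emb i y) j = (if j = i then y else \<zero>\<^bsub>E j\<^esub>)"
    unfolding emb_def by blast+
qed

lemma emb_linear:
  assumes i: "i < n" and y: "y \<in> carrier (E i)"
  shows "z \<in> carrier (E i) \<Longrightarrow> emb i (y \<oplus>\<^bsub>E i\<^esub> z) = emb i y \<oplus> emb i z"
    "emb i (c \<odot>\<^bsub>E i\<^esub> y) = c \<odot> emb i y"
proof -
  interpret Ei: assoc_algebra "E i" by (rule factor_algebra[OF i])
  show "emb i (y \<oplus>\<^bsub>E i\<^esub> z) = emb i y \<oplus> emb i z" if z: "z \<in> carrier (E i)"
  proof (rule h_eqI)
    fix j assume j: "j < n"
    interpret Ej: assoc_algebra "E j" by (rule factor_algebra[OF j])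
    show "h (emb i (y \<oplus>\<^bsub>E i\<^esub> z)) j = h (emb i y \<oplus> emb i z) j"
      using y z j by (simp add: emb_props[OF i] h_simps)
  qed (use y z in \<open>simp_all add: emb_props[OF i]\<close>)
  show "emb i (c \<odot>\<^bsub>E i\<^esub> y) = c \<odot> emb i y"
  proof (rule h_eqI)
    fix j assume j: "j < n"
    interpret Ej: assoc_algebra "E j" by (rule factor_algebra[OF j])
    show "h (emb i (c \<odot>\<^bsub>E i\<^esub> y)) j = h (c \<odot> emb i y) j"
      using y j by (simp add: emb_props[OF i] h_simps Ei.smult_closed Ej.smult_zero_right)
  qed (use y in \<open>simp_all add: emb_props[OF i] smult_closed Ei.smult_closed\<close>)
qed

text \<open>
  An element of a single factor is killed by \<open>X P\<close>, where \<open>P\<close> is its minimal polynomial in that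
  factor: the extra root is needed for the other components.
\<close>

lemma separates_emb:
  assumes i: "i < n" and y: "y \<in> carrier (E i)"
  shows "\<exists>Q. separates {emb i y} Q"
proof -
  interpret Ei: assoc_algebra "E i" by (rule factor_algebra[OF i])
  interpret Fi: Ring.field "E i" by (rule factor_field[OF i])
  have x: "emb i y \<in> carrier K" by (rule emb_props(1)[OF i y])
  have comp: "h (poly_at K P (emb i y)) j = poly_at (E j) P (h (emb i y) j)" if j: "j < n" for P j
    by (rule poly_at_hom[OF factor_algebra[OF j] x, where h = "\<lambda>x. h x j"])
      (use j h_simps(4)[OF j x] in \<open>simp_all add: h_closed h_simps\<close>)
  have kill: "poly_at K (pCons 0 P) (emb i y) = \<zero>" if P: "y \<otimes>\<^bsub>E i\<^esub> poly_at (E i) P y = \<zero>\<^bsub>E i\<^esub>" for P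
  proof (rule h_eqI)
    fix j assume j: "j < n"
    interpret Ej: assoc_algebra "E j" by (rule factor_algebra[OF j])
    show "h (poly_at K (pCons 0 P) (emb i y)) j = h \<zero> j"
      unfolding comp[OF j] emb_props(2)[OF i y j]
      using P y j
      by (auto simp: Ej.poly_at_pCons Ej.smult_zero_left Ej.poly_at_closed h_simps(5)[OF j zero_closed])
  qed (simp_all add: poly_at_closed[OF x])
  show ?thesis
  proof (cases "y = \<zero>\<^bsub>E i\<^esub>")
    case True
    \<comment> \<open>The zero element has minimal polynomial X, and X times X would have a double
      root. So X itself is used; its derivative is 1, hence the Bezout coefficients 0 and 1.\<close>
    have "poly_at K (pCons 0 1) (emb i y) = \<zero>"
      by (rule kill) (simp add: True Ei.poly_at_closed)
    then show ?thesis
      by (rule separates_single[OF x, where u = 0 and v = 1]) (simp add: pderiv_pCons)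
  next
    case False
    obtain P where P: "minimal_polynomial (E i) y P" "coprime P (pderiv P)"
      using factors[OF i] y unfolding finite_separable_extension_def by blast
    have P0: "poly_at (E i) P y = \<zero>\<^bsub>E i\<^esub>" "lead_coeff P = 1"
      "\<And>q. q \<noteq> 0 \<Longrightarrow> poly_at (E i) q y = \<zero>\<^bsub>E i\<^esub> \<Longrightarrow> degree P \<le> degree q"
      using P(1) unfolding minimal_polynomial_def by auto
    \<comment> \<open>If P = X r, then r vanishes at the nonzero field element y, against minimality
      of the degree. So the additional factor X is coprime to \<open>P\<close>.\<close>
    have "coeff P 0 \<noteq> 0"
    proof
      assume "coeff P 0 = 0"
      then obtain r where r: "P = pCons 0 r" by (cases P) auto
      have "r \<noteq> 0" using r P0(2) by auto
      have c: "poly_at (E i) r y \<in> carrier (E i)" by (rule Ei.poly_at_closed[OF y])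
      have "y \<otimes>\<^bsub>E i\<^esub> poly_at (E i) r y = \<zero>\<^bsub>E i\<^esub>"
        using P0(1) c y unfolding r Ei.poly_at_pCons[OF y] by (simp add: Ei.smult_zero_left)
      then have "poly_at (E i) r y = \<zero>\<^bsub>E i\<^esub>" using Fi.integral[OF _ y c] False by blast
      then have "degree P \<le> degree r" using P0(3) \<open>r \<noteq> 0\<close> by blast
      then show False using r \<open>r \<noteq> 0\<close> by simp
    qed
    from bezout_pCons_zero[OF P(2) this] obtain u v
      where uv: "u * pCons 0 P + v * pderiv (pCons 0 P) = 1" .
    have "poly_at K (pCons 0 P) (emb i y) = \<zero>" by (rule kill) (simp add: P0(1) y)
    then show ?thesis using uv by (rule separates_single[OF x])
  qed
qed

text \<open>Finite spanning sets of the factors, embedded in \<open>K\<close>, are treated element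
  by element and joined through products of tensors. By linearity the resulting list then works for
  all of \<open>K\<close>.\<close>

lemma separates_carrier: "\<exists>Q. separates (carrier K) Q"
proof -
  have "\<forall>i\<in>{..<n}. \<exists>B. finite B \<and> B \<subseteq> carrier (E i) \<and>
      (\<forall>x\<in>carrier (E i). \<exists>c. x = (\<Oplus>\<^bsub>E i\<^esub>b\<in>B. c b \<odot>\<^bsub>E i\<^esub> b))"
    using factors unfolding finite_separable_extension_def finite_dimensional_algebra_def by blast
  from bchoice[OF this] obtain B where B': "\<forall>i\<in>{..<n}. finite (B i) \<and> B i \<subseteq> carrier (E i) \<and>
      (\<forall>x\<in>carrier (E i). \<exists>c. x = (\<Oplus>\<^bsub>E i\<^esub>b\<in>B i. c b \<odot>\<^bsub>E i\<^esub> b))" ..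
  have B: "finite (B i)" "B i \<subseteq> carrier (E i)"
    "x \<in> carrier (E i) \<Longrightarrow> \<exists>c. x = (\<Oplus>\<^bsub>E i\<^esub>b\<in>B i. c b \<odot>\<^bsub>E i\<^esub> b)" if "i < n" for i x
    using bspec[OF B', of i] that by simp_all
  let ?X = "\<Union>i\<in>{..<n}. emb i ` B i"
  have "\<exists>Q. separates ?X Q"
  proof (rule separates_finite)
    show "finite ?X" using B(1) by simp
    show "?X \<subseteq> carrier K" using B(2) emb_props(1) by auto
    show "\<exists>Q. separates {x} Q" if "x \<in> ?X" for x
    proof -
      obtain i b where ib: "i < n" "b \<in> B i" "x = emb i b" using \<open>x \<in> ?X\<close> by blast
      have "b \<in> carrier (E i)" using ib B(2)[OF ib(1)] by blast
      then show ?thesis unfolding ib(3) by (rule separates_emb[OF ib(1)])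
    qed
  qed
  then obtain Q where Q: "separates ?X Q" by blast
  have Qs: "set Q \<subseteq> carrier K \<times> carrier K" using Q unfolding separates_def by blast
  have base: "emb i b \<in> separated Q" if "i < n" "b \<in> B i" for i b
  proof -
    have "emb i b \<in> ?X" "emb i b \<in> carrier K" using that B(2) emb_props(1) by auto
    then show ?thesis using Q unfolding separates_def separated_def by blast
  qed
  note closed = separated_closed[OF Qs]
  have zero: "\<zero> \<in> separated Q"
  proof -
    have z: "\<zero> \<otimes> k = \<zero>" if "k \<in> carrier K" for k using that by simp
    have "(\<Sum>(k, l)\<leftarrow>Q. \<beta> (\<zero> \<otimes> k) l) = (\<Sum>(k, l)\<leftarrow>Q. \<beta> k (\<zero> \<otimes> l))" if b: "bilinear_map K \<beta>" for \<beta>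
    proof (intro arg_cong[where f = sum_list] map_cong refl, clarify)
      fix k l assume "(k, l) \<in> set Q"
      then have kl: "k \<in> carrier K" "l \<in> carrier K" using Qs by auto
      then show "\<beta> (\<zero> \<otimes> k) l = \<beta> k (\<zero> \<otimes> l)"
        using b linear_map_zero[of "\<beta> k"] linear_map_zero[of "\<lambda>y. \<beta> y l"]
        unfolding bilinear_map_def by simp
    qed
    then show ?thesis unfolding separated_def by simp
  qed
  have emb_sep: "emb i y \<in> separated Q" if i: "i < n" and y: "y \<in> carrier (E i)" for i y
  proof -
    interpret Ei: assoc_algebra "E i" by (rule factor_algebra[OF i])
    obtain c where c: "y = (\<Oplus>\<^bsub>E i\<^esub>b\<in>B i. c b \<odot>\<^bsub>E i\<^esub> b)" using B(3)[OF i y] by blast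
    have "finsum (E i) (\<lambda>b. c b \<odot>\<^bsub>E i\<^esub> b) S \<in> carrier (E i) \<and>
        emb i (finsum (E i) (\<lambda>b. c b \<odot>\<^bsub>E i\<^esub> b) S) \<in> separated Q" if "S \<subseteq> B i" for S
      using finite_subset[OF that B(1)[OF i]] that
    proof induction
      case empty
      have "emb i \<zero>\<^bsub>E i\<^esub> = \<zero>"
        using emb_linear(2)[OF i, of "\<zero>\<^bsub>E i\<^esub>" 0] emb_props(1)[OF i, of "\<zero>\<^bsub>E i\<^esub>"]
        by (simp add: Ei.smult_zero_left smult_zero_left)
      then show ?case using zero by simp
    next
      case (insert b S)
      have bc: "b \<in> carrier (E i)" "c b \<odot>\<^bsub>E i\<^esub> b \<in> carrier (E i)"
        using insert.prems B(2)[OF i] Ei.smult_closed by auto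
      have "finsum (E i) (\<lambda>b. c b \<odot>\<^bsub>E i\<^esub> b) (insert b S)
          = c b \<odot>\<^bsub>E i\<^esub> b \<oplus>\<^bsub>E i\<^esub> finsum (E i) (\<lambda>b. c b \<odot>\<^bsub>E i\<^esub> b) S"
        using insert B(2)[OF i] Ei.smult_closed by (intro Ei.finsum_insert) auto
      moreover have "c b \<odot> emb i b \<in> separated Q"
        using closed(2) base[OF i] insert.prems by blast
      ultimately show ?case
        using insert bc closed(1) by (simp add: emb_linear[OF i])
    qed
    then show ?thesis unfolding c by blast
  qed
  have "x \<in> separated Q" if x: "x \<in> carrier K" for x
  proof -
    \<comment> \<open>x is built up one component at a time: z agrees with x in the first m
      components and is zero in the others.\<close>
    have "\<exists>z\<in>separated Q. \<forall>j<n. h z j = (if j < m then h x j else \<zero>\<^bsub>E j\<^esub>)" if "m \<le> n" for m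
      using that
    proof (induction m)
      case 0
      show ?case using zero h_simps(5)[OF _ zero_closed] by auto
    next
      case (Suc m)
      then have m: "m < n" by simp
      obtain z where z: "z \<in> separated Q" "\<forall>j<n. h z j = (if j < m then h x j else \<zero>\<^bsub>E j\<^esub>)"
        using Suc by auto
      have zc: "z \<in> carrier K" using z(1) by (simp add: separated_def)
      let ?y = "emb m (h x m)"
      have hx: "h x m \<in> carrier (E m)" by (rule h_closed[OF m x])
      have "h (z \<oplus> ?y) j = (if j < Suc m then h x j else \<zero>\<^bsub>E j\<^esub>)" if j: "j < n" for j
      proof -
        interpret Ej: assoc_algebra "E j" by (rule factor_algebra[OF j])
        have "h x j \<in> carrier (E j)" by (rule h_closed[OF j x])
        then have "\<zero>\<^bsub>E j\<^esub> \<oplus>\<^bsub>E j\<^esub> h x j = h x j" "h x j \<oplus>\<^bsub>E j\<^esub> \<zero>\<^bsub>E j\<^esub> = h x j" by simp_all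
        then show ?thesis
          using z(2) j zc emb_props[OF m hx] by (auto simp: h_simps less_Suc_eq)
      qed
      moreover have "z \<oplus> ?y \<in> separated Q" by (rule closed(1)[OF z(1) emb_sep[OF m hx]])
      ultimately show ?case by blast
    qed
    from this[of n] obtain z where z: "z \<in> separated Q" "\<forall>j<n. h z j = h x j" by auto
    have "z = x" by (rule h_eqI) (use z x in \<open>auto simp: separated_def\<close>)
    then show ?thesis using z(1) by simp
  qed
  then have "separates (carrier K) Q"
    using Q unfolding separates_def separated_def by blast
  then show ?thesis by blast
qed

end

lemma etale_separates:
  fixes K :: "('f::field, 'a) module"
  assumes "etale_algebra K"
  shows "comm_assoc_algebra K" "\<exists>Q. comm_assoc_algebra.separates K (carrier K) Q"
proof -
  obtain n E h where "\<forall>i<n. finite_separable_extension (E i)"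
      "h \<in> algebra_iso K (product_algebra {..<n} (E :: nat \<Rightarrow> ('f, 'a) module))"
    using assms unfolding etale_algebra_def by blast
  then interpret etale_presentation K n E h
    using assms unfolding etale_algebra_def
    by (intro etale_presentation.intro etale_presentation_axioms.intro) auto
  show "comm_assoc_algebra K" by (rule comm_assoc_algebra_axioms)
  show "\<exists>Q. separates (carrier K) Q" by (rule separates_carrier)
qed

section \<open>The nucleus and the Jacobson radical\<close>

context nonassoc_algebra
begin

lemma minus_eq_zero_iff:
  assumes "x \<in> carrier A" "y \<in> carrier A"
  shows "x \<ominus> y = \<zero> \<longleftrightarrow> x = y"
proof
  assume "x \<ominus> y = \<zero>"
  then have "(x \<ominus> y) \<oplus> y = \<zero> \<oplus> y" by simp
  then show "x = y" using assms by (simp add: a_minus_def a_assoc l_neg)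
qed (use assms in \<open>simp add: a_minus_def r_neg\<close>)

lemma nucleus_iff:
  "x \<in> nucleus A \<longleftrightarrow> x \<in> carrier A \<and> (\<forall>a\<in>carrier A. \<forall>b\<in>carrier A.
     (x \<otimes> a) \<otimes> b = x \<otimes> (a \<otimes> b) \<and> (a \<otimes> x) \<otimes> b = a \<otimes> (x \<otimes> b) \<and> (a \<otimes> b) \<otimes> x = a \<otimes> (b \<otimes> x))"
  unfolding nucleus_def associator_def by (auto simp: m_closed minus_eq_zero_iff)

lemma nucleusD:
  assumes "x \<in> nucleus A"
  shows "x \<in> carrier A"
    "\<lbrakk>a \<in> carrier A; b \<in> carrier A\<rbrakk> \<Longrightarrow> (x \<otimes> a) \<otimes> b = x \<otimes> (a \<otimes> b)"
    "\<lbrakk>a \<in> carrier A; b \<in> carrier A\<rbrakk> \<Longrightarrow> (a \<otimes> x) \<otimes> b = a \<otimes> (x \<otimes> b)"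
    "\<lbrakk>a \<in> carrier A; b \<in> carrier A\<rbrakk> \<Longrightarrow> (a \<otimes> b) \<otimes> x = a \<otimes> (b \<otimes> x)"
  using assms by (auto simp: nucleus_iff)

lemma nucleus_one: "\<one> \<in> nucleus A"
  by (auto simp: nucleus_iff one_closed l_one r_one m_closed)

lemma nucleus_zero: "\<zero> \<in> nucleus A"
  by (auto simp: nucleus_iff mult_zero_left mult_zero_right m_closed)

lemma nucleus_add:
  assumes "x \<in> nucleus A" "y \<in> nucleus A"
  shows "x \<oplus> y \<in> nucleus A"
  unfolding nucleus_iff
  using nucleusD[OF assms(1)] nucleusD[OF assms(2)] by (simp add: l_distr r_distr m_closed)

lemma nucleus_smult:
  assumes "x \<in> nucleus A"
  shows "c \<odot> x \<in> nucleus A"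
  unfolding nucleus_iff
  using nucleusD[OF assms] by (simp add: smult_mult_l smult_mult_r m_closed smult_closed)

lemma nucleus_mult:
  assumes "x \<in> nucleus A" "y \<in> nucleus A"
  shows "x \<otimes> y \<in> nucleus A"
  unfolding nucleus_iff
proof (intro conjI ballI)
  note x = nucleusD[OF assms(1)] and y = nucleusD[OF assms(2)]
  show "x \<otimes> y \<in> carrier A" using x y by (simp add: m_closed)
  fix a b assume ab: "a \<in> carrier A" "b \<in> carrier A"
  show "((x \<otimes> y) \<otimes> a) \<otimes> b = (x \<otimes> y) \<otimes> (a \<otimes> b)"
    using ab x y by (simp add: m_closed)
  have "(a \<otimes> (x \<otimes> y)) \<otimes> b = ((a \<otimes> x) \<otimes> y) \<otimes> b"
    using ab x(1) y(1) y(4)[of a x] by simp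
  also have "\<dots> = (a \<otimes> x) \<otimes> (y \<otimes> b)" using ab x(1) by (intro y(3) m_closed)
  also have "\<dots> = a \<otimes> ((x \<otimes> y) \<otimes> b)" using ab x y(1) by (simp add: m_closed)
  finally show "(a \<otimes> (x \<otimes> y)) \<otimes> b = a \<otimes> ((x \<otimes> y) \<otimes> b)" .
  have "(a \<otimes> b) \<otimes> (x \<otimes> y) = ((a \<otimes> b) \<otimes> x) \<otimes> y"
    using ab x(1) y(1) y(4)[of "a \<otimes> b" x] by (simp add: m_closed)
  also have "\<dots> = (a \<otimes> (b \<otimes> x)) \<otimes> y" using ab x(4)[of a b] by simp
  also have "\<dots> = a \<otimes> (b \<otimes> (x \<otimes> y))"
    using ab x(1) y(4)[of a "b \<otimes> x"] y(4)[of b x] by (simp add: m_closed)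
  finally show "(a \<otimes> b) \<otimes> (x \<otimes> y) = a \<otimes> (b \<otimes> (x \<otimes> y))" .
qed

lemma nucleus_simps:
  "carrier (nucleus_algebra A) = nucleus A" "add (nucleus_algebra A) = add A"
  "zero (nucleus_algebra A) = \<zero>" "one (nucleus_algebra A) = \<one>"
  "mult (nucleus_algebra A) = mult A" "smult (nucleus_algebra A) = smult A"
  by (simp_all add: nucleus_algebra_def)

lemma nucleus_minus: "x \<in> nucleus A \<Longrightarrow> \<ominus> x \<in> nucleus A"
  using nucleus_smult[of x "- 1"] by (simp add: nucleusD(1) smult_minus_one)

lemma assoc_algebra_nucleus: "assoc_algebra (nucleus_algebra A)"
proof -
  have r: "ring (nucleus_algebra A)"
  proof (rule ringI)
    show "abelian_group (nucleus_algebra A)"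
    proof (rule abelian_groupI)
      fix x assume "x \<in> carrier (nucleus_algebra A)"
      then show "\<exists>y\<in>carrier (nucleus_algebra A). y \<oplus>\<^bsub>nucleus_algebra A\<^esub> x = \<zero>\<^bsub>nucleus_algebra A\<^esub>"
        using nucleus_minus by (intro bexI[of _ "\<ominus> x"]) (simp_all add: nucleus_simps nucleusD l_neg)
    qed (simp_all add: nucleus_simps nucleus_add nucleus_zero nucleusD(1) a_ac)
    show "Group.monoid (nucleus_algebra A)"
      by (rule monoidI)
        (simp_all add: nucleus_simps nucleus_mult nucleus_one nucleusD l_one r_one)
  qed (simp_all add: nucleus_simps nucleusD(1) l_distr r_distr)
  then interpret N: ring "nucleus_algebra A" .
  have "nonassoc_algebra (nucleus_algebra A)"
    by unfold_locales
      (simp_all add: nucleus_simps nucleus_mult nucleus_one nucleusD(1) l_one r_one l_distr r_distr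
        nucleus_smult smult_l_distr smult_r_distr smult_assoc smult_one smult_mult_l smult_mult_r)
  then show ?thesis by (intro assoc_algebra.intro r)
qed

end

section \<open>Maximal left ideals and the Jacobson radical\<close>

context ring
begin

lemma left_idealI:
  assumes "I \<subseteq> carrier R" "I \<noteq> {}" "\<And>x y. \<lbrakk>x \<in> I; y \<in> I\<rbrakk> \<Longrightarrow> x \<oplus> y \<in> I"
    "\<And>r x. \<lbrakk>r \<in> carrier R; x \<in> I\<rbrakk> \<Longrightarrow> r \<otimes> x \<in> I"
  shows "left_ideal I R"
proof -
  have "\<ominus> x \<in> I" if "x \<in> I" for x
  proof -
    have "(\<ominus> \<one>) \<otimes> x = \<ominus> x" using that assms(1) by (auto simp: l_minus)
    then show ?thesis using assms(4)[of "\<ominus> \<one>" x] that by simp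
  qed
  then have "subgroup I (add_monoid R)"
    using assms by (intro add.subgroupI) auto
  then show ?thesis unfolding left_ideal_def using assms(4) by (simp add: additive_subgroup.intro)
qed

lemma left_idealD:
  assumes "left_ideal I R"
  shows "I \<subseteq> carrier R" "\<zero> \<in> I" "\<lbrakk>x \<in> I; y \<in> I\<rbrakk> \<Longrightarrow> x \<oplus> y \<in> I" "x \<in> I \<Longrightarrow> \<ominus> x \<in> I"
    "\<lbrakk>r \<in> carrier R; x \<in> I\<rbrakk> \<Longrightarrow> r \<otimes> x \<in> I"
proof -
  interpret additive_subgroup I R using assms by (simp add: left_ideal_def)
  show "I \<subseteq> carrier R" "\<zero> \<in> I" "\<lbrakk>x \<in> I; y \<in> I\<rbrakk> \<Longrightarrow> x \<oplus> y \<in> I" "x \<in> I \<Longrightarrow> \<ominus> x \<in> I"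
    using a_subset by auto
  show "\<lbrakk>r \<in> carrier R; x \<in> I\<rbrakk> \<Longrightarrow> r \<otimes> x \<in> I" using assms by (simp add: left_ideal_def)
qed

text \<open>The left ideal \<open>M\<close> + \<open>R\<close> y is larger than \<open>M\<close>,
  hence the whole ring; expressing the unit in it provides r. This is the elementwise form of
  maximality assumed for semisimple algebras.\<close>

lemma maximal_left_ideal_inverse:
  assumes M: "maximal_left_ideal M R" and y: "y \<in> carrier R" "y \<notin> M"
  shows "\<exists>r\<in>carrier R. \<one> \<ominus> r \<otimes> y \<in> M"
proof -
  have Ml: "left_ideal M R" using M by (simp add: maximal_left_ideal_def)
  note MD = left_idealD[OF Ml]
  let ?L = "{a \<oplus> r \<otimes> y |a r. a \<in> M \<and> r \<in> carrier R}"
  have "left_ideal ?L R"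
  proof (rule left_idealI)
    show "?L \<subseteq> carrier R" using MD(1) y by auto
    show "?L \<noteq> {}" using MD(2) by blast
  next
    fix u v assume "u \<in> ?L" "v \<in> ?L"
    then obtain a r b s where "u = a \<oplus> r \<otimes> y" "v = b \<oplus> s \<otimes> y" and c: "a \<in> M" "b \<in> M"
      "r \<in> carrier R" "s \<in> carrier R" by blast
    then have "u \<oplus> v = (a \<oplus> b) \<oplus> (r \<oplus> s) \<otimes> y"
      using MD(1) y by (simp add: l_distr subset_iff a_ac)
    then show "u \<oplus> v \<in> ?L" using c MD(3) by blast
  next
    fix s v assume s: "s \<in> carrier R" and "v \<in> ?L"
    then obtain a r where "v = a \<oplus> r \<otimes> y" and c: "a \<in> M" "r \<in> carrier R" by blast
    then have "s \<otimes> v = s \<otimes> a \<oplus> (s \<otimes> r) \<otimes> y"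
      using MD(1) y s by (simp add: r_distr subset_iff m_assoc)
    then show "s \<otimes> v \<in> ?L" using c s MD(5) by blast
  qed
  moreover have "M \<subseteq> ?L"
  proof
    fix a assume a: "a \<in> M"
    then have "a = a \<oplus> \<zero> \<otimes> y" using MD(1) y by (simp add: subset_iff)
    then show "a \<in> ?L" using a by blast
  qed
  moreover have "y \<in> ?L"
  proof -
    have "y = \<zero> \<oplus> \<one> \<otimes> y" using y by simp
    then show ?thesis using MD(2) by blast
  qed
  ultimately have "?L = carrier R" using M y(2) unfolding maximal_left_ideal_def by blast
  then have "\<one> \<in> ?L" by simp
  then obtain a r where ar: "\<one> = a \<oplus> r \<otimes> y" "a \<in> M" "r \<in> carrier R" by blast
  then have "\<one> \<ominus> r \<otimes> y = a" using MD(1) y by (simp add: a_minus_def subset_iff a_assoc r_neg)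
  then show ?thesis using ar by blast
qed

lemma jacobson_radicalD:
  "\<lbrakk>x \<in> jacobson_radical R; maximal_left_ideal M R\<rbrakk> \<Longrightarrow> x \<in> M"
  by (simp add: jacobson_radical_def)

text \<open>The set is the kernel of z \<mapsto> z r into the simple module \<open>R / M\<close>,
  and that map is onto as r is not in \<open>M\<close>. It is what makes the radical closed under
  right multiplication.\<close>

lemma maximal_left_ideal_quotient:
  assumes M: "maximal_left_ideal M R" and r: "r \<in> carrier R" "r \<notin> M"
  shows "maximal_left_ideal {z \<in> carrier R. z \<otimes> r \<in> M} R"
proof -
  let ?Q = "{z \<in> carrier R. z \<otimes> r \<in> M}"
  have Ml: "left_ideal M R" using M by (simp add: maximal_left_ideal_def)
  note MD = left_idealD[OF Ml]
  have Ql: "left_ideal ?Q R"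
  proof (rule left_idealI)
    have "\<zero> \<in> ?Q" using MD(2) r by simp
    then show "?Q \<noteq> {}" by blast
  qed (use MD r in \<open>auto simp: l_distr m_assoc\<close>)
  moreover have "?Q \<noteq> carrier R"
  proof
    assume "?Q = carrier R"
    then have "\<one> \<in> ?Q" by simp
    then show False using r by simp
  qed
  moreover have "L = ?Q \<or> L = carrier R" if L: "left_ideal L R" "?Q \<subseteq> L" for L
  proof (rule disjCI)
    assume "L \<noteq> carrier R"
    note LD = left_idealD[OF L(1)]
    have "L \<subseteq> ?Q"
    proof (rule ccontr)
      assume "\<not> L \<subseteq> ?Q"
      then obtain a where a: "a \<in> L" "a \<notin> ?Q" by blast
      have ac: "a \<in> carrier R" using a LD(1) by blast
      then have "a \<otimes> r \<notin> M" using a by simp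
      then obtain t where t: "t \<in> carrier R" "\<one> \<ominus> t \<otimes> (a \<otimes> r) \<in> M"
        using maximal_left_ideal_inverse[OF M] r ac by blast
      \<comment> \<open>The factor r is shifted from the left to the right: since 1 - t a r lies in
        \<open>M\<close>, the element 1 - r t a lies in \<open>?Q\<close>.\<close>
      have "r \<otimes> (\<one> \<ominus> t \<otimes> (a \<otimes> r)) = (\<one> \<ominus> (r \<otimes> t) \<otimes> a) \<otimes> r"
        using r ac t(1) by (simp add: a_minus_def r_distr l_distr r_minus l_minus m_assoc)
      moreover have "r \<otimes> (\<one> \<ominus> t \<otimes> (a \<otimes> r)) \<in> M" using MD(5) r t by blast
      ultimately have "\<one> \<ominus> (r \<otimes> t) \<otimes> a \<in> L" using L(2) r ac t(1) by auto
      moreover have "(r \<otimes> t) \<otimes> a \<in> L" using LD(5) a r t by simp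
      ultimately have "(\<one> \<ominus> (r \<otimes> t) \<otimes> a) \<oplus> (r \<otimes> t) \<otimes> a \<in> L" by (rule LD(3))
      then have "\<one> \<in> L" using r ac t(1) by (simp add: a_minus_def a_assoc l_neg)
      then have "x \<in> L" if "x \<in> carrier R" for x using LD(5)[of x \<one>] that by simp
      then show False using LD(1) \<open>L \<noteq> carrier R\<close> by blast
    qed
    then show "L = ?Q" using L(2) by blast
  qed
  ultimately show ?thesis unfolding maximal_left_ideal_def by blast
qed

text \<open>Right multiples are the point: if r is not in \<open>M\<close>, then the z with z r in
  \<open>M\<close> form a maximal left ideal, which contains x.\<close>

lemma ideal_jacobson_radical: "ideal (jacobson_radical R) R"
proof -
  let ?J = "jacobson_radical R"
  have Mmem: "left_ideal M R" if "maximal_left_ideal M R" for M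
    using that by (simp add: maximal_left_ideal_def)
  have left: "left_ideal ?J R"
  proof (rule left_idealI)
    have "\<zero> \<in> ?J" using left_idealD(2)[OF Mmem] by (auto simp: jacobson_radical_def)
    then show "?J \<noteq> {}" by blast
    show "x \<oplus> y \<in> ?J" if "x \<in> ?J" "y \<in> ?J" for x y
      using that left_idealD(3)[OF Mmem] by (auto simp: jacobson_radical_def)
    show "r \<otimes> x \<in> ?J" if "r \<in> carrier R" "x \<in> ?J" for r x
      using that left_idealD(5)[OF Mmem] by (auto simp: jacobson_radical_def)
  qed (auto simp: jacobson_radical_def)
  have right: "x \<otimes> r \<in> ?J" if x: "x \<in> ?J" and r: "r \<in> carrier R" for x r
  proof -
    have xc: "x \<in> carrier R" using x by (simp add: jacobson_radical_def)
    have "x \<otimes> r \<in> M" if M: "maximal_left_ideal M R" for M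
    proof (cases "r \<in> M")
      case True
      then show ?thesis using left_idealD(5)[OF Mmem[OF M] xc] by blast
    next
      case False
      show ?thesis using jacobson_radicalD[OF x maximal_left_ideal_quotient[OF M r False]] by simp
    qed
    then show ?thesis using xc r by (simp add: jacobson_radical_def)
  qed
  have "subgroup ?J (add_monoid R)"
    using left by (simp add: left_ideal_def additive_subgroup.a_subgroup)
  then show ?thesis using left_idealD(5)[OF left] right by (intro idealI ring_axioms) auto
qed

end

section \<open>Coordinates\<close>

interpretation poly_vs: vector_space "Polynomial.smult :: 'f::field \<Rightarrow> 'f poly \<Rightarrow> 'f poly"
  by unfold_locales (simp_all add: smult_add_right smult_add_left)

text \<open>Polynomials serve as a vector space type with room for every finite-dimensional algebra.
  The linear map \<open>g\<close> is total and onto, \<open>V\<close> is a complement of its kernel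
  within the space used, and \<open>co\<close> is the inverse of \<open>g\<close> on
  \<open>V\<close>.\<close>

locale coordinatized = nonassoc_algebra A
  for A :: "('f::field, 'a) module" (structure) +
  fixes V B0 :: "'f poly set" and g :: "'f poly \<Rightarrow> 'a" and co :: "'a \<Rightarrow> 'f poly"
  assumes V_subspace: "poly_vs.subspace V" and B0_finite: "finite B0"
    and V_span: "V \<subseteq> poly_vs.span B0"
    and g_add: "g (p + q) = g p \<oplus> g q" and g_smult: "g (Polynomial.smult c p) = c \<odot> g p"
    and g_closed: "g p \<in> carrier A"
    and co_closed: "x \<in> carrier A \<Longrightarrow> co x \<in> V"
    and g_co: "x \<in> carrier A \<Longrightarrow> g (co x) = x"
    and co_g: "p \<in> V \<Longrightarrow> co (g p) = p"
begin

lemma co_add: "\<lbrakk>x \<in> carrier A; y \<in> carrier A\<rbrakk> \<Longrightarrow> co (x \<oplus> y) = co x + co y"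
  using co_g[of "co x + co y"] V_subspace
  by (simp add: g_add g_co co_closed poly_vs.subspace_add)

lemma co_smult: "x \<in> carrier A \<Longrightarrow> co (c \<odot> x) = Polynomial.smult c (co x)"
  using co_g[of "Polynomial.smult c (co x)"] V_subspace
  by (simp add: g_smult g_co co_closed poly_vs.subspace_scale)

text \<open>Because \<open>g\<close> is total and always lands in the carrier, the transported
  product is bilinear on all polynomials, as \<open>fd_algebra\<close> requires.\<close>

definition mul :: "'f poly \<Rightarrow> 'f poly \<Rightarrow> 'f poly" where
  "mul p q = co (g p \<otimes> g q)"

lemma mul_co: "\<lbrakk>x \<in> carrier A; y \<in> carrier A\<rbrakk> \<Longrightarrow> mul (co x) (co y) = co (x \<otimes> y)"
  by (simp add: mul_def g_co)

lemma g_mul: "g (mul p q) = g p \<otimes> g q"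
  by (simp add: mul_def g_co g_closed m_closed)

lemma g_zero: "g 0 = \<zero>"
  using g_smult[of 0 0] by (simp add: smult_zero_left g_closed)

lemma co_zero: "co \<zero> = 0"
  using co_g[of 0] V_subspace by (simp add: g_zero poly_vs.subspace_0)

lemma g_sum: "finite I \<Longrightarrow> g (sum f I) = (\<Oplus>i\<in>I. g (f i))"
  by (induction I rule: finite_induct) (auto simp: g_zero g_add g_closed)

sublocale C: fd_algebra Polynomial.smult V B0 mul "co \<one>"
  by unfold_locales
    (simp_all add: V_subspace B0_finite V_span mul_def g_add g_smult g_closed g_co co_g co_closed
      co_add co_smult m_closed one_closed l_distr r_distr smult_mult_l smult_mult_r l_one r_one)

end

section \<open>Existence of coordinates\<close>

context nonassoc_algebra
begin

text \<open>With \<open>P\<close> a projection onto the kernel of \<open>g\<close> in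
  \<open>V0\<close>, the subspace of \<open>V0\<close> on which \<open>P\<close> vanishes is a
  complement of that kernel, so \<open>g\<close> maps it bijectively onto the algebra.\<close>

lemma coordinatized_exists:
  fixes g :: "'f poly \<Rightarrow> 'a"
  assumes V0: "poly_vs.subspace V0" "finite B0" "V0 \<subseteq> poly_vs.span B0"
    and g: "\<And>p q. g (p + q) = g p \<oplus> g q" "\<And>c p. g (Polynomial.smult c p) = c \<odot> g p"
    "\<And>p. g p \<in> carrier A"
    and surj: "\<And>x. x \<in> carrier A \<Longrightarrow> \<exists>p\<in>V0. g p = x"
  shows "\<exists>V co. coordinatized A V B0 g co"
proof -
  have g0: "g 0 = \<zero>" using g(2)[of 0 0] by (simp add: smult_zero_left g(3))
  have gdiff: "g (p - q) = g p \<ominus> g q" for p q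
    using g(1)[of "p - q" q] g(3) by (simp add: a_minus_def a_assoc r_neg)
  let ?N = "{p \<in> V0. g p = \<zero>}"
  have "poly_vs.subspace ?N"
    using V0(1) by (auto simp: poly_vs.subspace_def g0 g smult_zero_right)
  then obtain P where P: "Vector_Spaces.linear Polynomial.smult Polynomial.smult P" "\<And>x. P x \<in> ?N"
    "\<And>x. x \<in> ?N \<Longrightarrow> P x = x"
    using poly_vs.projection_exists by blast
  have Plin: "P (x + y) = P x + P y" "P (Polynomial.smult c x) = Polynomial.smult c (P x)" for x y c
    using P(1) unfolding Vector_Spaces.linear_iff by auto
  have Pdiff: "P (x - y) = P x - P y" for x y using Plin(1)[of "x - y" y] by simp
  have P0: "P 0 = 0" using Plin(2)[of 0 0] by simp
  define V where "V = {p \<in> V0. P p = 0}"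
  have V: "poly_vs.subspace V"
    using V0(1) by (auto simp: V_def poly_vs.subspace_def Plin P0)
  have ex: "\<exists>p. p \<in> V \<and> g p = x" if x: "x \<in> carrier A" for x
  proof -
    obtain p where p: "p \<in> V0" "g p = x" using surj[OF x] by blast
    have "P p \<in> V0" "g (P p) = \<zero>" "P (P p) = P p" using P(2)[of p] P(3)[OF P(2)] by auto
    then have "p - P p \<in> V" "g (p - P p) = x"
      using p V0(1) x by (simp_all add: V_def poly_vs.subspace_diff Pdiff gdiff a_minus_def)
    then show ?thesis by blast
  qed
  define co where "co x = (SOME p. p \<in> V \<and> g p = x)" for x
  have co: "co x \<in> V" "g (co x) = x" if "x \<in> carrier A" for x
    using someI_ex[OF ex[OF that]] unfolding co_def by auto
  have "co (g p) = p" if p: "p \<in> V" for p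
  proof -
    have "co (g p) - p \<in> ?N"
      using co[OF g(3)[of p]] p V0(1) by (simp add: V_def poly_vs.subspace_diff gdiff g(3) r_neg a_minus_def)
    then have "P (co (g p) - p) = co (g p) - p" by (rule P(3))
    moreover have "P (co (g p) - p) = 0" using co(1)[OF g(3)[of p]] p by (simp add: V_def Pdiff)
    ultimately show ?thesis by simp
  qed
  then have "coordinatized A V B0 g co"
    using V V0 g co by unfold_locales (auto simp: V_def)
  then show ?thesis by blast
qed

text \<open>A finite spanning set is numbered, and \<open>g\<close> reads the coefficients of a
  polynomial as coefficients of a linear combination. Monomials of degree below the size of the set
  already reach every element.\<close>

lemma coordinatized_finite_dimensional:
  assumes "finite_dimensional_algebra A"
  shows "\<exists>V B0 g co. coordinatized A V B0 g co"
proof -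
  obtain B where B: "finite B" "B \<subseteq> carrier A"
    "\<And>x. x \<in> carrier A \<Longrightarrow> \<exists>c. x = (\<Oplus>b\<in>B. c b \<odot> b)"
    using assms unfolding finite_dimensional_algebra_def by blast
  obtain e where e: "bij_betw e B {0..<card B}"
    using ex_bij_betw_finite_nat[OF B(1)] by blast
  define g where "g p = (\<Oplus>b\<in>B. coeff p (e b) \<odot> b)" for p
  have cl: "(\<lambda>b. c b \<odot> b) \<in> B \<rightarrow> carrier A" for c using B(2) smult_closed by auto
  let ?B0 = "(\<lambda>i. monom (1::'f) i) ` {0..<card B}"
  have "g (p + q) = g p \<oplus> g q" for p q
    unfolding g_def finsum_addf[OF cl cl, symmetric]
    by (rule finsum_cong') (use B(2) in \<open>auto simp: smult_l_distr smult_closed\<close>)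
  moreover have "g (Polynomial.smult c p) = c \<odot> g p" for c p
  proof -
    have "c \<odot> g p = (\<Oplus>b\<in>B. c \<odot> (coeff p (e b) \<odot> b))"
      unfolding g_def by (rule finsum_smult[OF B(1)]) (use B(2) smult_closed in auto)
    also have "\<dots> = g (Polynomial.smult c p)"
      unfolding g_def by (rule finsum_cong') (use B(2) in \<open>auto simp: smult_assoc smult_closed\<close>)
    finally show ?thesis by simp
  qed
  moreover have "g p \<in> carrier A" for p unfolding g_def by (rule finsum_closed[OF cl])
  moreover have "\<exists>p\<in>poly_vs.span ?B0. g p = x" if "x \<in> carrier A" for x
  proof -
    obtain c where c: "x = (\<Oplus>b\<in>B. c b \<odot> b)" using B(3)[OF \<open>x \<in> carrier A\<close>] by blast
    let ?p = "\<Sum>b\<in>B. Polynomial.smult (c b) (monom 1 (e b))"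
    have "?p \<in> poly_vs.span ?B0"
    proof (intro poly_vs.span_sum poly_vs.span_scale poly_vs.span_base)
      fix b assume "b \<in> B"
      then have "e b \<in> {0..<card B}" using e by (auto simp: bij_betw_def)
      then show "monom 1 (e b) \<in> ?B0" by blast
    qed
    moreover have "coeff ?p (e b) = c b" if b: "b \<in> B" for b
    proof -
      have "coeff ?p (e b) = (\<Sum>b'\<in>B. if b' = b then c b' else 0)"
        unfolding coeff_sum
        by (intro sum.cong refl) (use b e in \<open>auto simp: bij_betw_def inj_on_def\<close>)
      then show ?thesis using B(1) b by simp
    qed
    then have "g ?p = x"
      unfolding g_def c by (intro finsum_cong') (use cl in auto)
    ultimately show ?thesis by blast
  qed
  ultimately have "\<exists>V co. coordinatized A V ?B0 g co"
    by (intro coordinatized_exists[of "poly_vs.span ?B0"]) auto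
  then show ?thesis by blast
qed

end

section \<open>Semiassociative algebras\<close>

locale etale_in_nucleus = coordinatized A V B0 g co
  for A :: "('f::field, 'a) module" (structure) and V B0 g co +
  fixes K :: "'a set" and Q :: "('a \<times> 'a) list"
  assumes K_subalgebra: "subalgebra_of K A" and K_nucleus: "K \<subseteq> nucleus A"
    and K_comm_algebra: "comm_assoc_algebra (A\<lparr>carrier := K\<rparr>)"
    and Q_separates: "comm_assoc_algebra.separates (A\<lparr>carrier := K\<rparr>) K Q"
begin

abbreviation "Kr \<equiv> A\<lparr>carrier := K\<rparr>"

sublocale Kr: comm_assoc_algebra Kr by (rule K_comm_algebra)

lemma K_closed:
  "\<one> \<in> K" "\<lbrakk>x \<in> K; y \<in> K\<rbrakk> \<Longrightarrow> x \<oplus> y \<in> K" "\<lbrakk>x \<in> K; y \<in> K\<rbrakk> \<Longrightarrow> x \<otimes> y \<in> K"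
  "x \<in> K \<Longrightarrow> c \<odot> x \<in> K"
  using K_subalgebra unfolding subalgebra_of_def by auto

lemma K_nuc: "x \<in> K \<Longrightarrow> x \<in> nucleus A"
  and K_carrier: "x \<in> K \<Longrightarrow> x \<in> carrier A"
  using K_nucleus nucleusD(1) by auto

lemma K_zero: "\<zero> \<in> K"
  using K_closed(4)[OF K_closed(1), of 0] by (simp add: smult_zero_left one_closed)

abbreviation "kp i \<equiv> co (fst (Q ! i))"
abbreviation "kq i \<equiv> co (snd (Q ! i))"

lemma Q_sum: "(\<Sum>(k, l)\<leftarrow>Q. F k l) = (\<Sum>i<length Q. F (fst (Q ! i)) (snd (Q ! i)))"
  for F :: "'a \<Rightarrow> 'a \<Rightarrow> 'f poly"
  unfolding sum_list_sum_nth by (simp add: atLeast0LessThan case_prod_unfold)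

lemma Q_mem: "i < length Q \<Longrightarrow> fst (Q ! i) \<in> K \<and> snd (Q ! i) \<in> K"
proof -
  assume "i < length Q"
  then have "Q ! i \<in> K \<times> K" using Q_separates nth_mem[of i Q] unfolding Kr.separates_def by auto
  then show ?thesis by (simp add: mem_Times_iff)
qed

lemma Q_swap:
  assumes "bilinear_map Kr \<beta>" "z \<in> K"
  shows "(\<Sum>(k, l)\<leftarrow>Q. \<beta> (z \<otimes>\<^bsub>Kr\<^esub> k) l) = (\<Sum>(k, l)\<leftarrow>Q. \<beta> k (z \<otimes>\<^bsub>Kr\<^esub> l))"
  using Q_separates assms unfolding Kr.separates_def by blast

text \<open>Test maps with polynomial values are all that is required: \<open>co\<close> itself is
  one, and a bilinear \<open>G\<close> on coordinates gives the test map sending x, y to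
  \<open>G (co x) (co y)\<close>.\<close>

lemma separable_bimodule_K:
  "separable_bimodule Polynomial.smult V B0 mul (co \<one>) (co ` K) (length Q) (\<lambda>i. kp i) (\<lambda>i. kq i)"
proof
  show "poly_vs.subspace (co ` K)"
    unfolding poly_vs.subspace_def
  proof (intro conjI ballI allI)
    show "0 \<in> co ` K" using K_zero co_zero by force
    show "x + y \<in> co ` K" if xy: "x \<in> co ` K" "y \<in> co ` K" for x y
    proof -
      obtain a b where ab: "a \<in> K" "x = co a" "b \<in> K" "y = co b" using xy by blast
      then have "x + y = co (a \<oplus> b)" by (simp add: co_add K_carrier)
      then show ?thesis using ab K_closed(2) by blast
    qed
    show "Polynomial.smult c x \<in> co ` K" if x: "x \<in> co ` K" for c x
    proof -
      obtain a where a: "a \<in> K" "x = co a" using x by blast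
      then have "Polynomial.smult c x = co (c \<odot> a)" by (simp add: co_smult K_carrier)
      then show ?thesis using a K_closed(4) by blast
    qed
  qed
  show "co ` K \<subseteq> V" using co_closed K_carrier by blast
  show "co \<one> \<in> co ` K" using K_closed(1) by blast
  show "mul k l \<in> co ` K" if "k \<in> co ` K" "l \<in> co ` K" for k l
    using that K_closed(3) by (auto simp: mul_co K_carrier)
  show "mul k l = mul l k" if "k \<in> co ` K" "l \<in> co ` K" for k l
    using that Kr.mult_comm by (auto simp: mul_co K_carrier)
  show "mul (mul k x) y = mul k (mul x y)" "mul (mul x y) k = mul x (mul y k)"
    if "k \<in> co ` K" for k x y
    using that nucleusD(2,4)[OF K_nuc] by (auto simp: mul_def g_co K_carrier m_closed g_closed)
  show "kp i \<in> co ` K" "kq i \<in> co ` K" if "i < length Q" for i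
    using Q_mem[OF that] by auto
  have "linear_map Kr co" unfolding linear_map_def by (simp add: co_add co_smult K_carrier)
  then have "(\<Sum>(k, l)\<leftarrow>Q. co (k \<otimes> l)) = co \<one>"
    using Q_separates unfolding Kr.separates_def by simp
  then show "(\<Sum>i<length Q. mul (kp i) (kq i)) = co \<one>"
    using Q_mem unfolding Q_sum by (simp add: mul_co K_carrier)
  show "(\<Sum>i<length Q. G (mul z (kp i)) (kq i)) = (\<Sum>i<length Q. G (kp i) (mul z (kq i)))"
    if G: "C.bilin G" and z: "z \<in> co ` K" for G z
  proof -
    obtain a where a: "a \<in> K" "z = co a" using z by blast
    have "bilinear_map Kr (\<lambda>x y. G (co x) (co y))"
      unfolding bilinear_map_def linear_map_def
      by (simp add: co_add co_smult K_carrier C.bilin_simps[OF G])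
    from Q_swap[OF this a(1)]
    have "(\<Sum>(k, l)\<leftarrow>Q. G (co (a \<otimes> k)) (co l)) = (\<Sum>(k, l)\<leftarrow>Q. G (co k) (co (a \<otimes> l)))"
      by simp
    then show ?thesis
      using Q_mem a(1) unfolding Q_sum a(2) by (simp add: mul_co K_carrier)
  qed
qed

sublocale W: separable_bimodule Polynomial.smult V B0 mul "co \<one>" "co ` K" "length Q"
  "\<lambda>i. kp i" "\<lambda>i. kq i"
  by (rule separable_bimodule_K)

text \<open>This links the module over the tensor algebra, in which minimal faithfulness is
  formulated, to the operators used in coordinates.\<close>

lemma act_as_op:
  assumes "keys f \<subseteq> K \<times> K"
  shows "\<exists>\<phi>\<in>W.ops. \<forall>a\<in>carrier A. co (act f a) = \<phi> (co a)"
  using assms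
proof (induction rule: mono_induct)
  case zero
  show ?case by (rule bexI[OF _ W.ops_zero]) (simp add: act_zero co_zero)
next
  case (mon p c)
  then obtain k l where p: "p = (k, l)" "k \<in> K" "l \<in> K" by blast
  show ?case
    by (rule bexI[OF _ W.ops_scale[OF W.ops.single, of "co k" "co l" c]])
      (use p in \<open>auto simp: act_mon K_carrier m_closed co_smult mul_co\<close>)
next
  case (add f1 f2)
  then obtain \<phi> \<psi> where "\<phi> \<in> W.ops" "\<forall>a\<in>carrier A. co (act f1 a) = \<phi> (co a)"
    "\<psi> \<in> W.ops" "\<forall>a\<in>carrier A. co (act f2 a) = \<psi> (co a)" by blast
  moreover have "keys f1 \<subseteq> C2" "keys f2 \<subseteq> C2"
    using add.hyps K_carrier by blast+
  ultimately show ?case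
    by (intro bexI[OF _ W.ops.add[of \<phi> \<psi>]]) (auto simp: act_add act_closed co_add)
qed

text \<open>A sub-bimodule \<open>U\<close> of the coordinate space corresponds to a submodule of
  \<open>A\<close>, and \<open>U / 0\<close> is a section of \<open>A\<close>. If operators killing
  \<open>U\<close> kill \<open>V\<close>, this section is faithful, so minimality yields the
  hypothesis of \<open>cyclic_generator\<close>.\<close>

lemma minimally_faithful_cyclic:
  assumes mf: "minimally_faithful (tensor_algebra Kr Kr) (two_sided_module A)"
  shows "\<exists>a\<in>V. W.cyc a = V"
proof (rule W.cyclic_generator)
  fix U assume U: "W.sub_bimodule U"
    and faithful: "\<And>f. \<lbrakk>f \<in> W.ops; \<forall>x\<in>U. f x = 0\<rbrakk> \<Longrightarrow> \<forall>x\<in>V. f x = 0"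
  let ?M = "two_sided_module A" and ?T = "tensor_algebra Kr Kr"
  let ?rel = "tensor_relations Kr Kr" and ?P = "pair_algebra Kr Kr"
  let ?U = "g ` U"
  have Us: "poly_vs.subspace U" "U \<subseteq> V" using U unfolding W.sub_bimodule_def by auto
  have UA: "?U \<subseteq> carrier A" using g_closed by blast
  have T_cases: "\<exists>f. keys f \<subseteq> K \<times> K \<and> r = ?rel +>\<^bsub>?P\<^esub> f" if "r \<in> carrier ?T" for r
    using that unfolding tensor_algebra_def quotient_module_simps A_RCOSETS_def'
    by (auto simp: pair_algebra_simps)
  have K2: "K \<subseteq> carrier A" using K_carrier by blast
  have kC: "keys f \<subseteq> C2" if "keys f \<subseteq> K \<times> K" for f :: "('a \<times> 'a) \<Rightarrow>\<^sub>0 'f"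
    using that K2 by blast
  have smult: "(?rel +>\<^bsub>?P\<^esub> f) \<odot>\<^bsub>?M\<^esub> a = act f a"
    if "keys f \<subseteq> K \<times> K" "a \<in> carrier A" for f a
    by (rule two_sided_smult_coset[OF K2 kC[OF that(1)] that(2)])
  have smult_U: "r \<odot>\<^bsub>?M\<^esub> a \<in> ?U" if r: "r \<in> carrier ?T" and a: "a \<in> ?U" for r a
  proof -
    obtain f where f: "keys f \<subseteq> K \<times> K" "r = ?rel +>\<^bsub>?P\<^esub> f" using T_cases[OF r] by blast
    obtain \<phi> where \<phi>: "\<phi> \<in> W.ops" "\<forall>a\<in>carrier A. co (act f a) = \<phi> (co a)"
      using act_as_op[OF f(1)] by blast
    obtain u where u: "u \<in> U" "a = g u" using a by blast
    have aA: "a \<in> carrier A" "co a = u" using u Us(2) by (auto simp: g_closed co_g)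
    have "act f a = g (\<phi> u)" using \<phi>(2) aA g_co[OF act_closed[OF kC[OF f(1)] aA(1)]] by metis
    then show ?thesis
      unfolding f(2) smult[OF f(1) aA(1)] using W.ops_sub_bimodule[OF \<phi>(1) U u(1)] by blast
  qed
  interpret M: abelian_group ?M
    by (rule abelian_groupI)
      (auto simp: two_sided_module_simps a_ac intro!: bexI[of _ "\<ominus> _"] l_neg)
  have M_minus: "\<ominus>\<^bsub>?M\<^esub> a = \<ominus> a" if "a \<in> carrier A" for a
    by (rule M.minus_equality) (use that in \<open>simp_all add: two_sided_module_simps l_neg\<close>)
  have submod: "submodule ?U ?T ?M"
  proof (intro submodule.intro submodule_axioms.intro smult_U)
    show "subgroup ?U (add_monoid ?M)"
    proof (rule M.add.subgroupI)
      show "?U \<subseteq> carrier ?M" using UA by (simp add: two_sided_module_simps)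
      show "?U \<noteq> {}" using Us(1) poly_vs.subspace_0 by blast
      show "\<ominus>\<^bsub>?M\<^esub> a \<in> ?U" if a: "a \<in> ?U" for a
      proof -
        obtain u where u: "u \<in> U" "a = g u" using a by blast
        then have "\<ominus>\<^bsub>?M\<^esub> a = g (Polynomial.smult (- 1) u)"
          unfolding g_smult by (simp add: smult_minus_one g_closed M_minus)
        then show ?thesis using u(1) Us(1) poly_vs.subspace_scale by blast
      qed
      show "a \<oplus>\<^bsub>?M\<^esub> b \<in> ?U" if ab: "a \<in> ?U" "b \<in> ?U" for a b
      proof -
        obtain u v where uv: "u \<in> U" "a = g u" "v \<in> U" "b = g v" using ab by blast
        then have "a \<oplus>\<^bsub>?M\<^esub> b = g (u + v)" by (simp add: g_add two_sided_module_simps)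
        then show ?thesis using uv Us(1) poly_vs.subspace_add by blast
      qed
    qed
  qed
  have zero_sub: "submodule {\<zero>} ?T ?M"
  proof (intro submodule.intro submodule_axioms.intro)
    show "subgroup {\<zero>} (add_monoid ?M)"
      by (rule M.add.subgroupI) (simp_all add: M_minus two_sided_module_simps)
    show "r \<odot>\<^bsub>?M\<^esub> a \<in> {\<zero>}" if r: "r \<in> carrier ?T" and a: "a \<in> {\<zero>}" for r a
    proof -
      obtain f where f: "keys f \<subseteq> K \<times> K" "r = ?rel +>\<^bsub>?P\<^esub> f" using T_cases[OF r] by blast
      obtain \<phi> where \<phi>: "\<phi> \<in> W.ops" "\<forall>a\<in>carrier A. co (act f a) = \<phi> (co a)"
        using act_as_op[OF f(1)] by blast
      have "co (act f \<zero>) = 0" using \<phi> W.ops_zero_arg co_zero by simp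
      then have "act f \<zero> = \<zero>"
        using g_co[OF act_closed[OF kC[OF f(1)] zero_closed]] g_zero by simp
      then show ?thesis using a smult[OF f(1) zero_closed] f(2) by simp
    qed
  qed
  let ?q = "quotient_module (?M\<lparr>carrier := ?U\<rparr>) {\<zero>}"
  have "faithful_module ?T ?q"
    unfolding faithful_module_def
  proof (intro ballI impI)
    fix r assume r: "r \<in> carrier ?T" and kill: "\<forall>X\<in>carrier ?q. r \<odot>\<^bsub>?q\<^esub> X = \<zero>\<^bsub>?q\<^esub>"
    obtain f where f: "keys f \<subseteq> K \<times> K" "r = ?rel +>\<^bsub>?P\<^esub> f" using T_cases[OF r] by blast
    obtain \<phi> where \<phi>: "\<phi> \<in> W.ops" "\<forall>a\<in>carrier A. co (act f a) = \<phi> (co a)"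
      using act_as_op[OF f(1)] by blast
    \<comment> \<open>Modulo the zero submodule the cosets are singletons, so the action on the
      quotient is the action on \<open>?U\<close>.\<close>
    have coset: "{\<zero>} +>\<^bsub>?M\<lparr>carrier := ?U\<rparr>\<^esub> a = {a}" if "a \<in> carrier A" for a
      unfolding a_r_coset_def r_coset_def using that by (simp add: two_sided_module_simps)
    have "\<phi> u = 0" if u: "u \<in> U" for u
    proof -
      have gu: "g u \<in> ?U" "g u \<in> carrier A" using u g_closed by auto
      have "{g u} \<in> carrier ?q"
        unfolding quotient_module_simps A_RCOSETS_def' using u coset[OF gu(2), symmetric] by auto
      then have "r \<odot>\<^bsub>?q\<^esub> {g u} = {\<zero>}" using kill unfolding quotient_module_simps by blast
      then have "{\<zero>} +>\<^bsub>?M\<lparr>carrier := ?U\<rparr>\<^esub> (r \<odot>\<^bsub>?M\<^esub> g u) = {\<zero>}"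
        unfolding quotient_module_simps by simp
      moreover have "r \<odot>\<^bsub>?M\<^esub> g u = act f (g u)" unfolding f(2) by (rule smult[OF f(1) gu(2)])
      ultimately have "act f (g u) = \<zero>"
        using coset[OF act_closed[OF kC[OF f(1)] gu(2)]] by simp
      then show ?thesis using \<phi>(2) gu(2) u Us(2) co_zero by (metis co_g subsetD)
    qed
    \<comment> \<open>Annihilation passes from \<open>U\<close> to \<open>V\<close> by the
      assumption on \<open>U\<close>; faithfulness of \<open>A\<close> itself then makes the tensor
      r zero.\<close>
    then have "\<phi> x = 0" if "x \<in> V" for x using faithful[OF \<phi>(1)] that by blast
    then have "act f a = \<zero>" if "a \<in> carrier A" for a
      using \<phi>(2) that co_closed g_co[OF act_closed[OF kC[OF f(1)] that]] g_zero by metis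
    then have "r \<odot>\<^bsub>?M\<^esub> a = \<zero>\<^bsub>?M\<^esub>" if "a \<in> carrier ?M" for a
      using that smult[OF f(1)] unfolding f(2) by (simp add: two_sided_module_simps)
    then show "r = \<zero>\<^bsub>?T\<^esub>"
      using mf r unfolding minimally_faithful_def faithful_module_def by blast
  qed
  moreover have "{\<zero>} \<subseteq> ?U" using g_zero poly_vs.subspace_0[OF Us(1)] by force
  ultimately have "?U = carrier ?M"
    using mf submod zero_sub unfolding minimally_faithful_def by blast
  then have gU: "g ` U = carrier A" by (simp add: two_sided_module_simps)
  show "U = V"
  proof
    show "V \<subseteq> U"
    proof
      fix x assume x: "x \<in> V"
      then obtain u where "u \<in> U" "g x = g u" using g_closed[of x] gU by blast
      then show "x \<in> U" using x Us(2) co_g by (metis subsetD)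
    qed
  qed (rule Us(2))
qed

end

section \<open>Passage to the semisimple quotient of the nucleus\<close>

context etale_in_nucleus
begin

abbreviation "Nr \<equiv> nucleus_algebra A"
abbreviation "J \<equiv> jacobson_radical Nr"
abbreviation "S \<equiv> sigma_algebra A"

lemma algebra_ideal_J: "algebra_ideal Nr J"
proof -
  interpret N: assoc_algebra Nr by (rule assoc_algebra_nucleus)
  show ?thesis
    by (intro algebra_ideal.intro assoc_algebra_nucleus N.ideal_jacobson_radical)
qed

lemma sub_bimodule_nucleus: "W.sub_bimodule (co ` nucleus A)"
  unfolding W.sub_bimodule_def poly_vs.subspace_def
proof (intro conjI ballI allI)
  show "0 \<in> co ` nucleus A" using nucleus_zero co_zero by force
  show "x + y \<in> co ` nucleus A" if xy: "x \<in> co ` nucleus A" "y \<in> co ` nucleus A" for x y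
  proof -
    obtain a b where ab: "a \<in> nucleus A" "x = co a" "b \<in> nucleus A" "y = co b" using xy by blast
    then have "x + y = co (a \<oplus> b)" by (simp add: co_add nucleusD(1))
    then show ?thesis using ab nucleus_add by blast
  qed
  show "Polynomial.smult c x \<in> co ` nucleus A" if x: "x \<in> co ` nucleus A" for c x
  proof -
    obtain a where a: "a \<in> nucleus A" "x = co a" using x by blast
    then have "Polynomial.smult c x = co (c \<odot> a)" by (simp add: co_smult nucleusD(1))
    then show ?thesis using a nucleus_smult by blast
  qed
  show "co ` nucleus A \<subseteq> V" using co_closed nucleusD(1) by blast
  show "mul k x \<in> co ` nucleus A" "mul x k \<in> co ` nucleus A"
    if "k \<in> co ` K" "x \<in> co ` nucleus A" for k x
    using that nucleus_mult K_nuc by (auto simp: mul_co K_carrier nucleusD(1))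
qed

text \<open>The separability idempotent and the generator of the nucleus are pushed along the
  quotient map, which preserves products and carries a generator to a generator. Semisimplicity of
  \<open>S\<close> is obtained from the maximal left ideals of the nucleus, all of which contain
  \<open>J\<close>.\<close>

lemma separable_sigma:
  assumes cyclic: "\<exists>a\<in>V. W.cyc a = V"
  shows "separable_algebra S"
proof -
  interpret N: assoc_algebra Nr by (rule assoc_algebra_nucleus)
  interpret I: algebra_ideal Nr J by (rule algebra_ideal_J)
  have S_def: "S = I.Q" by (simp add: sigma_algebra_def)
  interpret S: assoc_algebra S unfolding S_def by (rule I.assoc_algebra_Q)
  let ?N = "co ` nucleus A"
  let ?q = "\<lambda>x. J +>\<^bsub>Nr\<^esub> x"
  have q_simps: "?q x \<in> carrier S" "y \<in> nucleus A \<Longrightarrow> ?q x \<oplus>\<^bsub>S\<^esub> ?q y = ?q (x \<oplus> y)"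
    "y \<in> nucleus A \<Longrightarrow> ?q x \<otimes>\<^bsub>S\<^esub> ?q y = ?q (x \<otimes> y)" "c \<odot>\<^bsub>S\<^esub> ?q x = ?q (c \<odot> x)"
    if "x \<in> nucleus A" for x y c
    using that I.coset_in_Q[of x] I.Q_add[of x y] I.Q_mult[of x y] I.Q_smult[of x c]
    unfolding S_def by (simp_all add: nucleus_simps)
  have q_one: "\<one>\<^bsub>S\<^esub> = ?q \<one>" using I.Q_one unfolding S_def by (simp add: nucleus_simps)
  have q_surj: "\<exists>x\<in>nucleus A. X = ?q x" if "X \<in> carrier S" for X
    using that I.Q_cases[of X] unfolding S_def by (auto simp: nucleus_simps)
  have NV: "poly_vs.subspace ?N" "?N \<subseteq> V"
    using sub_bimodule_nucleus unfolding W.sub_bimodule_def by auto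
  obtain P where P: "Vector_Spaces.linear Polynomial.smult Polynomial.smult P" "\<And>x. P x \<in> ?N"
    "\<And>x. x \<in> ?N \<Longrightarrow> P x = x"
    using poly_vs.projection_exists[OF NV(1)] by blast
  have Plin: "P (x + y) = P x + P y" "P (Polynomial.smult c x) = Polynomial.smult c (P x)" for x y c
    using P(1) unfolding Vector_Spaces.linear_iff by auto
  have gP: "g (P x) \<in> nucleus A" for x
    using P(2)[of x] g_co nucleusD(1) by auto
  \<comment> \<open>\<open>g\<close> may leave the nucleus; composing with the projection
    \<open>P\<close> forces its values into the nucleus and keeps the map total and linear.\<close>
  define gS where "gS p = ?q (g (P p))" for p
  have gS_co: "gS (co x) = ?q x" if "x \<in> nucleus A" for x
    unfolding gS_def using P(3)[of "co x"] that by (simp add: g_co nucleusD(1))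
  have "\<exists>VS coS. coordinatized S VS B0 gS coS"
  proof (rule S.coordinatized_exists[OF NV(1) B0_finite])
    show "?N \<subseteq> poly_vs.span B0" using NV(2) V_span by blast
    show "gS (p + q) = gS p \<oplus>\<^bsub>S\<^esub> gS q" for p q
      unfolding gS_def using gP by (simp add: Plin g_add q_simps)
    show "gS (Polynomial.smult c p) = c \<odot>\<^bsub>S\<^esub> gS p" for c p
      unfolding gS_def using gP by (simp add: Plin g_smult q_simps)
    show "gS p \<in> carrier S" for p unfolding gS_def by (rule q_simps(1)[OF gP])
    show "\<exists>p\<in>?N. gS p = X" if X: "X \<in> carrier S" for X
      using q_surj[OF X] gS_co by blast
  qed
  then obtain VS coS where "coordinatized S VS B0 gS coS" by blast
  then interpret CS: coordinatized S VS B0 gS coS .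
  \<comment> \<open>The quotient map from the nucleus to \<open>S\<close> in coordinates. It is
    linear everywhere and multiplicative on \<open>?N\<close>.\<close>
  define j where "j p = coS (gS p)" for p
  have jV: "j p \<in> VS" for p unfolding j_def by (rule CS.co_closed[OF CS.g_closed])
  have gj: "gS (j p) = gS p" for p unfolding j_def by (rule CS.g_co[OF CS.g_closed])
  have j_add: "j (x + y) = j x + j y" and j_smult: "j (Polynomial.smult c x) = Polynomial.smult c (j x)"
    for x y c
    unfolding j_def by (simp_all add: CS.g_add CS.g_smult CS.co_add CS.co_smult CS.g_closed)
  have j_sum: "j (sum f X) = (\<Sum>i\<in>X. j (f i))" for f and X :: "nat set"
    using j_smult[of 0 0]
    by (induction X rule: infinite_finite_induct) (simp_all add: j_add)
  have j_mul: "j (mul x y) = CS.mul (j x) (j y)" if xy: "x \<in> ?N" "y \<in> ?N" for x y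
  proof -
    obtain a b where ab: "a \<in> nucleus A" "x = co a" "b \<in> nucleus A" "y = co b" using xy by blast
    have "gS (mul x y) = gS x \<otimes>\<^bsub>S\<^esub> gS y"
      using ab by (simp add: mul_co nucleusD(1) gS_co nucleus_mult q_simps)
    then show ?thesis unfolding CS.mul_def gj by (simp add: j_def)
  qed
  have j_one: "j (co \<one>) = coS \<one>\<^bsub>S\<^esub>"
    unfolding j_def q_one by (simp add: gS_co nucleus_one)
  have j_surj: "\<exists>x\<in>?N. v = j x" if v: "v \<in> VS" for v
  proof -
    obtain x where x: "x \<in> nucleus A" "gS v = ?q x" using q_surj[OF CS.g_closed] by blast
    then have "v = j (co x)" using CS.co_g[OF v] by (simp add: j_def gS_co)
    then show ?thesis using x(1) by blast
  qed
  have KN: "k \<in> ?N" if "k \<in> co ` K" for k using that K_nuc by blast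
  have mul_assoc: "CS.mul (CS.mul x y) z = CS.mul x (CS.mul y z)" for x y z
    by (simp add: CS.mul_def CS.g_co S.m_closed CS.g_closed S.m_assoc)
  interpret T: separable_bimodule Polynomial.smult VS B0 CS.mul "coS \<one>\<^bsub>S\<^esub>" "j ` co ` K" "length Q"
    "\<lambda>i. j (kp i)" "\<lambda>i. j (kq i)"
  proof
    show "poly_vs.subspace (j ` co ` K)"
      using W.subspace_K unfolding poly_vs.subspace_def
    proof (intro conjI ballI allI; elim conjE)
      assume sub: "0 \<in> co ` K" "\<forall>x\<in>co ` K. \<forall>y\<in>co ` K. x + y \<in> co ` K"
        "\<forall>c. \<forall>x\<in>co ` K. Polynomial.smult c x \<in> co ` K"
      have "0 = j 0" using j_smult[of 0 0] by simp
      then show "0 \<in> j ` co ` K" using sub(1) by (rule image_eqI)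
      show "x + y \<in> j ` co ` K" if xy: "x \<in> j ` co ` K" "y \<in> j ` co ` K" for x y
      proof -
        obtain a b where ab: "a \<in> co ` K" "x = j a" "b \<in> co ` K" "y = j b" using xy by blast
        then have "x + y = j (a + b)" by (simp add: j_add)
        then show ?thesis using sub(2) ab by blast
      qed
      show "Polynomial.smult c x \<in> j ` co ` K" if x: "x \<in> j ` co ` K" for c x
      proof -
        obtain a where a: "a \<in> co ` K" "x = j a" using x by blast
        then have "Polynomial.smult c x = j (Polynomial.smult c a)" by (simp add: j_smult)
        then show ?thesis using sub(3) a by blast
      qed
    qed
    show "j ` co ` K \<subseteq> VS" using jV by blast
    show "CS.mul k l \<in> j ` co ` K" "CS.mul k l = CS.mul l k"
      if kl: "k \<in> j ` co ` K" "l \<in> j ` co ` K" for k l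
    proof -
      obtain a b where ab: "a \<in> co ` K" "k = j a" "b \<in> co ` K" "l = j b" using kl by blast
      then have "CS.mul k l = j (mul a b)" "CS.mul l k = j (mul b a)" using j_mul KN by simp_all
      then show "CS.mul k l \<in> j ` co ` K" "CS.mul k l = CS.mul l k"
        using W.K_mul[OF ab(1,3)] W.K_comm[OF ab(1,3)] by simp_all
    qed
    show "coS \<one>\<^bsub>S\<^esub> \<in> j ` co ` K" unfolding j_one[symmetric] using W.unit_K by blast
    show "(\<Sum>i<length Q. CS.mul (j (kp i)) (j (kq i))) = coS \<one>\<^bsub>S\<^esub>"
      unfolding j_one[symmetric] W.pq_unit[symmetric] j_sum
      by (intro sum.cong refl j_mul[symmetric] KN) (use W.pK W.qK in auto)
    show "j (kp i) \<in> j ` co ` K" "j (kq i) \<in> j ` co ` K" if "i < length Q" for i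
      using W.pK[OF that] W.qK[OF that] by blast+
    show "(\<Sum>i<length Q. G (CS.mul z (j (kp i))) (j (kq i)))
        = (\<Sum>i<length Q. G (j (kp i)) (CS.mul z (j (kq i))))"
      if G: "CS.C.bilin G" and z: "z \<in> j ` co ` K" for G z
    proof -
      obtain a where a: "a \<in> co ` K" "z = j a" using z by blast
      have "C.bilin (\<lambda>x y. G (j x) (j y))"
        by (intro C.bilinI) (simp_all add: j_add j_smult CS.C.bilin_simps[OF G])
      from W.pq_swap[OF this a(1)] show ?thesis
        using j_mul[OF KN[OF a(1)] KN[OF W.pK]] j_mul[OF KN[OF a(1)] KN[OF W.qK]]
        unfolding a(2) by simp
    qed
  qed (simp_all add: mul_assoc)
  \<comment> \<open>A nonzero x lifts to some n outside \<open>J\<close>, so a maximal left ideal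
    \<open>M\<close> of the nucleus misses n; its image \<open>MS\<close> is the left ideal
    required.\<close>
  have max: "\<exists>M. CS.C.left_ideal_sp M \<and> x \<notin> M \<and>
      (\<forall>y\<in>VS - M. \<exists>r\<in>VS. coS \<one>\<^bsub>S\<^esub> - CS.mul r y \<in> M)" if x: "x \<in> VS" "x \<noteq> 0" for x
  proof -
    obtain n where n: "n \<in> nucleus A" "gS x = ?q n" using q_surj[OF CS.g_closed] by blast
    have "n \<notin> J"
    proof
      assume "n \<in> J"
      then have "gS x = \<zero>\<^bsub>S\<^esub>"
        using n I.a_rcos_const by (simp add: S_def I.Q_zero)
      then show False using x CS.co_g[OF x(1)] CS.co_zero by simp
    qed
    then obtain M where M: "maximal_left_ideal M Nr" "n \<notin> M"
      using n(1) unfolding jacobson_radical_def by (auto simp: nucleus_simps)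
    have Ml: "left_ideal M Nr" using M(1) by (simp add: maximal_left_ideal_def)
    note MD = N.left_idealD[OF Ml, unfolded nucleus_simps]
    have MA: "a \<in> carrier A" if "a \<in> M" for a using that MD(1) nucleusD(1) by blast
    have JM: "J \<subseteq> M" using N.jacobson_radicalD[OF _ M(1)] by blast
    \<comment> \<open>As \<open>M\<close> contains \<open>J\<close>, membership in \<open>M\<close>
      depends on the coset alone. So \<open>MS\<close> can be tested on any representative.\<close>
    have rep: "b \<in> M" if ab: "a \<in> M" "b \<in> nucleus A" "?q a = ?q b" for a b
    proof -
      have "a \<in> nucleus A" using ab MD(1) by blast
      then have "b \<in> ?q a" using ab I.coset_self[of b] by (simp add: nucleus_simps)
      then have "b \<ominus>\<^bsub>Nr\<^esub> a \<in> J" using I.in_coset_iff[of a b] \<open>a \<in> nucleus A\<close> by (simp add: nucleus_simps)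
      then have "(b \<ominus>\<^bsub>Nr\<^esub> a) \<oplus> a \<in> M" using MD(3)[OF _ ab(1)] JM by blast
      moreover have "(b \<ominus>\<^bsub>Nr\<^esub> a) \<oplus>\<^bsub>Nr\<^esub> a = b"
      proof -
        have "a \<in> carrier Nr" "b \<in> carrier Nr"
          using ab(2) \<open>a \<in> nucleus A\<close> by (simp_all add: nucleus_simps)
        then show ?thesis by (simp add: a_minus_def N.a_assoc N.l_neg)
      qed
      ultimately show ?thesis by (simp add: nucleus_simps)
    qed
    define MS where "MS = {v \<in> VS. \<exists>a\<in>M. gS v = ?q a}"
    have MS_iff: "v \<in> MS \<longleftrightarrow> v \<in> VS \<and> a \<in> M" if "gS v = ?q a" "a \<in> nucleus A" for v a
      using that rep unfolding MS_def by auto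
    have gS0: "gS 0 = ?q \<zero>" using gS_co[OF nucleus_zero] by (simp add: co_zero)
    have lid: "CS.C.left_ideal_sp MS"
      unfolding CS.C.left_ideal_sp_def poly_vs.subspace_def
    proof (intro conjI ballI allI)
      show "0 \<in> MS" using MS_iff[OF gS0 nucleus_zero] MD(2) CS.C.V_zero by simp
      show "x + y \<in> MS" if xy: "x \<in> MS" "y \<in> MS" for x y
      proof -
        obtain a b where ab: "x \<in> VS" "y \<in> VS" "a \<in> M" "gS x = ?q a" "b \<in> M" "gS y = ?q b"
          using xy unfolding MS_def by blast
        then have "gS (x + y) = ?q (a \<oplus> b)" using MD(1) by (simp add: CS.g_add q_simps subset_iff)
        then show ?thesis unfolding MS_def using ab CS.C.V_add MD(3) by blast
      qed
      show "Polynomial.smult c x \<in> MS" if xm: "x \<in> MS" for c x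
      proof -
        obtain a where a: "x \<in> VS" "a \<in> M" "gS x = ?q a" using xm unfolding MS_def by blast
        have an: "a \<in> nucleus A" using a MD(1) by blast
        have "gS (Polynomial.smult c x) = ?q (c \<odot> a)" using a(3) an by (simp add: CS.g_smult q_simps)
        moreover have "c \<odot> a = (c \<odot> \<one>) \<otimes> a"
          using MA[OF a(2)] by (simp add: smult_mult_l one_closed l_one)
        ultimately show ?thesis
          unfolding MS_def using a(1,2) CS.C.V_scale MD(5)[OF nucleus_smult[OF nucleus_one]] by auto
      qed
      show "MS \<subseteq> VS" unfolding MS_def by blast
      show "CS.mul r x \<in> MS" if r: "r \<in> VS" and xm: "x \<in> MS" for r x
      proof -
        obtain a where a: "x \<in> VS" "a \<in> M" "gS x = ?q a" using xm unfolding MS_def by blast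
        obtain b where b: "b \<in> nucleus A" "gS r = ?q b" using q_surj[OF CS.g_closed] by blast
        have "gS (CS.mul r x) = ?q (b \<otimes> a)"
          unfolding CS.g_mul a(3) b(2) using b(1) a(2) MD(1) by (simp add: q_simps subset_iff)
        then show ?thesis unfolding MS_def using CS.C.mul_closed[OF r a(1)] MD(5)[OF b(1) a(2)] by blast
      qed
    qed
    moreover have "x \<notin> MS" using MS_iff[OF n(2,1)] M(2) by simp
    moreover have "\<exists>r\<in>VS. coS \<one>\<^bsub>S\<^esub> - CS.mul r y \<in> MS" if y: "y \<in> VS - MS" for y
    proof -
      obtain b where b: "b \<in> nucleus A" "gS y = ?q b" using q_surj[OF CS.g_closed] by blast
      have "b \<notin> M" using MS_iff[OF b(2,1)] y by simp
      then obtain r where r: "r \<in> nucleus A" "\<one> \<ominus>\<^bsub>Nr\<^esub> r \<otimes> b \<in> M"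
        using N.maximal_left_ideal_inverse[OF M(1), of b] b(1) by (auto simp: nucleus_simps)
      have rb: "r \<otimes> b \<in> nucleus A" by (rule nucleus_mult[OF r(1) b(1)])
      have "\<ominus>\<^bsub>Nr\<^esub> (r \<otimes> b) = \<ominus> (r \<otimes> b)"
        by (rule N.minus_equality)
          (use rb nucleus_minus nucleusD(1) in \<open>simp_all add: nucleus_simps l_neg\<close>)
      then have diff: "\<one> \<ominus>\<^bsub>Nr\<^esub> r \<otimes> b = \<one> \<oplus> (- 1) \<odot> (r \<otimes> b)"
        using rb nucleusD(1) by (simp add: a_minus_def nucleus_simps(2) smult_minus_one)
      \<comment> \<open>The difference is written with the scalar -1, since \<open>gS\<close> is
        known to respect sums and scalar multiples.\<close>
      have "gS (coS \<one>\<^bsub>S\<^esub> + Polynomial.smult (- 1) (CS.mul (j (co r)) y))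
          = ?q (\<one> \<oplus> (- 1) \<odot> (r \<otimes> b))"
        unfolding CS.g_add CS.g_smult CS.g_mul gj gS_co[OF r(1)] b(2)
        using r(1) b(1) rb by (simp add: CS.g_co q_one q_simps nucleus_one nucleus_smult)
      then have "gS (coS \<one>\<^bsub>S\<^esub> - CS.mul (j (co r)) y) = ?q (\<one> \<ominus>\<^bsub>Nr\<^esub> r \<otimes> b)"
        unfolding diff by simp
      moreover have "coS \<one>\<^bsub>S\<^esub> - CS.mul (j (co r)) y \<in> VS"
        using y by (intro CS.C.V_diff CS.C.mul_closed jV CS.C.unit_in) simp
      ultimately have "coS \<one>\<^bsub>S\<^esub> - CS.mul (j (co r)) y \<in> MS"
        unfolding MS_def using r(2) by blast
      then show ?thesis using jV by blast
    qed
    ultimately show ?thesis by blast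
  qed
  obtain n0 where n0: "n0 \<in> ?N" "W.cyc n0 = ?N"
    using cyclic W.cyc_summand[OF _ _ sub_bimodule_nucleus] by blast
  have jT: "T.sub_bimodule (T.cyc (j n0))" by (rule T.sub_bimodule_cyc[OF jV])
  \<comment> \<open>The map j turns a sandwich by elements of \<open>K\<close> into a sandwich by
    their images, so the image of every operator value stays in the cyclic sub-bimodule generated by
    \<open>j x\<close>.\<close>
  have j_ops: "j (f x) \<in> T.cyc (j x)" if f: "f \<in> W.ops" and x: "x \<in> ?N" for f x
    using f
  proof induction
    case (single k l)
    have kx: "mul k x \<in> ?N"
      using sub_bimodule_nucleus single x unfolding W.sub_bimodule_def by blast
    have "j (mul (mul k x) l) = CS.mul (CS.mul (j k) (j x)) (j l)"
      using j_mul[OF kx KN] j_mul[OF KN x] single by simp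
    then show ?case using T.cycI[OF T.ops.single[of "j k" "j l"]] single by blast
  next
    case (add f g)
    then show ?case
      using T.sub_bimodule_cyc[OF jV[of x]] unfolding T.sub_bimodule_def
      by (simp add: j_add poly_vs.subspace_add)
  next
    case (eq_on f g)
    then show ?case using x NV(2) by auto
  qed
  have cycT: "T.cyc (j n0) = VS"
  proof
    show "T.cyc (j n0) \<subseteq> VS" using jT unfolding T.sub_bimodule_def by blast
    show "VS \<subseteq> T.cyc (j n0)"
    proof
      fix v assume "v \<in> VS"
      then obtain x where x: "x \<in> ?N" "v = j x" using j_surj by blast
      then obtain f where "f \<in> W.ops" "x = f n0" using n0(2) unfolding W.cyc_def by blast
      then show "v \<in> T.cyc (j n0)" using j_ops n0(1) x(2) by blast
    qed
  qed
  obtain B cB where B: "finite B" "B \<subseteq> VS"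
    "\<And>b. Vector_Spaces.linear Polynomial.smult (*) (cB b)"
    "\<And>x. x \<in> VS \<Longrightarrow> x = (\<Sum>b\<in>B. Polynomial.smult (cB b x) b)"
    "\<And>b b'. b \<in> B \<Longrightarrow> b' \<in> B \<Longrightarrow> cB b b' = (if b = b' then 1 else 0)"
    using poly_vs.coordinates_exist[OF CS.V_subspace B0_finite CS.V_span] by blast
  interpret SC: separable_core Polynomial.smult VS B0 CS.mul "coS \<one>\<^bsub>S\<^esub>" "j ` co ` K" "length Q"
    "\<lambda>i. j (kp i)" "\<lambda>i. j (kq i)" B cB "j n0"
  proof (intro separable_core.intro T.separable_bimodule_axioms semisimple_algebra.intro
      CS.C.fd_algebra_axioms semisimple_algebra_axioms.intro separable_core_axioms.intro max)
  qed (use B cycT jV mul_assoc in simp_all)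
  obtain u y M where uy: "\<forall>b\<in>B. u b \<in> VS \<and> y b \<in> VS"
    "\<forall>s\<in>VS. \<forall>b\<in>B. CS.mul s (u b) = (\<Sum>b'\<in>B. Polynomial.smult (M s b' b) (u b')) \<and>
       CS.mul (y b) s = (\<Sum>b'\<in>B. Polynomial.smult (M s b b') (y b'))"
    "(\<Sum>b\<in>B. CS.mul (u b) (y b)) = coS \<one>\<^bsub>S\<^esub>"
    using SC.dual_bases by blast
  interpret ES: enveloping_algebra S by (intro enveloping_algebra.intro S.assoc_algebra_axioms)
  show ?thesis
  proof (rule ES.separability_criterion[where u = "\<lambda>b. gS (u b)" and y = "\<lambda>b. gS (y b)"
        and M = "\<lambda>s. M (coS s)" and B = B])
    show "finite B" by (rule B(1))
    show "gS (u b) \<in> carrier S" "gS (y b) \<in> carrier S" for b by (rule CS.g_closed)+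
    show "s \<otimes>\<^bsub>S\<^esub> gS (u i) = (\<Oplus>\<^bsub>S\<^esub>j\<in>B. M (coS s) j i \<odot>\<^bsub>S\<^esub> gS (u j))"
      "gS (y i) \<otimes>\<^bsub>S\<^esub> s = (\<Oplus>\<^bsub>S\<^esub>j\<in>B. M (coS s) i j \<odot>\<^bsub>S\<^esub> gS (y j))"
      if s: "s \<in> carrier S" and i: "i \<in> B" for s i
    proof -
      have "gS (CS.mul (coS s) (u i)) = gS (\<Sum>j\<in>B. Polynomial.smult (M (coS s) j i) (u j))"
        "gS (CS.mul (y i) (coS s)) = gS (\<Sum>j\<in>B. Polynomial.smult (M (coS s) i j) (y j))"
        using uy(2) CS.co_closed[OF s] i by simp_all
      then show "s \<otimes>\<^bsub>S\<^esub> gS (u i) = (\<Oplus>\<^bsub>S\<^esub>j\<in>B. M (coS s) j i \<odot>\<^bsub>S\<^esub> gS (u j))"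
        "gS (y i) \<otimes>\<^bsub>S\<^esub> s = (\<Oplus>\<^bsub>S\<^esub>j\<in>B. M (coS s) i j \<odot>\<^bsub>S\<^esub> gS (y j))"
        using s by (simp_all add: CS.g_mul CS.g_co CS.g_sum[OF B(1)] CS.g_smult)
    qed
    have "gS (\<Sum>b\<in>B. CS.mul (u b) (y b)) = gS (coS \<one>\<^bsub>S\<^esub>)" using uy(3) by simp
    then show "(\<Oplus>\<^bsub>S\<^esub>b\<in>B. gS (u b) \<otimes>\<^bsub>S\<^esub> gS (y b)) = \<one>\<^bsub>S\<^esub>"
      by (simp add: CS.g_sum[OF B(1)] CS.g_mul CS.g_co)
  qed
qed

end

theorem theorem12p3:
  fixes A :: "('f::field, 'a) module"
  assumes "semiassociative A"
  shows "separable_algebra (sigma_algebra A)"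
proof -
  obtain K where A: "nonassoc_algebra A" "finite_dimensional_algebra A"
    and K: "subalgebra_of K A" "K \<subseteq> nucleus A" "etale_algebra (A\<lparr>carrier := K\<rparr>)"
      "minimally_faithful (tensor_algebra (A\<lparr>carrier := K\<rparr>) (A\<lparr>carrier := K\<rparr>)) (two_sided_module A)"
    using assms unfolding semiassociative_def by blast
  interpret A: nonassoc_algebra A by (rule A(1))
  obtain V B0 g co where "coordinatized A V B0 g co"
    using A.coordinatized_finite_dimensional[OF A(2)] by blast
  moreover obtain Q where "comm_assoc_algebra.separates (A\<lparr>carrier := K\<rparr>) K Q"
    using etale_separates(2)[OF K(3)] by auto
  ultimately interpret etale_in_nucleus A V B0 g co K Q
    using K(1,2) etale_separates(1)[OF K(3)]
    by (intro etale_in_nucleus.intro etale_in_nucleus_axioms.intro)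
  show ?thesis by (rule separable_sigma[OF minimally_faithful_cyclic[OF K(4)]])
qed

end
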